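(* Let $1<p<\infty$ and let $P$ be a prime ideal in $H^\infty$. Then $P$ is the trace of some prime ideal $Q$ in $N^p$ (i.e. $P=Q\cap H^\infty$ for some prime ideal $Q$ of $N^p$) if and only if $P$ contains no outer function $F$ for which $\log|F^*|\in L^p(T)$. When this is the case, $Q$ is the unique prime ideal in $N^p$ with $P=Q\cap H^\infty$, and $Q=PN^p$.
   Context: $D$ is the open unit disk in $\mathbb{C}$, $T=\partial D$. $H^\infty$ is the ring of bounded holomorphic functions on $D$. For $1<p<\infty$, $N^p$ is the ring (under pointwise operations) of holomorphic $f$ on $D$ with $\sup_{0<r<1}\int_0^{2\pi}\big(\log^+|f(re^{i\theta})|\big)^p\,\frac{d\theta}{2\pi}<\infty$, where $\log^+ x=\max(\log x,0)$ for $x\ge 0$ (so $\log^+0=0$); it contains $H^\infty$. $F^*(e^{i\theta})=\lim_{r\to1}F(re^{i\theta})$ denotes the radial boundary function (defined a.e.). An outer function is a holomorphic function on $D$ of the form $F(z)=\lambda\exp\Big(\frac1{2\pi}\int_0^{2\pi}\frac{e^{it}+z}{e^{it}-z}\log|F^*(e^{it})|\,dt\Big)$ with $|\lambda|=1$ and $\log|F^*|\in L^1(T)$. A prime ideal in a ring $R$ is a proper ideal $P$ such that $fg\in P$ with $f,g\in R$ implies $f\in P$ or $g\in P$. $PN^p$ denotes the ideal of $N^p$ generated by $P$. *)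

theory Defs
  imports "HOL-Complex_Analysis.Complex_Analysis" "HOL-Algebra.Ideal"
begin

abbreviation unit_disc :: "complex set" where
  "unit_disc \<equiv> ball 0 1"

text \<open>
  Functions on the unit disc are represented by functions on \<^typ>\<open>complex\<close> that are
  \<^const>\<open>extensional\<close>, so that equality of ring elements is equality on the disc.
\<close>

definition disc_ring :: "(complex \<Rightarrow> complex) set \<Rightarrow> (complex \<Rightarrow> complex) ring" where
  "disc_ring A =
     \<lparr> carrier = {f \<in> extensional unit_disc. f \<in> A},
       mult = (\<lambda>f g. \<lambda>z\<in>unit_disc. f z * g z),
       one = (\<lambda>z\<in>unit_disc. 1),
       zero = (\<lambda>z\<in>unit_disc. 0),
       add = (\<lambda>f g. \<lambda>z\<in>unit_disc. f z + g z) \<rparr>"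

definition Hinf :: "(complex \<Rightarrow> complex) ring" where
  "Hinf = disc_ring {f. f holomorphic_on unit_disc \<and> bounded (f ` unit_disc)}"

text \<open>Since \<^term>\<open>ln (0::real) = 0\<close>, the value at 0 is 0, as required.\<close>

definition log_plus :: "real \<Rightarrow> real" where
  "log_plus x = max (ln x) 0"

definition Np :: "real \<Rightarrow> (complex \<Rightarrow> complex) ring" where
  "Np p = disc_ring {f. f holomorphic_on unit_disc \<and>
     (SUP r\<in>{0<..<1}. \<integral>\<^sup>+t\<in>{0..2*pi}.
        ennreal (log_plus (norm (f (of_real r * cis t))) powr p / (2 * pi)) \<partial>lborel) < \<infinity>}"

abbreviation circle_measure :: "real measure" where
  "circle_measure \<equiv> lebesgue_on {0..2*pi}"

text \<open>Unspecified at points where the radial limit does not exist.\<close>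

definition radial_limit :: "(complex \<Rightarrow> complex) \<Rightarrow> complex \<Rightarrow> complex" where
  "radial_limit F \<zeta> = Lim (at_left (1::real)) (\<lambda>r. F (of_real r * \<zeta>))"

text \<open>
  The boundary function has to exist almost everywhere. It also has to be
  nonzero almost everywhere: where it vanishes, its logarithmic modulus is \<open>-\<infinity>\<close>,
  whereas \<^term>\<open>ln (0::real) = 0\<close>.
\<close>

definition log_boundary_in_Lp :: "real \<Rightarrow> (complex \<Rightarrow> complex) \<Rightarrow> bool" where
  "log_boundary_in_Lp p F \<longleftrightarrow>
     (AE t in circle_measure.
        ((\<lambda>r. F (of_real r * cis t)) \<longlongrightarrow> radial_limit F (cis t)) (at_left (1::real)) \<and>
        radial_limit F (cis t) \<noteq> 0) \<and>
     (\<lambda>t. ln (norm (radial_limit F (cis t)))) \<in> borel_measurable circle_measure \<and>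
     integrable circle_measure (\<lambda>t. \<bar>ln (norm (radial_limit F (cis t)))\<bar> powr p)"

definition outer_function :: "(complex \<Rightarrow> complex) \<Rightarrow> bool" where
  "outer_function F \<longleftrightarrow>
     F holomorphic_on unit_disc \<and> log_boundary_in_Lp 1 F \<and>
     (\<exists>c. norm c = 1 \<and>
        (\<forall>z\<in>unit_disc. F z = c * exp (1 / (2 * of_real pi) *
           (\<integral>t. (cis t + z) / (cis t - z) * of_real (ln (norm (radial_limit F (cis t))))
              \<partial>circle_measure))))"

end

theory Submission
  imports Defs "HOL-Probability.Probability" "HOL-Real_Asymp.Real_Asymp"
begin

text \<open>
  The ring \<open>N\<^sup>p\<close> is a ring of fractions of \<open>H\<^sup>\<infinity>\<close>: every element is a quotient \<open>h/F\<close> with \<open>h\<close>, \<open>F\<close> bounded and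
  \<open>F\<close> outer with \<open>log |F*| \<in> L\<^sup>p\<close>, and such \<open>F\<close> are units of \<open>N\<^sup>p\<close>. Prime ideals of a ring of fractions
  correspond to the primes of the original ring that contain no denominator, and the prime over \<open>P\<close> is
  the extended ideal; this is \<open>prime_contraction_localization\<close>.

  The denominators are units since \<open>log |F|\<close> is the Poisson integral of \<open>log |F*|\<close> and Poisson
  integration does not increase \<open>L\<^sup>p\<close> means (\<open>outer_function_inverse_in_Np\<close>).

  To find a denominator for \<open>f \<in> N\<^sup>p\<close> one needs a holomorphic \<open>g\<close> without zeros such that
  \<open>- log |g| \<ge> log\<^sup>+ |f|\<close> and the \<open>L\<^sup>p\<close> means of \<open>log |g|\<close> are bounded. On a circle of radius \<open>r < 1\<close> the continuous
  function \<open>log\<^sup>+ |f|\<close> is nearly the real part of an entire function, and the maximum principle carries the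
  inequality inside; a normal family argument lets \<open>r \<rightarrow> 1\<close> (\<open>outer_denominator\<close>).

  That \<open>g\<close> is outer with \<open>log |g*| \<in> L\<^sup>p\<close> is where \<open>p > 1\<close> is decisive. Functions bounded in \<open>L\<^sup>p\<close> with
  \<open>p > 1\<close> are uniformly integrable, so \<open>log |g(r e\<^sup>i\<^sup>t)|\<close> converges in \<open>L\<^sup>1\<close> as soon as it converges almost everywhere,
  and then the Schwarz formula on the circles of radius \<open>r < 1\<close> turns into the representation of \<open>g\<close> by its
  boundary values (\<open>outer_function_criterion\<close>).

  Convergence almost everywhere is Fatou's theorem on radial limits of bounded holomorphic functions
  (\<open>Fatou_radial_limits\<close>). It is derived here from an \<open>L\<^sup>2\<close> maximal inequality: the Poisson operator with a
  radius that depends on the boundary point is bounded by the \<open>T T*\<close> method, since the kernel of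
  \<open>T T*\<close> is dominated by the kernels of \<open>T\<close> and \<open>T*\<close> (\<open>kernel_compose_le\<close>).
\<close>

section \<open>Normalized arc length and the mean value property\<close>

text \<open>
  Normalized arc length, carried by \<open>[0, 2\<pi>]\<close> but with all Borel sets of the line measurable.
  Functions of a boundary point enter as functions of \<open>t\<close> through \<^term>\<open>cis t\<close>, so they need
  no restriction to the interval, and Tonelli's theorem applies to Borel functions on the plane.
\<close>

definition circ :: "real measure" where
  "circ = uniform_measure lborel {0..2*pi}"

lemma sets_circ [simp, measurable_cong]: "sets circ = sets borel"
  by (simp add: circ_def)

lemma space_circ [simp]: "space circ = UNIV"
  by (simp add: circ_def)

interpretation circ: prob_space circ
  unfolding circ_def by (rule prob_space_uniform_measure) auto

interpretation circ2: pair_prob_space circ circ ..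

lemma nn_integral_circ:
  assumes [measurable]: "f \<in> borel_measurable borel"
  shows "(\<integral>\<^sup>+t. f t \<partial>circ) = (\<integral>\<^sup>+t\<in>{0..2*pi}. f t \<partial>lborel) / ennreal (2*pi)"
  unfolding circ_def by (subst nn_integral_uniform_measure) (auto simp: mult.commute)

lemma circ_eq_density:
  "circ = density lborel (\<lambda>t. ennreal (indicator {0..2*pi} t / (2*pi)))"
  unfolding circ_def uniform_measure_def
  by (intro density_cong) (auto simp: indicator_def divide_ennreal simp flip: ennreal_1)

lemma integral_circ:
  fixes f :: "real \<Rightarrow> 'b :: euclidean_space"
  assumes [measurable]: "f \<in> borel_measurable borel"
  shows "(\<integral>t. f t \<partial>circ) = (\<integral>t. f t \<partial>lebesgue_on {0..2*pi}) /\<^sub>R (2*pi)"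
proof -
  have "(\<integral>t. f t \<partial>circ) = (\<integral>t. (indicator {0..2*pi} t / (2*pi)) *\<^sub>R f t \<partial>lborel)"
    unfolding circ_eq_density by (subst integral_density) auto
  also have "\<dots> = (\<integral>t. (indicator {0..2*pi} t *\<^sub>R f t) /\<^sub>R (2*pi) \<partial>lborel)"
    by (simp add: field_simps)
  also have "\<dots> = (\<integral>t. indicator {0..2*pi} t *\<^sub>R f t \<partial>lborel) /\<^sub>R (2*pi)"
    by (rule integral_scaleR_right)
  also have "(\<integral>t. indicator {0..2*pi} t *\<^sub>R f t \<partial>lborel) = (\<integral>t. f t \<partial>lebesgue_on {0..2*pi})"
    by (subst integral_restrict_space) (auto simp: integral_completion)
  finally show ?thesis .
qed

lemma integrable_circ_bounded:
  fixes f :: "real \<Rightarrow> 'b :: {banach, second_countable_topology}"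
  assumes "f \<in> borel_measurable borel" "\<And>t. norm (f t) \<le> B"
  shows "integrable circ f"
  using assms by (intro circ.integrable_const_bound[of _ B]) auto

lemma continuous_cis_comp:
  assumes "continuous_on (sphere 0 r) f" "r \<ge> 0"
  shows "continuous_on A (\<lambda>t. f (of_real r * cis t))"
  by (rule continuous_on_compose2[OF assms(1)]) (auto intro!: continuous_intros simp: norm_mult assms(2))

lemma circ_cis_comp:
  fixes f :: "complex \<Rightarrow> 'b :: euclidean_space"
  assumes "continuous_on (sphere 0 r) f" "r \<ge> 0"
  shows measurable_circle_comp: "(\<lambda>t. f (of_real r * cis t)) \<in> borel_measurable borel"
    and integrable_circle_comp: "integrable circ (\<lambda>t. f (of_real r * cis t))"
proof -
  show *: "(\<lambda>t. f (of_real r * cis t)) \<in> borel_measurable borel"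
    using continuous_cis_comp[OF assms] by (rule borel_measurable_continuous_onI)
  have "compact (f ` sphere 0 r)"
    using assms by (intro compact_continuous_image) auto
  then obtain B where "\<And>x. x \<in> f ` sphere 0 r \<Longrightarrow> norm x \<le> B"
    by (meson bounded_iff compact_imp_bounded)
  then show "integrable circ (\<lambda>t. f (of_real r * cis t))"
    using * assms by (intro integrable_circ_bounded[of _ B]) (auto simp: norm_mult)
qed

lemmas circ_cis_comp1 = circ_cis_comp[of 1, simplified]

lemma Cauchy_circ:
  assumes "continuous_on (cball 0 1) F" "F holomorphic_on ball 0 1" "norm z < 1"
  shows "(\<integral>t. F (cis t) * (cis t / (cis t - z)) \<partial>circ) = F z"
proof -
  have "((\<lambda>u. F u / (u - z)) has_contour_integral 2 * of_real pi * \<i> * F z) (circlepath 0 1)"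
    by (rule Cauchy_integral_circlepath) (use assms in auto)
  then have I: "((\<lambda>t. F (cis t) / (cis t - z) * \<i> * cis t) has_integral 2 * of_real pi * \<i> * F z) {0..2*pi}"
    unfolding circlepath_def by (subst (asm) has_contour_integral_part_circlepath_iff) auto
  have nz: "w \<noteq> z" if "norm w = 1" for w
    using that assms(3) by auto
  have c: "continuous_on (sphere 0 1) (\<lambda>w. F w * (w / (w - z)))"
    by (intro continuous_intros continuous_on_subset[OF assms(1)]) (auto dest: nz)
  have 1: "((\<lambda>t. F (cis t) * (cis t / (cis t - z))) has_integral 2 * of_real pi * F z) {0..2*pi}"
    using has_integral_mult_left[OF I, of "- \<i>"] by (simp add: algebra_simps)
  have "integrable (lebesgue_on {0..2*pi}) (\<lambda>t. F (cis t) * (cis t / (cis t - z)))"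
    using continuous_cis_comp[OF c, of "{0..2*pi}"]
    by (intro continuous_imp_integrable_real) auto
  then have "(\<integral>t. F (cis t) * (cis t / (cis t - z)) \<partial>lebesgue_on {0..2*pi}) = 2 * of_real pi * F z"
    by (intro has_integral_unique[OF has_integral_integral_lebesgue_on 1]) auto
  then show ?thesis
    using circ_cis_comp1(1)[OF c] by (simp add: integral_circ scaleR_conv_of_real)
qed

lemma mean_value_circ:
  assumes "continuous_on (cball 0 1) F" "F holomorphic_on ball 0 1"
  shows "(\<integral>t. F (cis t) \<partial>circ) = F 0"
  using Cauchy_circ[OF assms, of 0] by simp

section \<open>The Poisson and Schwarz integral formulas\<close>

definition poisson :: "complex \<Rightarrow> real \<Rightarrow> real" where
  "poisson z s = (1 - (norm z)\<^sup>2) / (norm (cis s - z))\<^sup>2"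

lemma cis_measurable [measurable]: "cis \<in> borel_measurable borel"
  by (intro borel_measurable_continuous_onI continuous_intros)

lemma poisson_measurable [measurable (raw)]:
  assumes [measurable]: "f \<in> borel_measurable M" "g \<in> borel_measurable M"
  shows "(\<lambda>x. poisson (f x) (g x)) \<in> borel_measurable M"
  unfolding poisson_def by measurable

lemma cis_ne_disc: "norm z < 1 \<Longrightarrow> cis s \<noteq> z"
  by auto

lemma poisson_pos: "norm z < 1 \<Longrightarrow> poisson z s > 0"
  unfolding poisson_def by (intro divide_pos_pos) (auto simp: power_less_one_iff)

lemma poisson_nonneg: "norm z < 1 \<Longrightarrow> poisson z s \<ge> 0"
  using poisson_pos[of z s] by simp

lemma norm_cis_diff_ge: "1 - norm z \<le> norm (cis s - z)"
  using norm_triangle_ineq2[of "cis s" z] by simp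

lemma poisson_le:
  assumes "norm z \<le> R" "R < 1"
  shows "poisson z s \<le> 1 / (1 - R)\<^sup>2"
  unfolding poisson_def
proof (rule frac_le)
  show "(1 - R)\<^sup>2 \<le> (cmod (cis s - z))\<^sup>2"
    using norm_cis_diff_ge[of z s] assms by (intro power_mono) auto
qed (use assms in auto)

lemma abs_poisson_le:
  assumes "norm z < 1"
  shows "\<bar>poisson z s\<bar> \<le> 1 / (1 - norm z)\<^sup>2"
  using poisson_le[of z "norm z" s] poisson_nonneg[OF assms, of s] assms by simp

lemma poisson_eq_Re: "norm z < 1 \<Longrightarrow> poisson z s = Re ((cis s + z) / (cis s - z))"
proof -
  have "Re (((cis s + z) * cnj (cis s - z))) = 1 - (norm z)\<^sup>2"
    unfolding cmod_power2 using sin_cos_squared_add[of s]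
    by (simp add: algebra_simps power2_eq_square)
  then show ?thesis
    unfolding poisson_def complex_div_cnj[of "cis s + z"] by (simp add: Re_divide_of_real flip: of_real_power)
qed

lemma integrable_poisson_mult:
  fixes f :: "real \<Rightarrow> 'b :: {banach, second_countable_topology}"
  assumes "norm z < 1" "integrable circ f"
  shows "integrable circ (\<lambda>s. poisson z s *\<^sub>R f s)"
proof (rule Bochner_Integration.integrable_bound[OF integrable_scaleR_right[of "1 / (1 - norm z)\<^sup>2", OF assms(2)]])
  show "(\<lambda>s. poisson z s *\<^sub>R f s) \<in> borel_measurable circ"
    using borel_measurable_integrable[OF assms(2)] by measurable
  show "AE s in circ. norm (poisson z s *\<^sub>R f s) \<le> norm ((1 / (1 - norm z)\<^sup>2) *\<^sub>R f s)"
    using mult_right_mono[OF abs_poisson_le[OF assms(1)], of "norm (f _)"] by (intro AE_I2) simp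
qed

text \<open>
  Cauchy's formula reproduces \<open>F(z)\<close> with the kernel \<open>\<zeta>/(\<zeta> - z)\<close>, which is neither real nor positive.
  Multiplying \<open>F\<close> by \<open>(1 - |z|\<^sup>2)/(1 - \<zeta> z*)\<close>, with \<open>z*\<close> the conjugate of \<open>z\<close>, keeps it holomorphic in
  \<open>\<zeta>\<close> and does not change its value at \<open>z\<close>, and on the circle it turns the Cauchy kernel into the
  Poisson kernel.
\<close>

lemma poisson_formula:
  assumes F: "continuous_on (cball 0 1) F" "F holomorphic_on ball 0 1" and z: "norm z < 1"
  shows "(\<integral>s. poisson z s *\<^sub>R F (cis s) \<partial>circ) = F z"
proof -
  define G where "G w = F w * ((1 - (norm z)\<^sup>2) / (1 - cnj z * w))" for w
  have nz: "1 - cnj z * w \<noteq> 0" if "norm w \<le> 1" for w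
  proof
    assume "1 - cnj z * w = 0"
    then have "norm (cnj z * w) = 1" by simp
    moreover have "norm (cnj z * w) \<le> norm z"
      using that by (simp add: norm_mult mult_left_le)
    ultimately show False using z by simp
  qed
  have "(\<integral>t. G (cis t) * (cis t / (cis t - z)) \<partial>circ) = G z"
    unfolding G_def by (rule Cauchy_circ) (use F z nz in \<open>auto intro!: continuous_intros holomorphic_intros\<close>)
  also have "G z = F z"
  proof -
    have "(complex_of_real (norm z))\<^sup>2 = cnj z * z"
      by (metis complex_norm_square of_real_power mult.commute)
    then show ?thesis using nz[of z] z unfolding G_def by simp
  qed
  also have "(\<lambda>t. G (cis t) * (cis t / (cis t - z))) = (\<lambda>t. poisson z t *\<^sub>R F (cis t))"
  proof
    fix t
    have "(1 - cnj z * cis t) * (cis t - z) = cis t * of_real ((norm (cis t - z))\<^sup>2)"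
      unfolding complex_norm_square
      by (simp add: algebra_simps cis_cnj cis_mult)
    moreover have "(1 - cnj z * cis t) \<noteq> 0" "cis t - z \<noteq> 0"
      using nz[of "cis t"] cis_ne_disc[OF z] by auto
    ultimately have "cis t / ((1 - cnj z * cis t) * (cis t - z)) = 1 / of_real ((norm (cis t - z))\<^sup>2)"
      by simp
    moreover have "G (cis t) * (cis t / (cis t - z)) =
        F (cis t) * of_real (1 - (norm z)\<^sup>2) * (cis t / ((1 - cnj z * cis t) * (cis t - z)))"
      unfolding G_def by simp
    ultimately show "G (cis t) * (cis t / (cis t - z)) = poisson z t *\<^sub>R F (cis t)"
      unfolding poisson_def scaleR_conv_of_real by (simp only:) simp
  qed
  finally show ?thesis .
qed

lemma poisson_integral_1:
  assumes "norm z < 1"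
  shows "(\<integral>s. poisson z s \<partial>circ) = 1"
proof -
  have "(\<integral>s. complex_of_real (poisson z s) \<partial>circ) = 1"
    using poisson_formula[of "\<lambda>_. 1" z] assms by (simp add: scaleR_conv_of_real)
  then show ?thesis by simp
qed

lemma integrable_poisson: "norm z < 1 \<Longrightarrow> integrable circ (poisson z)"
  using integrable_poisson_mult[of z "\<lambda>_. 1::real"] by simp

lemma poisson_nn_integral_1:
  assumes "norm z < 1"
  shows "(\<integral>\<^sup>+s. ennreal (poisson z s) \<partial>circ) = 1"
  using assms by (subst nn_integral_eq_integral) (auto simp: poisson_nonneg poisson_integral_1 integrable_poisson)

lemma norm_cis_diff_sym: "norm (cis s - of_real r * cis t) = norm (cis t - of_real r * cis s)"
proof -
  have *: "norm (cis s - of_real r * cis t) = norm (1 - of_real r * cis (t - s))" for s t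
  proof -
    have "cis s - of_real r * cis t = cis s * (1 - of_real r * cis (t - s))"
      by (simp add: algebra_simps cis_mult)
    then show ?thesis by (simp add: norm_mult)
  qed
  have "norm (1 - of_real r * cis (t - s)) = norm (cnj (1 - of_real r * cis (s - t)))"
    by (simp add: cis_cnj)
  then show ?thesis unfolding *[of s t] *[of t s] by (simp only: complex_mod_cnj)
qed

text \<open>
  The Poisson operators are self-adjoint. Together with the semigroup law this is what makes
  the \<open>L\<^sup>2\<close> theory below elementary.
\<close>

lemma poisson_sym: "poisson (of_real r * cis t) s = poisson (of_real r * cis s) t"
  unfolding poisson_def by (simp add: norm_cis_diff_sym[of s] norm_mult)

text \<open>
  As a function of the boundary variable, the second kernel is the real part of a function holomorphic
  in a neighbourhood of the closed disc, so the Poisson formula evaluates the integral.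
\<close>

lemma poisson_semigroup:
  assumes a: "0 \<le> a" "a < 1" and b: "0 \<le> b" "b < 1"
  shows "(\<integral>s. poisson (of_real a * cis t) s * poisson (of_real b * cis s) t' \<partial>circ) =
           poisson (of_real (a * b) * cis t) t'"
proof -
  define H where "H w = (cis t' + of_real b * w) / (cis t' - of_real b * w)" for w
  have lt: "norm (of_real b * w) < 1" if "norm w \<le> 1" for w :: complex
    using mult_left_mono[OF that b(1)] b by (simp add: norm_mult)
  have nz: "cis t' - of_real b * w \<noteq> 0" if "norm w \<le> 1" for w
    using cis_ne_disc[OF lt[OF that]] by simp
  have cont: "continuous_on (cball 0 1) H" unfolding H_def
    using nz by (auto intro!: continuous_intros)
  have Re_H: "Re (H w) = poisson (of_real b * w) t'" if "norm w \<le> 1" for w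
    unfolding H_def using poisson_eq_Re[OF lt[OF that], of t'] by simp
  have z: "norm (of_real a * cis t) < 1" using a by (simp add: norm_mult)
  have int: "integrable circ (\<lambda>s. poisson (of_real a * cis t) s *\<^sub>R H (cis s))"
    by (intro integrable_poisson_mult z circ_cis_comp1 continuous_on_subset[OF cont]) auto
  have "(\<integral>s. poisson (of_real a * cis t) s *\<^sub>R H (cis s) \<partial>circ) = H (of_real a * cis t)"
    by (rule poisson_formula[OF cont _ z], unfold H_def) (use nz in \<open>auto intro!: holomorphic_intros\<close>)
  then have "(\<integral>s. Re (poisson (of_real a * cis t) s *\<^sub>R H (cis s)) \<partial>circ) = Re (H (of_real a * cis t))"
    unfolding integral_Re[OF int] by simp
  then show ?thesis
    using z by (simp add: Re_H mult_ac)
qed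

text \<open>
  If \<open>a \<le> b\<close> then \<open>1 - ab\<close> is comparable to \<open>1 - a\<close>, so the kernel at radius \<open>ab\<close> is dominated by
  the kernel at the smaller of the two radii. The sum on the right avoids having to know which one that is.
\<close>

lemma poisson_product_le:
  assumes a: "0 \<le> a" "a < 1" and b: "0 \<le> b" "b < 1"
  shows "poisson (of_real (a * b) * cis t) s \<le> 16 * (poisson (of_real a * cis t) s + poisson (of_real b * cis t) s)"
proof -
  have *: "poisson (of_real (a * b) * cis t) s \<le> 16 * poisson (of_real a * cis t) s"
    if a: "0 \<le> a" "a < 1" and b: "0 \<le> b" "b < 1" and ab: "a \<le> b" for a b
  proof -
    have ab1: "a * b \<le> a" "a * b < 1" "0 \<le> a * b"
      using a b mult_left_le[of b a] by (auto simp: algebra_simps)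
    have pos: "norm (cis s - of_real a * cis t) > 0" "norm (cis s - of_real (a * b) * cis t) > 0"
      using a ab1 by (auto intro!: cis_ne_disc simp: norm_mult simp del: of_real_mult)
    have "norm (cis s - of_real a * cis t) \<le>
            norm (cis s - of_real (a * b) * cis t) + norm (of_real (a * b - a) * cis t)"
      using norm_triangle_ineq[of "cis s - of_real (a * b) * cis t" "of_real (a * b - a) * cis t"]
      by (simp add: algebra_simps)
    also have "norm (of_real (a * b - a) * cis t) = a - a * b"
      using ab1 by (simp add: norm_mult del: of_real_diff)
    also have "a - a * b \<le> 1 - a * b" using a by simp
    also have "1 - a * b \<le> norm (cis s - of_real (a * b) * cis t)"
      using norm_cis_diff_ge[of "of_real (a * b) * cis t" s] ab1 a b by (simp add: norm_mult)
    finally have "norm (cis s - of_real a * cis t) \<le> 2 * norm (cis s - of_real (a * b) * cis t)"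
      by simp
    then have n: "(norm (cis s - of_real a * cis t))\<^sup>2 \<le> 4 * (norm (cis s - of_real (a * b) * cis t))\<^sup>2"
      by (metis (no_types, lifting) norm_ge_zero power_mono power_mult_distrib four_x_squared)
    have "1 - (a * b)\<^sup>2 \<le> 4 * (1 - a\<^sup>2)"
    proof -
      have "1 - a * b \<le> (1 - a) * (1 + a)"
        using mult_left_mono[OF ab, of a] a by (simp add: algebra_simps)
      also have "\<dots> \<le> (1 - a) * 2" using a by (intro mult_left_mono) auto
      finally have "1 - a * b \<le> 2 * (1 - a)" by simp
      then have "(1 - a * b) * (1 + a * b) \<le> 2 * (1 - a) * 2"
        using a b ab1 by (intro mult_mono) auto
      also have "\<dots> \<le> 4 * (1 - a\<^sup>2)"
        using a mult_left_le[of a a] by (simp add: power2_eq_square)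
      finally show ?thesis by (simp add: algebra_simps power2_eq_square)
    qed
    then have "(1 - (a * b)\<^sup>2) * (norm (cis s - of_real a * cis t))\<^sup>2 \<le>
       (4 * (1 - a\<^sup>2)) * (4 * (norm (cis s - of_real (a * b) * cis t))\<^sup>2)"
      using n a by (intro mult_mono) (auto simp: power_le_one)
    then show ?thesis
      using pos a b ab1 unfolding poisson_def by (simp add: norm_mult field_simps)
  qed
  have nn: "poisson (of_real a * cis t) s \<ge> 0" "poisson (of_real b * cis t) s \<ge> 0"
    using a b by (auto intro!: poisson_nonneg simp: norm_mult)
  show ?thesis
  proof (cases "a \<le> b")
    case True
    then show ?thesis using *[OF a b] nn by simp
  next
    case False
    then show ?thesis using *[OF b a] nn by (simp add: mult.commute[of a])
  qed
qed

text \<open>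
  Split \<open>Re F\<close> into \<open>F/2\<close> and the conjugate of \<open>F/2\<close>. The Schwarz kernel is \<open>2\<zeta>/(\<zeta> - z) - 1\<close>, so
  Cauchy's formula handles the first half; on the circle the kernel is also the conjugate of
  \<open>(1 + \<zeta> z*)/(1 - \<zeta> z*)\<close>, with \<open>z*\<close> the conjugate of \<open>z\<close>, which is holomorphic in \<open>\<zeta>\<close> with value 1
  at 0, so the mean value property handles the second.
\<close>

lemma schwarz_formula:
  assumes F: "continuous_on (cball 0 1) F" "F holomorphic_on ball 0 1" and z: "norm z < 1"
  shows "(\<integral>t. (cis t + z) / (cis t - z) * of_real (Re (F (cis t))) \<partial>circ) = F z - \<i> * of_real (Im (F 0))"
proof -
  have nz: "w \<noteq> z" if "norm w = 1" for w using that z by auto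
  have nz': "cnj z * w \<noteq> 1" if "norm w \<le> 1" for w
  proof
    assume "cnj z * w = 1"
    then have "norm (cnj z * w) = 1" by simp
    moreover have "norm (cnj z * w) \<le> norm z"
      using that by (simp add: norm_mult mult_left_le)
    ultimately show False using z by simp
  qed
  have cs: "continuous_on (sphere 0 1) F" by (rule continuous_on_subset[OF F(1)]) auto
  have 1: "(\<integral>t. F (cis t) * (cis t / (cis t - z)) \<partial>circ) = F z"
    by (rule Cauchy_circ[OF F z])
  have 2: "(\<integral>t. F (cis t) \<partial>circ) = F 0"
    by (rule mean_value_circ[OF F])
  have i1: "integrable circ (\<lambda>t. F (cis t) * (cis t / (cis t - z)))"
    by (rule circ_cis_comp1(2)[of "\<lambda>w. F w * (w / (w - z))"])
       (intro continuous_intros cs, auto dest: nz)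
  have i2: "integrable circ (\<lambda>t. F (cis t))"
    by (rule circ_cis_comp1(2)[OF cs])
  have "(\<integral>t. F (cis t) * ((1 + cnj z * cis t) / (1 - cnj z * cis t)) \<partial>circ) =
          F 0 * ((1 + cnj z * 0) / (1 - cnj z * 0))"
    by (rule mean_value_circ[of "\<lambda>w. F w * ((1 + cnj z * w) / (1 - cnj z * w))"])
       (use F nz' in \<open>auto intro!: continuous_intros holomorphic_intros\<close>)
  then have 3: "(\<integral>t. F (cis t) * ((1 + cnj z * cis t) / (1 - cnj z * cis t)) \<partial>circ) = F 0"
    by simp
  have i3: "integrable circ (\<lambda>t. F (cis t) * ((1 + cnj z * cis t) / (1 - cnj z * cis t)))"
    by (rule circ_cis_comp1(2)[of "\<lambda>w. F w * ((1 + cnj z * w) / (1 - cnj z * w))"])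
       (intro continuous_intros cs, use nz' in auto)
  have 4: "(\<integral>t. cnj (F (cis t) * ((1 + cnj z * cis t) / (1 - cnj z * cis t))) \<partial>circ) = cnj (F 0)"
    unfolding Bochner_Integration.integral_cnj 3 ..
  have eq: "(cis t + z) / (cis t - z) * of_real (Re (F (cis t))) =
      F (cis t) * (cis t / (cis t - z)) - F (cis t) / 2
       + cnj (F (cis t) * ((1 + cnj z * cis t) / (1 - cnj z * cis t))) / 2" for t
  proof -
    have "cis t \<noteq> z" using nz[of "cis t"] by auto
    have c: "cnj ((1 + cnj z * cis t) / (1 - cnj z * cis t)) = (cis t + z) / (cis t - z)"
    proof -
      have *: "cis t * (1 + z * cis (-t)) = cis t + z" "cis t * (1 - z * cis (-t)) = cis t - z"
        by (simp_all add: algebra_simps cis_mult)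
      have "cnj ((1 + cnj z * cis t) / (1 - cnj z * cis t)) = (1 + z * cis (-t)) / (1 - z * cis (-t))"
        by (simp add: cis_cnj)
      also have "\<dots> = (cis t * (1 + z * cis (-t))) / (cis t * (1 - z * cis (-t)))"
        by (rule mult_divide_mult_cancel_left[symmetric]) simp
      finally show ?thesis unfolding * .
    qed
    have R: "of_real (Re (F (cis t))) = (F (cis t) + cnj (F (cis t))) / 2"
      by (simp add: complex_add_cnj)
    define q where "q = (cis t + z) / (cis t - z)"
    have q: "cis t / (cis t - z) = (q + 1) / 2"
      using \<open>cis t \<noteq> z\<close> unfolding q_def by (simp add: divide_simps)
    show ?thesis
      unfolding complex_cnj_mult c q_def[symmetric] q R by (simp add: field_simps)
  qed
  have "(\<integral>t. (cis t + z) / (cis t - z) * of_real (Re (F (cis t))) \<partial>circ) = F z - F 0 / 2 + cnj (F 0) / 2"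
    unfolding eq using 1 2 4 i1 i2 i3 integrable_cnj[OF i3] by (simp del: complex_cnj_mult complex_cnj_divide)
  also have "\<dots> = F z - \<i> * of_real (Im (F 0))"
    by (simp add: complex_eq_iff)
  finally show ?thesis .
qed

lemma norm_schwarz_kernel_le:
  assumes "norm z < 1"
  shows "norm ((cis t + z) / (cis t - z)) \<le> 2 / (1 - norm z)"
  unfolding norm_divide
proof (rule frac_le)
  show "norm (cis t + z) \<le> 2" using norm_triangle_ineq[of "cis t" z] assms by simp
  show "1 - norm z \<le> norm (cis t - z)" by (rule norm_cis_diff_ge)
qed (use assms in auto)

lemma integrable_schwarz_kernel:
  assumes z: "norm z < 1" and h: "integrable circ (h :: real \<Rightarrow> real)"
  shows "integrable circ (\<lambda>t. (cis t + z) / (cis t - z) * of_real (h t))"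
proof (rule Bochner_Integration.integrable_bound)
  define W where "W = 2 / (1 - norm z)"
  have W: "norm ((cis t + z) / (cis t - z)) \<le> W" for t
    unfolding W_def by (rule norm_schwarz_kernel_le[OF z])
  show "integrable circ (\<lambda>t. W * h t)" using h by simp
  have m: "(\<lambda>t. (cis t + z) / (cis t - z)) \<in> borel_measurable circ" by measurable
  show "(\<lambda>t. (cis t + z) / (cis t - z) * of_real (h t)) \<in> borel_measurable circ"
    using borel_measurable_integrable[OF h] m by measurable
  have "0 \<le> W" using z by (simp add: W_def)
  then have "norm ((cis t + z) / (cis t - z) * of_real (h t)) \<le> norm (W * h t)" for t
    using mult_right_mono[OF W, of "\<bar>h t\<bar>" t] by (simp only: norm_mult norm_of_real real_norm_def abs_mult abs_of_nonneg abs_ge_zero)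
  then show "AE t in circ. norm ((cis t + z) / (cis t - z) * of_real (h t)) \<le> norm (W * h t)" by simp
qed

section \<open>Poisson integrals in Lp\<close>

lemma powr_tangent:
  fixes u a p :: real
  assumes "a > 0" "u \<ge> 0" "p \<ge> 1"
  shows "a powr p + p * a powr (p - 1) * (u - a) \<le> u powr p"
proof (cases "u = 0")
  case True
  have "a powr (p - 1) * a = a powr p" using assms by (simp add: powr_mult_base mult.commute)
  then show ?thesis using True assms by (simp add: algebra_simps mult_le_cancel_right1)
next
  case False
  have "((\<lambda>x. x powr p) has_real_derivative p * a powr (p - 1)) (at a)"
    using assms by (auto intro!: derivative_eq_intros)
  then have "p * a powr (p - 1) * (u - a) \<le> u powr p - a powr p"
    using assms False convex_on_imp_above_tangent[OF powr_convex[OF assms(3)], of a u]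
    by (simp add: interior_open has_field_derivative_at_within)
  then show ?thesis by simp
qed

text \<open>
  Jensen's inequality for the probability density \<^term>\<open>poisson z\<close>: integrate the tangent
  inequality for \<open>x \<mapsto> x\<^sup>p\<close> at the mean.
\<close>

lemma poisson_jensen:
  assumes z: "norm z < 1" and p: "p \<ge> 1" and u: "integrable circ u" "\<And>s. u s \<ge> 0"
  shows "ennreal ((\<integral>s. poisson z s * u s \<partial>circ) powr p) \<le> (\<integral>\<^sup>+s. ennreal (poisson z s) * ennreal (u s powr p) \<partial>circ)"
proof -
  note [measurable] = borel_measurable_integrable[OF u(1)]
  define a where "a = (\<integral>s. poisson z s * u s \<partial>circ)"
  have iu: "integrable circ (\<lambda>s. poisson z s * u s)"
    using integrable_poisson_mult[OF z u(1)] by simp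
  have a0: "a \<ge> 0" unfolding a_def using u z by (auto intro!: integral_nonneg_AE simp: poisson_nonneg)
  show ?thesis
  proof (cases "a > 0 \<and> integrable circ (\<lambda>s. poisson z s * u s powr p)")
    case True
    have "a powr p = (\<integral>s. poisson z s * (a powr p - p * a powr (p - 1) * a) + p * a powr (p - 1) * (poisson z s * u s) \<partial>circ)"
      using iu integrable_poisson[OF z] poisson_integral_1[OF z] by (simp add: a_def[symmetric])
    also have "\<dots> \<le> (\<integral>s. poisson z s * u s powr p \<partial>circ)"
    proof (rule integral_mono)
      fix s
      have "poisson z s * (a powr p + p * a powr (p - 1) * (u s - a)) \<le> poisson z s * u s powr p"
        using True u p poisson_nonneg[OF z] by (intro mult_left_mono powr_tangent) auto
      then show "poisson z s * (a powr p - p * a powr (p - 1) * a) + p * a powr (p - 1) * (poisson z s * u s)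
                  \<le> poisson z s * u s powr p"
        by (simp add: algebra_simps)
    qed (use True iu integrable_poisson[OF z] in auto)
    finally have "ennreal (a powr p) \<le> ennreal (\<integral>s. poisson z s * u s powr p \<partial>circ)"
      by (simp add: ennreal_leI)
    also have "\<dots> = (\<integral>\<^sup>+s. ennreal (poisson z s * u s powr p) \<partial>circ)"
      using True poisson_nonneg[OF z] by (subst nn_integral_eq_integral) auto
    finally show ?thesis unfolding a_def using poisson_nonneg[OF z] by (simp add: ennreal_mult)
  next
    case False
    show ?thesis
    proof (cases "a = 0")
      case True
      then show ?thesis using p by (simp add: a_def[symmetric])
    next
      case a: False
      then have "\<not> integrable circ (\<lambda>s. poisson z s * u s powr p)" using False a0 by auto
      then have "(\<integral>\<^sup>+s. ennreal (poisson z s * u s powr p) \<partial>circ) = \<infinity>"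
        using poisson_nonneg[OF z] by (subst (asm) integrable_iff_bounded) (auto simp: abs_mult less_top[symmetric])
      then show ?thesis using poisson_nonneg[OF z] by (simp add: ennreal_mult)
    qed
  qed
qed

text \<open>
  Jensen bounds the \<open>p\<close>-th power of the integral pointwise; by symmetry the kernel also integrates to 1
  in the other variable.
\<close>

lemma poisson_Lp_contraction:
  assumes r: "0 \<le> r" "r < 1" and p: "p \<ge> 1" and u: "integrable circ u" "\<And>s. u s \<ge> 0"
  shows "(\<integral>\<^sup>+t. ennreal ((\<integral>s. poisson (of_real r * cis t) s * u s \<partial>circ) powr p) \<partial>circ)
           \<le> (\<integral>\<^sup>+t. ennreal (u t powr p) \<partial>circ)"
proof -
  note [measurable] = borel_measurable_integrable[OF u(1)]
  have z: "norm (of_real r * cis t) < 1" for t using r by (simp add: norm_mult)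
  have "(\<integral>\<^sup>+t. ennreal ((\<integral>s. poisson (of_real r * cis t) s * u s \<partial>circ) powr p) \<partial>circ)
     \<le> (\<integral>\<^sup>+t. \<integral>\<^sup>+s. ennreal (poisson (of_real r * cis t) s) * ennreal (u s powr p) \<partial>circ \<partial>circ)"
    by (intro nn_integral_mono poisson_jensen z p u)
  also have "\<dots> = (\<integral>\<^sup>+s. \<integral>\<^sup>+t. ennreal (poisson (of_real r * cis t) s) * ennreal (u s powr p) \<partial>circ \<partial>circ)"
    by (subst circ2.Fubini') auto
  also have "\<dots> = (\<integral>\<^sup>+s. \<integral>\<^sup>+t. ennreal (poisson (of_real r * cis s) t) * ennreal (u s powr p) \<partial>circ \<partial>circ)"
    by (subst poisson_sym) simp
  also have "\<dots> = (\<integral>\<^sup>+s. ennreal (u s powr p) \<partial>circ)"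
    using z by (simp add: nn_integral_multc poisson_nn_integral_1)
  finally show ?thesis .
qed

section \<open>The radial maximal inequality\<close>

lemma ennreal_le_of_sq_le:
  fixes I c :: ennreal
  assumes "I\<^sup>2 \<le> c * I" "I \<noteq> \<infinity>"
  shows "I \<le> c"
proof (cases "I = 0")
  case False
  have "I * I \<le> I * c" using assms(1) by (simp add: power2_eq_square mult.commute)
  then show ?thesis using False assms(2) by (simp add: ennreal_mult_le_mult_iff)
qed simp

lemma circ_nn_integral_sq_le:
  fixes u :: "real \<Rightarrow> ennreal"
  assumes "u \<in> borel_measurable borel"
  shows "(\<integral>\<^sup>+t. u t \<partial>circ)\<^sup>2 \<le> (\<integral>\<^sup>+t. (u t)\<^sup>2 \<partial>circ)"
  using Cauchy_Schwarz_nn_integral[of u circ "\<lambda>_. 1"] assms circ.emeasure_space_1 by simp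

text \<open>
  A maximal function over radii is linearized by letting the radius \<open>\<rho>(t)\<close> depend measurably on
  the boundary point. It remains to bound the resulting linear operator in \<open>L\<^sup>2\<close>, with a constant that
  does not depend on \<open>\<rho>\<close>; the bound \<open>R < 1\<close> only secures finiteness beforehand.
\<close>

locale radius_choice =
  fixes \<rho> :: "real \<Rightarrow> real" and R :: real
  assumes \<rho>_measurable [measurable]: "\<rho> \<in> borel_measurable borel"
    and \<rho>_nonneg: "0 \<le> \<rho> t" and \<rho>_le: "\<rho> t \<le> R" and R_less: "R < 1"
begin

lemma \<rho>_less: "\<rho> t < 1"
  using \<rho>_le R_less le_less_trans by blast

definition kernel :: "real \<Rightarrow> real \<Rightarrow> ennreal" where
  "kernel t s = ennreal (poisson (of_real (\<rho> t) * cis t) s)"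

lemma kernel_measurable [measurable (raw)]:
  assumes [measurable]: "f \<in> borel_measurable M" "g \<in> borel_measurable M"
  shows "(\<lambda>x. kernel (f x) (g x)) \<in> borel_measurable M"
  unfolding kernel_def by measurable

lemma kernel_le: "kernel t s \<le> ennreal (1 / (1 - R)\<^sup>2)"
  unfolding kernel_def
  by (intro ennreal_leI poisson_le) (use \<rho>_nonneg \<rho>_le R_less in \<open>auto simp: norm_mult\<close>)

text \<open>
  The left-hand side is the kernel of \<open>T T*\<close>, where \<open>T\<close> averages at the chosen radii. The semigroup law and
  \<open>poisson_product_le\<close> bound it by the kernels of \<open>T\<close> and \<open>T*\<close> themselves.
\<close>

lemma kernel_compose_le:
  "(\<integral>\<^sup>+s. kernel t s * kernel t' s \<partial>circ) \<le> 16 * (kernel t t' + kernel t' t)"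
proof -
  have n: "norm (of_real (\<rho> t) * cis s) < 1" for t s
    using \<rho>_nonneg \<rho>_less by (simp add: norm_mult)
  have int: "integrable circ (\<lambda>s. poisson (of_real (\<rho> t) * cis t) s * poisson (of_real (\<rho> t') * cis s) t')"
    unfolding poisson_sym[of "\<rho> t'" _ t']
    by (rule integrable_poisson_mult[OF n, where 'b = real, simplified] integrable_poisson n)+
  have "(\<integral>\<^sup>+s. kernel t s * kernel t' s \<partial>circ) =
      (\<integral>\<^sup>+s. ennreal (poisson (of_real (\<rho> t) * cis t) s * poisson (of_real (\<rho> t') * cis s) t') \<partial>circ)"
    unfolding kernel_def poisson_sym[of "\<rho> t'" t']
    by (simp add: ennreal_mult poisson_nonneg n)
  also have "\<dots> = ennreal (poisson (of_real (\<rho> t * \<rho> t') * cis t) t')"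
    using int \<rho>_nonneg \<rho>_less
    by (subst nn_integral_eq_integral) (auto simp: poisson_semigroup poisson_nonneg n simp del: of_real_mult)
  also have "\<dots> \<le> ennreal (16 * (poisson (of_real (\<rho> t) * cis t) t' + poisson (of_real (\<rho> t') * cis t) t'))"
    by (intro ennreal_leI poisson_product_le \<rho>_nonneg \<rho>_less)
  also have "\<dots> = 16 * (kernel t t' + kernel t' t)"
    unfolding kernel_def poisson_sym[of "\<rho> t'" t']
    by (simp add: ennreal_mult poisson_nonneg n)
  finally show ?thesis .
qed

text \<open>
  With \<open>T\<close> as above, \<open>\<parallel>T* \<phi>\<parallel>\<^sup>2 = \<langle>T T* \<phi>, \<phi>\<rangle> \<le> 32 \<langle>T* \<phi>, \<phi>\<rangle> \<le> 32 \<parallel>T* \<phi>\<parallel> \<parallel>\<phi>\<parallel>\<close>. One factor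
  \<open>\<parallel>T* \<phi>\<parallel>\<close> cancels because it is finite, which is where \<open>R < 1\<close> enters.
\<close>

lemma adjoint_bound:
  assumes \<phi>[measurable]: "\<phi> \<in> borel_measurable borel"
  shows "(\<integral>\<^sup>+s. (\<integral>\<^sup>+t. kernel t s * \<phi> t \<partial>circ)\<^sup>2 \<partial>circ) \<le> 1024 * (\<integral>\<^sup>+t. (\<phi> t)\<^sup>2 \<partial>circ)"
proof -
  define S where "S s = (\<integral>\<^sup>+t. kernel t s * \<phi> t \<partial>circ)" for s
  define I where "I = (\<integral>\<^sup>+s. (S s)\<^sup>2 \<partial>circ)"
  define J where "J = (\<integral>\<^sup>+t. (\<phi> t)\<^sup>2 \<partial>circ)"
  have S[measurable]: "S \<in> borel_measurable borel"
    unfolding S_def by measurable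
  have "I = (\<integral>\<^sup>+s. \<integral>\<^sup>+t. \<integral>\<^sup>+t'. (kernel t s * \<phi> t) * (kernel t' s * \<phi> t') \<partial>circ \<partial>circ \<partial>circ)"
    unfolding I_def S_def power2_eq_square
    by (simp add: nn_integral_cmult nn_integral_multc)
  also have "\<dots> = (\<integral>\<^sup>+t. \<integral>\<^sup>+s. \<integral>\<^sup>+t'. (kernel t s * \<phi> t) * (kernel t' s * \<phi> t') \<partial>circ \<partial>circ \<partial>circ)"
    by (rule circ2.Fubini') measurable
  also have "\<dots> = (\<integral>\<^sup>+t. \<integral>\<^sup>+t'. \<integral>\<^sup>+s. (kernel t s * \<phi> t) * (kernel t' s * \<phi> t') \<partial>circ \<partial>circ \<partial>circ)"
    by (intro nn_integral_cong circ2.Fubini') measurable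
  also have "\<dots> = (\<integral>\<^sup>+t. \<integral>\<^sup>+t'. (\<phi> t * \<phi> t') * (\<integral>\<^sup>+s. kernel t s * kernel t' s \<partial>circ) \<partial>circ \<partial>circ)"
    by (simp add: mult_ac flip: nn_integral_cmult)
  also have "\<dots> \<le> (\<integral>\<^sup>+t. \<integral>\<^sup>+t'. (\<phi> t * \<phi> t') * (16 * (kernel t t' + kernel t' t)) \<partial>circ \<partial>circ)"
    by (intro nn_integral_mono mult_left_mono kernel_compose_le) auto
  also have "\<dots> = (\<integral>\<^sup>+t. \<integral>\<^sup>+t'. 16 * (kernel t t' * \<phi> t * \<phi> t') + 16 * (kernel t' t * \<phi> t' * \<phi> t) \<partial>circ \<partial>circ)"
    by (simp add: algebra_simps)
  also have "\<dots> = 16 * (\<integral>\<^sup>+t. \<integral>\<^sup>+t'. kernel t t' * \<phi> t * \<phi> t' \<partial>circ \<partial>circ)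
                + 16 * (\<integral>\<^sup>+t. \<integral>\<^sup>+t'. kernel t' t * \<phi> t' * \<phi> t \<partial>circ \<partial>circ)"
    by (simp add: nn_integral_add nn_integral_cmult)
  also have "(\<integral>\<^sup>+t. \<integral>\<^sup>+t'. kernel t t' * \<phi> t * \<phi> t' \<partial>circ \<partial>circ) =
             (\<integral>\<^sup>+t. \<integral>\<^sup>+t'. kernel t' t * \<phi> t' * \<phi> t \<partial>circ \<partial>circ)"
    by (rule circ2.Fubini') measurable
  also have "(\<integral>\<^sup>+t. \<integral>\<^sup>+t'. kernel t' t * \<phi> t' * \<phi> t \<partial>circ \<partial>circ) = (\<integral>\<^sup>+t. S t * \<phi> t \<partial>circ)"
    unfolding S_def by (simp add: nn_integral_multc)
  also have "16 * (\<integral>\<^sup>+t. S t * \<phi> t \<partial>circ) + 16 * (\<integral>\<^sup>+t. S t * \<phi> t \<partial>circ) = 32 * (\<integral>\<^sup>+t. S t * \<phi> t \<partial>circ)"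
    by (simp flip: distrib_right)
  finally have "I\<^sup>2 \<le> (32 * (\<integral>\<^sup>+t. S t * \<phi> t \<partial>circ))\<^sup>2"
    by (rule power_mono) simp
  also have "\<dots> = 1024 * (\<integral>\<^sup>+t. S t * \<phi> t \<partial>circ)\<^sup>2"
    by (simp add: power_mult_distrib)
  also have "\<dots> \<le> 1024 * (I * J)"
    unfolding I_def J_def by (intro mult_left_mono Cauchy_Schwarz_nn_integral) auto
  finally have *: "I\<^sup>2 \<le> (1024 * J) * I" by (simp add: mult_ac)
  show ?thesis
  proof (cases "J = \<infinity>")
    case True
    then show ?thesis by (simp add: J_def ennreal_mult_top)
  next
    case False
    \<comment> \<open>finiteness of \<open>I\<close>, needed to cancel it in the quadratic inequality\<close>
    define B where "B = ennreal (1 / (1 - R)\<^sup>2)"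
    have "(\<integral>\<^sup>+t. \<phi> t \<partial>circ)\<^sup>2 \<le> J"
      unfolding J_def by (rule circ_nn_integral_sq_le) simp
    then have fin: "(\<integral>\<^sup>+t. \<phi> t \<partial>circ) \<noteq> \<infinity>"
      using False by (auto simp: power2_eq_square top_unique)
    have "S s \<le> B * (\<integral>\<^sup>+t. \<phi> t \<partial>circ)" for s
    proof -
      have "S s \<le> (\<integral>\<^sup>+t. B * \<phi> t \<partial>circ)"
        unfolding S_def B_def by (intro nn_integral_mono mult_right_mono kernel_le) simp
      then show ?thesis by (simp add: nn_integral_cmult)
    qed
    then have "I \<le> (\<integral>\<^sup>+s. (B * (\<integral>\<^sup>+t. \<phi> t \<partial>circ))\<^sup>2 \<partial>circ)"
      unfolding I_def by (intro nn_integral_mono power_mono) auto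
    also have "\<dots> < \<infinity>"
      using fin unfolding B_def by (auto simp: circ.emeasure_space_1[simplified] power2_eq_square ennreal_mult_eq_top_iff less_top[symmetric])
    finally have "I \<le> 1024 * J"
      by (intro ennreal_le_of_sq_le[OF *]) auto
    then show ?thesis unfolding I_def J_def S_def .
  qed
qed

text \<open>
  Duality: \<open>\<parallel>T u\<parallel>\<^sup>2 = \<langle>u, T* T u\<rangle> \<le> \<parallel>u\<parallel> \<parallel>T* (T u)\<parallel> \<le> 32 \<parallel>u\<parallel> \<parallel>T u\<parallel>\<close>.
\<close>

lemma selected_average_bound:
  assumes u[measurable]: "u \<in> borel_measurable borel"
  shows "(\<integral>\<^sup>+t. (\<integral>\<^sup>+s. kernel t s * u s \<partial>circ)\<^sup>2 \<partial>circ) \<le> 1024 * (\<integral>\<^sup>+s. (u s)\<^sup>2 \<partial>circ)"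
proof -
  define S where "S t = (\<integral>\<^sup>+s. kernel t s * u s \<partial>circ)" for t
  define X where "X = (\<integral>\<^sup>+t. (S t)\<^sup>2 \<partial>circ)"
  define J where "J = (\<integral>\<^sup>+t. (u t)\<^sup>2 \<partial>circ)"
  have S[measurable]: "S \<in> borel_measurable borel"
    unfolding S_def by measurable
  have "X = (\<integral>\<^sup>+t. \<integral>\<^sup>+s. S t * (kernel t s * u s) \<partial>circ \<partial>circ)"
    unfolding X_def power2_eq_square
    by (subst (2) S_def) (simp add: nn_integral_cmult)
  also have "\<dots> = (\<integral>\<^sup>+s. \<integral>\<^sup>+t. S t * (kernel t s * u s) \<partial>circ \<partial>circ)"
    by (rule circ2.Fubini') measurable
  also have "\<dots> = (\<integral>\<^sup>+s. u s * (\<integral>\<^sup>+t. kernel t s * S t \<partial>circ) \<partial>circ)"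
    by (simp add: mult_ac flip: nn_integral_cmult)
  finally have "X\<^sup>2 = (\<integral>\<^sup>+s. u s * (\<integral>\<^sup>+t. kernel t s * S t \<partial>circ) \<partial>circ)\<^sup>2" by simp
  also have "\<dots> \<le> J * (\<integral>\<^sup>+s. (\<integral>\<^sup>+t. kernel t s * S t \<partial>circ)\<^sup>2 \<partial>circ)"
    unfolding J_def by (intro Cauchy_Schwarz_nn_integral) measurable
  also have "\<dots> \<le> J * (1024 * X)"
    unfolding X_def by (intro mult_left_mono adjoint_bound S) simp
  finally have *: "X\<^sup>2 \<le> (1024 * J) * X" by (simp add: mult_ac)
  show ?thesis
  proof (cases "J = \<infinity>")
    case True
    then show ?thesis by (simp add: J_def ennreal_mult_top)
  next
    case False
    \<comment> \<open>finiteness of \<open>X\<close>, needed to cancel it in the quadratic inequality\<close>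
    define B where "B = ennreal (1 / (1 - R)\<^sup>2)"
    have "(\<integral>\<^sup>+t. u t \<partial>circ)\<^sup>2 \<le> J"
      unfolding J_def by (rule circ_nn_integral_sq_le) simp
    then have fin: "(\<integral>\<^sup>+t. u t \<partial>circ) \<noteq> \<infinity>"
      using False by (auto simp: power2_eq_square top_unique)
    have "S t \<le> B * (\<integral>\<^sup>+t. u t \<partial>circ)" for t
    proof -
      have "S t \<le> (\<integral>\<^sup>+s. B * u s \<partial>circ)"
        unfolding S_def B_def by (intro nn_integral_mono mult_right_mono kernel_le) simp
      then show ?thesis by (simp add: nn_integral_cmult)
    qed
    then have "X \<le> (\<integral>\<^sup>+s. (B * (\<integral>\<^sup>+t. u t \<partial>circ))\<^sup>2 \<partial>circ)"
      unfolding X_def by (intro nn_integral_mono power_mono) auto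
    also have "\<dots> < \<infinity>"
      using fin unfolding B_def by (auto simp: circ.emeasure_space_1[simplified] power2_eq_square ennreal_mult_eq_top_iff less_top[symmetric])
    finally have "X \<le> 1024 * J"
      by (intro ennreal_le_of_sq_le[OF *]) auto
    then show ?thesis unfolding X_def J_def S_def .
  qed
qed

end

lemma norm_poisson_le:
  assumes F: "continuous_on (cball 0 1) F" "F holomorphic_on ball 0 1" and z: "norm z < 1"
  shows "norm (F z) \<le> (\<integral>s. poisson z s * norm (F (cis s)) \<partial>circ)"
proof -
  have "norm (F z) = norm (\<integral>s. poisson z s *\<^sub>R F (cis s) \<partial>circ)"
    by (subst poisson_formula[OF F z]) simp
  also have "\<dots> \<le> (\<integral>s. norm (poisson z s *\<^sub>R F (cis s)) \<partial>circ)"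
    by (rule integral_norm_bound)
  also have "\<dots> = (\<integral>s. poisson z s * norm (F (cis s)) \<partial>circ)"
    using poisson_nonneg[OF z] by simp
  finally show ?thesis .
qed

lemma (in radius_choice) selected_radius_bound:
  assumes F: "continuous_on (cball 0 1) F" "F holomorphic_on ball 0 1"
  shows "(\<integral>\<^sup>+t. ennreal ((norm (F (of_real (\<rho> t) * cis t)))\<^sup>2) \<partial>circ) \<le> 1024 * (\<integral>\<^sup>+t. ennreal ((norm (F (cis t)))\<^sup>2) \<partial>circ)"
proof -
  have n: "norm (of_real (\<rho> t) * cis s) < 1" for t s
    using \<rho>_nonneg \<rho>_less by (simp add: norm_mult)
  have cs: "continuous_on (sphere 0 1) F" by (rule continuous_on_subset[OF F(1)]) auto
  note [measurable] = circ_cis_comp1(1)[OF cs]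
  have le: "ennreal (norm (F (of_real (\<rho> t) * cis t))) \<le> (\<integral>\<^sup>+s. kernel t s * ennreal (norm (F (cis s))) \<partial>circ)" for t
  proof -
    have "integrable circ (\<lambda>s. poisson (of_real (\<rho> t) * cis t) s * norm (F (cis s)))"
      using integrable_poisson_mult[OF n integrable_norm[OF circ_cis_comp1(2)[OF cs]]] by simp
    then have "ennreal (\<integral>s. poisson (of_real (\<rho> t) * cis t) s * norm (F (cis s)) \<partial>circ) =
       (\<integral>\<^sup>+s. ennreal (poisson (of_real (\<rho> t) * cis t) s * norm (F (cis s))) \<partial>circ)"
      by (subst nn_integral_eq_integral) (auto simp: poisson_nonneg n)
    also have "\<dots> = (\<integral>\<^sup>+s. kernel t s * ennreal (norm (F (cis s))) \<partial>circ)"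
      unfolding kernel_def by (simp add: ennreal_mult poisson_nonneg n)
    finally show ?thesis
      using ennreal_leI[OF norm_poisson_le[OF F n]] by metis
  qed
  have "(\<integral>\<^sup>+t. ennreal ((norm (F (of_real (\<rho> t) * cis t)))\<^sup>2) \<partial>circ) = (\<integral>\<^sup>+t. (ennreal (norm (F (of_real (\<rho> t) * cis t))))\<^sup>2 \<partial>circ)"
    by (simp add: ennreal_power)
  also have "\<dots> \<le> (\<integral>\<^sup>+t. (\<integral>\<^sup>+s. kernel t s * ennreal (norm (F (cis s))) \<partial>circ)\<^sup>2 \<partial>circ)"
    by (intro nn_integral_mono power_mono le) simp
  also have "\<dots> \<le> 1024 * (\<integral>\<^sup>+s. (ennreal (norm (F (cis s))))\<^sup>2 \<partial>circ)"
    by (rule selected_average_bound) measurable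
  finally show ?thesis by (simp add: ennreal_power)
qed

text \<open>
  A radius among the first \<open>n + 1\<close> terms of \<open>rr\<close> that maximizes \<open>v\<close> at the point \<open>t\<close>. Choosing by
  recursion makes its measurability in \<open>t\<close> evident.
\<close>

primrec best_radius :: "(real \<Rightarrow> real \<Rightarrow> real) \<Rightarrow> (nat \<Rightarrow> real) \<Rightarrow> nat \<Rightarrow> real \<Rightarrow> real" where
  "best_radius v rr 0 t = rr 0"
| "best_radius v rr (Suc n) t =
     (if v (rr (Suc n)) t > v (best_radius v rr n t) t then rr (Suc n) else best_radius v rr n t)"

lemma best_radius_ge:
  "i \<le> n \<Longrightarrow> v (rr i) t \<le> v (best_radius v rr n t) t"
proof (induction n)
  case (Suc n)
  then show ?case by (cases "i = Suc n") (force simp: le_Suc_eq)+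
qed simp

text \<open>
  Choosing at each boundary point the best of the first \<open>n\<close> radii is a radius function, so the operator
  bound applies with a constant that does not depend on \<open>n\<close>; monotone convergence does the rest.
\<close>

lemma radial_maximal_inequality:
  fixes rr :: "nat \<Rightarrow> real"
  assumes F: "continuous_on (cball 0 1) F" "F holomorphic_on ball 0 1"
    and rr: "\<And>n. 0 \<le> rr n" "\<And>n. rr n < 1"
  shows "(\<integral>\<^sup>+t. (SUP n. ennreal ((norm (F (of_real (rr n) * cis t)))\<^sup>2)) \<partial>circ)
           \<le> 1024 * (\<integral>\<^sup>+t. ennreal ((norm (F (cis t)))\<^sup>2) \<partial>circ)"
proof -
  define v where "v r t = norm (F (of_real r * cis t))" for r t
  define b where "b = best_radius v rr"
  have v_rr[measurable]: "v (rr n) \<in> borel_measurable borel" for n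
    unfolding v_def
    by (intro measurable_circle_comp[where f = "\<lambda>z. norm (F z)"] continuous_on_norm continuous_on_subset[OF F(1)])
       (use rr[of n] in auto)
  have meas: "b n \<in> borel_measurable borel \<and> (\<lambda>t. v (b n t) t) \<in> borel_measurable borel" for n
  proof (induction n)
    case (Suc n)
    then have [measurable]: "b n \<in> borel_measurable borel" "(\<lambda>t. v (b n t) t) \<in> borel_measurable borel"
      by auto
    have 1: "b (Suc n) = (\<lambda>t. if v (rr (Suc n)) t > v (b n t) t then rr (Suc n) else b n t)"
      by (auto simp: b_def)
    have 2: "(\<lambda>t. v (b (Suc n) t) t) = (\<lambda>t. if v (rr (Suc n)) t > v (b n t) t then v (rr (Suc n)) t else v (b n t) t)"
      by (auto simp: 1)
    show ?case unfolding 2 unfolding 1 by measurable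
  qed (auto simp: b_def)
  have rng: "\<exists>R<1. \<forall>t. 0 \<le> b n t \<and> b n t \<le> R" for n
  proof (induction n)
    case 0
    then show ?case using rr[of 0] by (auto simp: b_def)
  next
    case (Suc n)
    then obtain R where "R < 1" "\<forall>t. 0 \<le> b n t \<and> b n t \<le> R" by auto
    then show ?case using rr[of "Suc n"]
      by (intro exI[of _ "max R (rr (Suc n))"]) (auto simp: b_def le_max_iff_disj)
  qed
  have bound: "(\<integral>\<^sup>+t. ennreal ((v (b n t) t)\<^sup>2) \<partial>circ) \<le> 1024 * (\<integral>\<^sup>+t. ennreal ((norm (F (cis t)))\<^sup>2) \<partial>circ)" for n
  proof -
    obtain R where R: "R < 1" "\<forall>t. 0 \<le> b n t \<and> b n t \<le> R" using rng by blast
    interpret radius_choice "b n" R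
      by unfold_locales (use R meas in auto)
    show ?thesis unfolding v_def by (rule selected_radius_bound[OF F])
  qed
  have inc: "incseq (\<lambda>n. ennreal ((v (b n t) t)\<^sup>2))" for t
    by (intro incseq_SucI ennreal_leI power_mono) (auto simp: b_def v_def)
  have "(\<integral>\<^sup>+t. (SUP n. ennreal ((norm (F (of_real (rr n) * cis t)))\<^sup>2)) \<partial>circ) \<le> (\<integral>\<^sup>+t. (SUP n. ennreal ((v (b n t) t)\<^sup>2)) \<partial>circ)"
  proof (intro nn_integral_mono SUP_mono)
    fix t n
    have "v (rr n) t \<le> v (b n t) t" unfolding b_def by (rule best_radius_ge) simp
    then show "\<exists>m\<in>UNIV. ennreal ((norm (F (of_real (rr n) * cis t)))\<^sup>2) \<le> ennreal ((v (b m t) t)\<^sup>2)"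
      by (intro bexI[of _ n] ennreal_leI power_mono) (auto simp: v_def)
  qed
  also have "\<dots> = (SUP n. (\<integral>\<^sup>+t. ennreal ((v (b n t) t)\<^sup>2) \<partial>circ))"
  proof (rule nn_integral_monotone_convergence_SUP)
    show "incseq (\<lambda>n t. ennreal ((v (b n t) t)\<^sup>2))"
      using inc by (simp add: incseq_def le_fun_def)
    have [measurable]: "(\<lambda>t. v (b n t) t) \<in> borel_measurable borel" for n
      using meas by blast
    show "(\<lambda>t. ennreal ((v (b n t) t)\<^sup>2)) \<in> borel_measurable circ" for n by measurable
  qed
  also have "\<dots> \<le> 1024 * (\<integral>\<^sup>+t. ennreal ((norm (F (cis t)))\<^sup>2) \<partial>circ)"
    by (intro SUP_least bound)
  finally show ?thesis .
qed

section \<open>Radial limits of bounded holomorphic functions\<close>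

definition circle_mean_sq :: "(complex \<Rightarrow> complex) \<Rightarrow> real \<Rightarrow> real" where
  "circle_mean_sq F r = (\<integral>t. (norm (F (of_real r * cis t)))\<^sup>2 \<partial>circ)"

lemma continuous_on_sphere_of_cball:
  "continuous_on (cball 0 1) (F :: complex \<Rightarrow> 'b::topological_space) \<Longrightarrow> r \<le> 1 \<Longrightarrow> continuous_on (sphere 0 r) F"
  by (rule continuous_on_subset) auto

lemma dilation_mem:
  assumes "0 \<le> b" "b \<le> 1" "norm (w :: complex) \<le> 1"
  shows "norm (of_real b * w) \<le> 1"
  using mult_left_mono[OF assms(3,1)] assms(1,2) by (simp add: norm_mult)

lemma dilation_mem_less:
  assumes "0 \<le> b" "b < 1" "norm (w :: complex) \<le> 1"
  shows "norm (of_real b * w) < 1"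
  using mult_left_mono[OF assms(3,1)] assms(1,2) by (simp add: norm_mult)

lemma dilation:
  fixes F :: "complex \<Rightarrow> complex"
  assumes "continuous_on (cball 0 1) F" "F holomorphic_on ball 0 1" "0 \<le> b" "b \<le> 1"
  shows "continuous_on (cball 0 1) (\<lambda>w. F (of_real b * w))"
    and "(\<lambda>w. F (of_real b * w)) holomorphic_on ball 0 1"
proof -
  show "continuous_on (cball 0 1) (\<lambda>w. F (of_real b * w))"
    by (rule continuous_on_compose2[OF assms(1)])
       (use dilation_mem[OF assms(3,4)] in \<open>auto intro!: continuous_intros\<close>)
  have "norm (of_real b * w) < 1" if "norm w < 1" for w :: complex
    using mult_right_mono[OF assms(4), of "norm w"] that assms(3) by (simp add: norm_mult)
  then show "(\<lambda>w. F (of_real b * w)) holomorphic_on ball 0 1"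
    by (intro holomorphic_on_compose_gen[OF _ assms(2), unfolded o_def] holomorphic_intros) auto
qed

text \<open>
  Contracting the argument makes a function holomorphic on the open disc continuous up to the boundary,
  as the integral formulas require.
\<close>

lemma strict_dilation:
  fixes g :: "complex \<Rightarrow> complex"
  assumes "g holomorphic_on ball 0 1" "0 \<le> b" "b < 1"
  shows "continuous_on (cball 0 1) (\<lambda>w. g (of_real b * w))"
    and "(\<lambda>w. g (of_real b * w)) holomorphic_on ball 0 1"
proof -
  have "(\<lambda>w. g (of_real b * w)) holomorphic_on cball 0 1"
    by (rule holomorphic_on_compose_gen[OF _ assms(1), unfolded o_def])
       (use dilation_mem_less[OF assms(2,3)] in \<open>auto intro!: holomorphic_intros\<close>)
  then show "continuous_on (cball 0 1) (\<lambda>w. g (of_real b * w))"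
     "(\<lambda>w. g (of_real b * w)) holomorphic_on ball 0 1"
    by (auto intro: holomorphic_on_imp_continuous_on holomorphic_on_subset)
qed

lemma integrable_circle_sq:
  assumes F: "continuous_on (cball 0 1) F" and r: "0 \<le> r" "r \<le> 1"
  shows "integrable circ (\<lambda>t. (norm (F (of_real r * cis t)))\<^sup>2)"
  by (rule integrable_circle_comp[where f = "\<lambda>z. (norm (F z))\<^sup>2"])
     (intro continuous_intros continuous_on_sphere_of_cball[OF F] r)+

lemma circle_mean_sq_mono:
  assumes F: "continuous_on (cball 0 1) F" "F holomorphic_on ball 0 1" and a: "0 \<le> a" "a \<le> 1"
  shows "circle_mean_sq F a \<le> circle_mean_sq F 1"
proof (cases "a = 1")
  case False
  then have a1: "a < 1" using a by simp
  have n: "norm (of_real a * cis t) < 1" for t using a a1 by (simp add: norm_mult)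
  define u where "u t = norm (F (cis t))" for t
  have u: "integrable circ u" unfolding u_def
    by (intro integrable_norm circ_cis_comp1 continuous_on_sphere_of_cball[OF F(1)]) simp
  have "ennreal (circle_mean_sq F a) = (\<integral>\<^sup>+t. ennreal ((norm (F (of_real a * cis t)))\<^sup>2) \<partial>circ)"
    unfolding circle_mean_sq_def
    by (rule nn_integral_eq_integral[symmetric]) (use integrable_circle_sq[OF F(1) a] in auto)
  also have "\<dots> \<le> (\<integral>\<^sup>+t. ennreal ((\<integral>s. poisson (of_real a * cis t) s * u s \<partial>circ) powr 2) \<partial>circ)"
  proof (intro nn_integral_mono ennreal_leI)
    fix t
    have "norm (F (of_real a * cis t)) \<le> (\<integral>s. poisson (of_real a * cis t) s * u s \<partial>circ)"
      unfolding u_def by (rule norm_poisson_le[OF F n])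
    then show "(norm (F (of_real a * cis t)))\<^sup>2 \<le> (\<integral>s. poisson (of_real a * cis t) s * u s \<partial>circ) powr 2"
      using order_trans[OF norm_ge_zero] by (subst powr_numeral) (auto intro!: power_mono)
  qed
  also have "\<dots> \<le> (\<integral>\<^sup>+t. ennreal (u t powr 2) \<partial>circ)"
    by (rule poisson_Lp_contraction[OF a(1) a1 _ u]) (auto simp: u_def)
  also have "\<dots> = ennreal (circle_mean_sq F 1)"
    unfolding circle_mean_sq_def using integrable_circle_sq[OF F(1), of 1]
    by (subst nn_integral_eq_integral) (auto simp: u_def)
  finally show ?thesis
    by (subst (asm) ennreal_le_iff) (auto simp: circle_mean_sq_def intro!: integral_nonneg_AE)
qed simp

lemma cnj_measurable [measurable]: "cnj \<in> borel_measurable borel"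
  by (intro borel_measurable_continuous_onI continuous_intros)

text \<open>
  Passing from \<open>F\<close> to its values on the circle of radius \<open>b\<close> is a self-adjoint operation, the Poisson
  integral. Moving one of its two applications to the other factor lets the radii multiply.
\<close>

lemma circle_inner_product:
  assumes F: "continuous_on (cball 0 1) F" "F holomorphic_on ball 0 1" and b: "0 \<le> b" "b < 1"
  shows "(\<integral>t. F (cis t) * cnj (F (of_real (b * b) * cis t)) \<partial>circ) = of_real (circle_mean_sq F b)"
proof -
  have n: "norm (of_real b * cis t) < 1" for t using b by (simp add: norm_mult)
  obtain B where "\<forall>x\<in>F ` cball 0 1. norm x \<le> B"
    using compact_imp_bounded[OF compact_continuous_image[OF F(1) compact_cball]]
    by (auto simp: bounded_iff)
  then have B: "norm (F z) \<le> B" if "norm z \<le> 1" for z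
    using that by auto
  then have B0: "B \<ge> 0" using norm_ge_zero order_trans[of 0 "norm (F 0)" B] by auto
  have [measurable]: "(\<lambda>t. F (cis t)) \<in> borel_measurable borel" "(\<lambda>t. F (of_real b * cis t)) \<in> borel_measurable borel"
    using circ_cis_comp(1)[OF continuous_on_sphere_of_cball[OF F(1)]] circ_cis_comp(1)[OF continuous_on_sphere_of_cball[OF F(1)], of 1] b
    by auto
  define f where "f s t = poisson (of_real b * cis t) s *\<^sub>R F (cis s) * cnj (F (of_real b * cis t))" for s t
  have f_le: "norm (f s t) \<le> (1 / (1 - b)\<^sup>2) * B * B" for s t
    unfolding f_def norm_mult norm_scaleR complex_mod_cnj real_norm_def
    using abs_poisson_le[OF n, of t s] B[of "cis s"] B[of "of_real b * cis t"] n[of t] b B0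
    by (intro mult_mono) (auto simp: norm_mult)
  have [measurable]: "(\<lambda>x. F (cis (fst x))) \<in> borel_measurable (circ \<Otimes>\<^sub>M circ)"
       "(\<lambda>x. F (of_real b * cis (snd x))) \<in> borel_measurable (circ \<Otimes>\<^sub>M circ)"
    by (rule measurable_compose[of fst _ borel "\<lambda>t. F (cis t)"] measurable_compose[of snd _ borel "\<lambda>t. F (of_real b * cis t)"]; measurable)+
  have "case_prod f \<in> borel_measurable (circ \<Otimes>\<^sub>M circ)"
    unfolding case_prod_beta f_def by measurable
  then have "integrable (circ \<Otimes>\<^sub>M circ) (case_prod f)"
    by (intro circ2.P.integrable_const_bound[of _ "(1 / (1 - b)\<^sup>2) * B * B"] AE_I2)
       (use f_le in auto)
  then have swap: "(\<integral>t. \<integral>s. f s t \<partial>circ \<partial>circ) = (\<integral>s. \<integral>t. f s t \<partial>circ \<partial>circ)"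
    by (rule circ2.Fubini_integral)
  have "(\<integral>s. f s t \<partial>circ) = of_real ((norm (F (of_real b * cis t)))\<^sup>2)" for t
  proof -
    have "(\<integral>s. f s t \<partial>circ) = (\<integral>s. poisson (of_real b * cis t) s *\<^sub>R F (cis s) \<partial>circ) * cnj (F (of_real b * cis t))"
      unfolding f_def by (rule Bochner_Integration.integral_mult_left_zero)
    then show ?thesis by (simp only: poisson_formula[OF F n] complex_norm_square)
  qed
  then have 1: "(\<integral>t. \<integral>s. f s t \<partial>circ \<partial>circ) = of_real (circle_mean_sq F b)"
    by (simp add: circle_mean_sq_def del: of_real_power)
  have 2: "(\<integral>t. f s t \<partial>circ) = F (cis s) * cnj (F (of_real (b * b) * cis s))" for s
  proof -
    have "(\<integral>t. f s t \<partial>circ) = (\<integral>t. F (cis s) * cnj (poisson (of_real b * cis s) t *\<^sub>R F (of_real b * cis t)) \<partial>circ)"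
      unfolding f_def by (subst poisson_sym) (simp add: mult_ac)
    also have "\<dots> = F (cis s) * cnj (\<integral>t. poisson (of_real b * cis s) t *\<^sub>R F (of_real b * cis t) \<partial>circ)"
      unfolding Bochner_Integration.integral_cnj[symmetric]
      by (rule Bochner_Integration.integral_mult_right_zero)
    also have "(\<integral>t. poisson (of_real b * cis s) t *\<^sub>R F (of_real b * cis t) \<partial>circ) = F (of_real b * (of_real b * cis s))"
      using poisson_formula[OF dilation[OF F b(1) less_imp_le[OF b(2)]] n] .
    finally show ?thesis by (simp add: mult.assoc)
  qed
  show ?thesis using swap unfolding 1 2 by simp
qed

text \<open>
  Expanding the square gives \<open>M(1) + M(b\<^sup>2) - 2 M(b)\<close> for the square means \<open>M\<close>, and
  \<open>M(b\<^sup>2) \<le> M(b)\<close>. Hence the \<open>L\<^sup>2\<close> distance between two circles is controlled by the growth of the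
  increasing function \<open>M\<close>.
\<close>

lemma circle_mean_sq_diff:
  assumes F: "continuous_on (cball 0 1) F" "F holomorphic_on ball 0 1" and b: "0 \<le> b" "b < 1"
  shows "(\<integral>t. (norm (F (cis t) - F (of_real (b * b) * cis t)))\<^sup>2 \<partial>circ) \<le> circle_mean_sq F 1 - circle_mean_sq F b"
proof -
  have bb: "0 \<le> b * b" "b * b \<le> 1" "b * b \<le> b" using b mult_left_le[of b b] by auto
  note c1 = continuous_on_sphere_of_cball[OF F(1), of 1, simplified]
  note cb = continuous_on_sphere_of_cball[OF F(1) bb(2)]
  have i1: "integrable circ (\<lambda>t. (norm (F (cis t)))\<^sup>2)"
    using integrable_circle_sq[OF F(1), of 1] by simp
  have i2: "integrable circ (\<lambda>t. (norm (F (of_real (b * b) * cis t)))\<^sup>2)"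
    using integrable_circle_sq[OF F(1) bb(1,2)] .
  have "continuous_on (sphere 0 1) (\<lambda>w. F w * cnj (F (of_real (b * b) * w)))"
    by (intro continuous_intros c1 continuous_on_compose2[OF F(1)])
       (use bb in \<open>auto simp: norm_mult simp flip: of_real_mult\<close>)
  then have i3: "integrable circ (\<lambda>t. F (cis t) * cnj (F (of_real (b * b) * cis t)))"
    by (rule circ_cis_comp1(2))
  have eq: "(norm (x - y))\<^sup>2 = (norm x)\<^sup>2 + (norm y)\<^sup>2 - 2 * Re (x * cnj y)" for x y :: complex
    unfolding cmod_power2 by (simp add: power2_eq_square algebra_simps)
  have "(\<integral>t. (norm (F (cis t) - F (of_real (b * b) * cis t)))\<^sup>2 \<partial>circ)
      = (\<integral>t. (norm (F (cis t)))\<^sup>2 \<partial>circ) + (\<integral>t. (norm (F (of_real (b * b) * cis t)))\<^sup>2 \<partial>circ)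
         - 2 * (\<integral>t. Re (F (cis t) * cnj (F (of_real (b * b) * cis t))) \<partial>circ)"
  proof -
    have "(\<integral>t. A t + B t - 2 * C t \<partial>circ) = (\<integral>t. A t \<partial>circ) + (\<integral>t. B t \<partial>circ) - 2 * (\<integral>t. C t \<partial>circ)"
      if "integrable circ A" "integrable circ B" "integrable circ C" for A B C :: "real \<Rightarrow> real"
      using that by simp
    from this[OF i1 i2 integrable_Re[OF i3]] show ?thesis unfolding eq .
  qed
  also have "(\<integral>t. Re (F (cis t) * cnj (F (of_real (b * b) * cis t))) \<partial>circ) = circle_mean_sq F b"
    unfolding integral_Re[OF i3] circle_inner_product[OF F b] by simp
  also have "(\<integral>t. (norm (F (cis t)))\<^sup>2 \<partial>circ) + (\<integral>t. (norm (F (of_real (b * b) * cis t)))\<^sup>2 \<partial>circ)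
     = circle_mean_sq F 1 + circle_mean_sq F (b * b)"
    by (simp add: circle_mean_sq_def)
  also have "circle_mean_sq F (b * b) \<le> circle_mean_sq F b"
  proof -
    have "circle_mean_sq (\<lambda>w. F (of_real b * w)) b \<le> circle_mean_sq (\<lambda>w. F (of_real b * w)) 1"
      using circle_mean_sq_mono[OF dilation[OF F b(1) less_imp_le[OF b(2)]]] b by simp
    then show ?thesis by (simp add: circle_mean_sq_def mult.assoc)
  qed
  finally show ?thesis by simp
qed

text \<open>
  The maximal inequality for \<open>g(sz) - g(b\<^sup>2 sz)\<close>, \<open>s < 1\<close>, combined with the \<open>L\<^sup>2\<close> bound for the same
  difference; then \<open>s \<rightarrow> 1\<close> by Fatou's lemma.
\<close>

lemma radial_oscillation_bound:
  fixes rr :: "nat \<Rightarrow> real"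
  assumes g: "g holomorphic_on ball 0 1" and b: "0 \<le> b" "b < 1"
    and L: "\<And>r. 0 \<le> r \<Longrightarrow> r < 1 \<Longrightarrow> circle_mean_sq g r \<le> L"
    and rr: "\<And>n. 0 \<le> rr n" "\<And>n. rr n < 1"
  shows "(\<integral>\<^sup>+t. (SUP n. ennreal ((norm (g (of_real (rr n) * cis t) - g (of_real (b * b * rr n) * cis t)))\<^sup>2)) \<partial>circ)
           \<le> ennreal (1024 * (L - circle_mean_sq g (b * b)))"
proof -
  \<comment> \<open>increasing to 1 and never below \<open>b\<close>, so that the square mean of \<open>g(s z)\<close> at radius \<open>b\<close> is at least that of \<open>g\<close> at \<open>b\<^sup>2\<close>\<close>
  define s :: "nat \<Rightarrow> real" where "s k = 1 - (1 - b) / real (k + 2)" for k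
  have s: "0 < s k" "s k < 1" "b \<le> s k" for k
  proof -
    have "(1 - b) / real (k + 2) \<le> (1 - b) / 2" "(1 - b) / real (k + 2) \<le> (1 - b) / 1"
      using b by (intro divide_left_mono; simp)+
    then have "(1 - b) / real (k + 2) < 1" "(1 - b) / real (k + 2) \<le> 1 - b"
      using b by simp_all
    then show "0 < s k" "b \<le> s k" unfolding s_def by simp_all
    show "s k < 1" using b by (simp add: s_def)
  qed
  have s_lim: "s \<longlonglongrightarrow> 1"
    unfolding s_def by real_asymp
  have cont: "continuous_on (ball 0 1) g" using g by (rule holomorphic_on_imp_continuous_on)
  define T where "T k n t = ennreal ((norm (g (of_real (s k * rr n) * cis t) - g (of_real (b * b * (s k * rr n)) * cis t)))\<^sup>2)" for k n t
  have bb: "0 \<le> b * b" "b * b < 1" using b mult_left_le[of b b] by auto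
  have meas_g[measurable]: "(\<lambda>t. g (of_real r * cis t)) \<in> borel_measurable borel" if "0 \<le> r" "r < 1" for r
    by (rule measurable_circle_comp) (use that in \<open>auto intro!: continuous_on_subset[OF cont]\<close>)
  have T_meas[measurable]: "T k n \<in> borel_measurable circ" for k n
  proof -
    have "s k * rr n < 1" "0 \<le> s k * rr n"
      using s[of k] rr[of n] mult_right_mono[of "s k" 1 "rr n"] by auto
    moreover then have "0 \<le> b * b * (s k * rr n)" "b * b * (s k * rr n) < 1"
      using bb mult_right_mono[of "b * b" 1 "s k * rr n"] by auto
    ultimately show ?thesis unfolding T_def using meas_g by measurable
  qed
  have T_int: "(\<integral>\<^sup>+t. (SUP n. T k n t) \<partial>circ) \<le> ennreal (1024 * (L - circle_mean_sq g (b * b)))" for k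
  proof -
    define F where "F w = g (of_real (s k) * w) - g (of_real (s k) * (of_real (b * b) * w))" for w
    define G where "G w = g (of_real (s k) * w)" for w
    note G = strict_dilation[OF g less_imp_le[OF s(1)] s(2), of k, folded G_def]
    note Gc = G(1) and Gh = G(2)
    have FG: "F w = G w - G (of_real (b * b) * w)" for w by (simp add: F_def G_def)
    note D = dilation[OF Gc Gh bb(1) less_imp_le[OF bb(2)]]
    have Fc: "continuous_on (cball 0 1) F" unfolding FG
      by (intro continuous_intros Gc D)
    have Fh: "F holomorphic_on ball 0 1" unfolding FG
      by (intro holomorphic_intros Gh D)
    have "(\<integral>\<^sup>+t. (SUP n. T k n t) \<partial>circ) = (\<integral>\<^sup>+t. (SUP n. ennreal ((norm (F (of_real (rr n) * cis t)))\<^sup>2)) \<partial>circ)"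
      unfolding T_def F_def by (simp add: mult_ac)
    also have "\<dots> \<le> 1024 * (\<integral>\<^sup>+t. ennreal ((norm (F (cis t)))\<^sup>2) \<partial>circ)"
      by (rule radial_maximal_inequality[OF Fc Fh rr])
    also have "(\<integral>\<^sup>+t. ennreal ((norm (F (cis t)))\<^sup>2) \<partial>circ) = ennreal (\<integral>t. (norm (F (cis t)))\<^sup>2 \<partial>circ)"
      using integrable_circle_sq[OF Fc, of 1] by (intro nn_integral_eq_integral) auto
    also have "(\<integral>t. (norm (F (cis t)))\<^sup>2 \<partial>circ) \<le> circle_mean_sq G 1 - circle_mean_sq G b"
      unfolding FG by (rule circle_mean_sq_diff[OF Gc Gh b])
    also have "circle_mean_sq G 1 - circle_mean_sq G b \<le> L - circle_mean_sq g (b * b)"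
    proof -
      have "circle_mean_sq G 1 = circle_mean_sq g (s k)" by (simp add: circle_mean_sq_def G_def)
      then have "circle_mean_sq G 1 \<le> L" using L[of "s k"] s[of k] by auto
      moreover have "circle_mean_sq g (b * b) \<le> circle_mean_sq G b"
      proof -
        have gb: "b * b \<le> s k * b" using s[of k] b by (intro mult_right_mono) auto
        define H where "H w = G (of_real b * w)" for w
        note H = dilation[OF Gc Gh b(1) less_imp_le[OF b(2)], folded H_def]
        have "circle_mean_sq H (b / s k) \<le> circle_mean_sq H 1"
          by (rule circle_mean_sq_mono[OF H]) (use s[of k] b in auto)
        moreover have "of_real (s k) * (of_real b * (of_real (b / s k) * w)) = of_real (b * b) * w" for w :: complex
          using s[of k] by simp
        then have "circle_mean_sq H (b / s k) = circle_mean_sq g (b * b)"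
          by (simp only: circle_mean_sq_def H_def G_def)
        moreover have "circle_mean_sq H 1 = circle_mean_sq G b"
          by (simp add: circle_mean_sq_def H_def)
        ultimately show ?thesis by simp
      qed
      ultimately show ?thesis by simp
    qed
    finally show ?thesis
      by (subst ennreal_mult') (simp_all add: ennreal_leI mult_left_mono)
  qed
  have "(\<integral>\<^sup>+t. (SUP n. ennreal ((norm (g (of_real (rr n) * cis t) - g (of_real (b * b * rr n) * cis t)))\<^sup>2)) \<partial>circ)
      \<le> (\<integral>\<^sup>+t. liminf (\<lambda>k. SUP n. T k n t) \<partial>circ)"
  proof (intro nn_integral_mono SUP_least)
    fix t n
    have lim: "(\<lambda>k. T k n t) \<longlonglongrightarrow> ennreal ((norm (g (of_real (rr n) * cis t) - g (of_real (b * b * rr n) * cis t)))\<^sup>2)"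
    proof -
      have *: "(\<lambda>k. g (of_real (c * (s k * rr n)) * cis t)) \<longlonglongrightarrow> g (of_real (c * rr n) * cis t)"
        if c: "0 \<le> c" "c \<le> 1" for c
      proof (rule isCont_tendsto_compose[where g = g])
        have "c * rr n < 1" "0 \<le> c * rr n" using rr[of n] c mult_right_mono[of c 1 "rr n"] by auto
        then have "of_real (c * rr n) * cis t \<in> ball 0 1" by (simp add: norm_mult del: of_real_mult)
        then show "isCont g (of_real (c * rr n) * cis t)"
          using cont continuous_on_eq_continuous_at[of "ball 0 1" g] by auto
        have "(\<lambda>k. of_real (c * (s k * rr n)) * cis t) \<longlonglongrightarrow> of_real (c * (1 * rr n)) * cis t"
          by (intro tendsto_intros s_lim)
        then show "(\<lambda>k. of_real (c * (s k * rr n)) * cis t) \<longlonglongrightarrow> of_real (c * rr n) * cis t" by simp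
      qed
      show ?thesis unfolding T_def
        using *[of 1] *[of "b * b"] bb by (intro tendsto_intros) auto
    qed
    have "ennreal ((norm (g (of_real (rr n) * cis t) - g (of_real (b * b * rr n) * cis t)))\<^sup>2) = liminf (\<lambda>k. T k n t)"
      using lim_imp_Liminf[OF _ lim] by simp
    also have "\<dots> \<le> liminf (\<lambda>k. SUP n. T k n t)"
      by (intro Liminf_mono always_eventually allI SUP_upper) simp
    finally show "ennreal ((norm (g (of_real (rr n) * cis t) - g (of_real (b * b * rr n) * cis t)))\<^sup>2) \<le> liminf (\<lambda>k. SUP n. T k n t)" .
  qed
  also have "\<dots> \<le> liminf (\<lambda>k. \<integral>\<^sup>+t. (SUP n. T k n t) \<partial>circ)"
    by (rule nn_integral_liminf) measurable
  also have "\<dots> \<le> ennreal (1024 * (L - circle_mean_sq g (b * b)))"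
    by (rule order_trans[OF Liminf_le_Limsup Limsup_bounded]) (use T_int in auto)
  finally show ?thesis .
qed

text \<open>
  Approximation near 1 by functions that have a limit there gives the Cauchy criterion.
\<close>

lemma has_left_limit_of_uniform_approximation:
  fixes f :: "real \<Rightarrow> complex"
  assumes "\<And>e. e > 0 \<Longrightarrow> \<exists>h l. (h \<longlongrightarrow> l) (at_left 1) \<and> (\<forall>\<^sub>F r in at_left 1. norm (f r - h r) \<le> e)"
  shows "\<exists>l. (f \<longlongrightarrow> l) (at_left 1)"
proof -
  have "cauchy_filter (filtermap f (at_left 1))"
    unfolding cauchy_filter_metric_filtermap
  proof (intro allI impI)
    fix e :: real assume "e > 0"
    then obtain h l where h: "(h \<longlongrightarrow> l) (at_left 1)" and le: "\<forall>\<^sub>F r in at_left 1. norm (f r - h r) \<le> e / 4"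
      using assms[of "e / 4"] by auto
    have "\<forall>\<^sub>F r in at_left 1. dist (h r) l < e / 4"
      using h \<open>e > 0\<close> by (intro tendstoD) auto
    with le have "\<forall>\<^sub>F r in at_left 1. dist (f r) l < e / 2"
    proof eventually_elim
      case (elim r)
      then show ?case using dist_triangle[of "f r" l "h r"] by (simp add: dist_norm)
    qed
    then show "\<exists>P. eventually P (at_left 1) \<and> (\<forall>x y. P x \<and> P y \<longrightarrow> dist (f x) (f y) < e)"
      by (intro exI[of _ "\<lambda>r. dist (f r) l < e / 2"]) (auto intro: dist_triangle_half_l)
  qed
  moreover have "filtermap f (at_left 1) \<noteq> bot"
    by (simp add: filtermap_bot_iff trivial_limit_at_left_real)
  ultimately show ?thesis
    using complete_UNIV[where 'a = complex] unfolding complete_uniform filterlim_def by auto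
qed

text \<open>
  The square means of \<open>g\<close> increase to a finite limit, so by \<open>radial_oscillation_bound\<close> the dilations
  \<open>r \<mapsto> g(b\<^sup>2 r e\<^sup>i\<^sup>t)\<close> approximate \<open>r \<mapsto> g(r e\<^sup>i\<^sup>t)\<close> uniformly in \<open>r\<close>, as closely as desired, for almost
  every \<open>t\<close>. The dilations are continuous up to \<open>r = 1\<close>.
\<close>

theorem Fatou_radial_limits:
  assumes g: "g holomorphic_on ball 0 1" and bdd: "bounded (g ` ball 0 1)"
  shows "AE t in circ. \<exists>l. ((\<lambda>r. g (of_real r * cis t)) \<longlongrightarrow> l) (at_left (1::real))"
proof -
  obtain B where "\<forall>x\<in>g ` ball 0 1. norm x \<le> B"
    using bdd by (auto simp: bounded_iff)
  then have B: "norm (g z) \<le> B" if "norm z < 1" for z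
    using that by auto
  then have B0: "B \<ge> 0" using norm_ge_zero order_trans[of 0 "norm (g 0)" B] by auto
  have cont: "continuous_on (ball 0 1) g" using g by (rule holomorphic_on_imp_continuous_on)
  have le_B: "circle_mean_sq g r \<le> B\<^sup>2" if "0 \<le> r" "r < 1" for r
  proof -
    have "integrable circ (\<lambda>t. (norm (g (of_real r * cis t)))\<^sup>2)"
      by (rule integrable_circle_comp[where f = "\<lambda>z. (norm (g z))\<^sup>2"])
         (use that in \<open>auto intro!: continuous_intros continuous_on_subset[OF cont]\<close>)
    then have "circle_mean_sq g r \<le> (\<integral>t. B\<^sup>2 \<partial>circ)"
      unfolding circle_mean_sq_def by (rule integral_mono) (use that in \<open>auto intro!: power_mono B simp: norm_mult\<close>)
    then show ?thesis by (simp add: circ.prob_space[simplified])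
  qed
  define L where "L = (SUP r\<in>{0..<1}. circle_mean_sq g r)"
  have bddA: "bdd_above (circle_mean_sq g ` {0..<1})"
    by (rule bdd_aboveI2[of _ _ "B\<^sup>2"]) (use le_B in auto)
  have L: "circle_mean_sq g r \<le> L" if "0 \<le> r" "r < 1" for r
    unfolding L_def using that by (intro cSUP_upper bddA) auto
  obtain rr :: "nat \<Rightarrow> real" where rr: "range rr = \<rat> \<inter> {0..<1}"
  proof -
    have "countable (\<rat> \<inter> {0..<1::real})" using countable_rat by (rule countable_Int1)
    moreover have "(0::real) \<in> \<rat> \<inter> {0..<1}" by simp
    ultimately have "range (from_nat_into (\<rat> \<inter> {0..<1::real})) = \<rat> \<inter> {0..<1}"
      by (intro range_from_nat_into) blast+
    then show ?thesis by (rule that)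
  qed
  have rr01: "0 \<le> rr n" "rr n < 1" for n using rr by auto
  define D where "D b t = (SUP n. ennreal ((norm (g (of_real (rr n) * cis t) - g (of_real (b * b * rr n) * cis t)))\<^sup>2))" for b t
  have meas_g: "(\<lambda>t. g (of_real r * cis t)) \<in> borel_measurable borel" if "0 \<le> r" "r < 1" for r
    by (rule measurable_circle_comp) (use that in \<open>auto intro!: continuous_on_subset[OF cont]\<close>)
  have bound: "\<exists>b. 0 \<le> b \<and> b < 1 \<and> (\<integral>\<^sup>+t. D b t \<partial>circ) \<le> ennreal (1 / real (Suc n))" for n
  proof -
    \<comment> \<open>1024 is the constant of the maximal inequality; the square root below undoes the product \<open>b * b\<close> in \<open>D\<close>\<close>
    define e where "e = 1 / (1024 * real (Suc n))"
    have "e > 0" by (simp add: e_def)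
    then obtain r where r: "0 \<le> r" "r < 1" "L - e < circle_mean_sq g r"
      using less_cSUP_iff[OF _ bddA, of "L - e"] unfolding L_def by auto
    have "sqrt r * sqrt r = r" using r by simp
    moreover have "(\<integral>\<^sup>+t. D (sqrt r) t \<partial>circ) \<le> ennreal (1024 * (L - circle_mean_sq g (sqrt r * sqrt r)))"
      unfolding D_def by (rule radial_oscillation_bound[OF g _ _ L rr01]) (use r in \<open>auto\<close>)
    moreover have "1024 * (L - circle_mean_sq g r) \<le> 1 / real (Suc n)"
    proof -
      have "1024 * e = 1 / real (Suc n)" by (simp add: e_def divide_simps)
      moreover have "1024 * (L - circle_mean_sq g r) \<le> 1024 * e" using r(3) by simp
      ultimately show ?thesis by (simp only:)
    qed
    ultimately show ?thesis using r
      by (intro exI[of _ "sqrt r"]) (auto intro: order_trans ennreal_leI)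
  qed
  then obtain b where b: "\<And>n. 0 \<le> b n" "\<And>n. b n < 1" "\<And>n. (\<integral>\<^sup>+t. D (b n) t \<partial>circ) \<le> ennreal (1 / real (Suc n))"
    by metis
  have D_meas[measurable]: "D (b n) \<in> borel_measurable circ" for n
  proof -
    have [measurable]: "(\<lambda>t. g (of_real (rr k) * cis t)) \<in> borel_measurable borel"
      "(\<lambda>t. g (of_real (b n * b n * rr k) * cis t)) \<in> borel_measurable borel" for k
    proof -
      have "0 \<le> b n * b n" "b n * b n \<le> 1" using b(1,2)[of n] mult_le_one[of "b n" "b n"] by auto
      then have "0 \<le> b n * b n * rr k" "b n * b n * rr k < 1"
        using mult_right_mono[of "b n * b n" 1 "rr k"] rr01[of k] by auto
      then show "(\<lambda>t. g (of_real (rr k) * cis t)) \<in> borel_measurable borel"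
         "(\<lambda>t. g (of_real (b n * b n * rr k) * cis t)) \<in> borel_measurable borel"
        using meas_g rr01 by blast+
    qed
    show ?thesis unfolding D_def by measurable
  qed
  have "(\<integral>\<^sup>+t. (INF n. D (b n) t) \<partial>circ) \<le> ennreal (1 / real (Suc n))" for n
    by (rule order_trans[OF nn_integral_mono b(3)]) (auto intro: INF_lower)
  moreover have "(\<lambda>n. ennreal (1 / real (Suc n))) \<longlonglongrightarrow> ennreal 0"
    by (intro tendsto_ennrealI) real_asymp
  ultimately have "(\<integral>\<^sup>+t. (INF n. D (b n) t) \<partial>circ) \<le> 0"
    by (intro LIMSEQ_le_const) auto
  then have "AE t in circ. (INF n. D (b n) t) = 0"
    by (subst (asm) le_zero_eq, subst (asm) nn_integral_0_iff_AE) auto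
  then show ?thesis
  proof eventually_elim
    case (elim t)
    show ?case
    proof (rule has_left_limit_of_uniform_approximation)
      fix e :: real assume e: "e > 0"
      then have "(INF n. D (b n) t) < ennreal (e\<^sup>2)" using elim by simp
      then obtain n where n: "D (b n) t < ennreal (e\<^sup>2)" by (auto simp: INF_less_iff)
      define c where "c = b n * b n"
      have c: "0 \<le> c" "c < 1" unfolding c_def
        using b(1,2)[of n] mult_left_le[of "b n" "b n"] by auto
      have c_mem: "of_real (c * r) * cis t \<in> ball 0 1" if "0 \<le> r" "r \<le> 1" for r
        using that c mult_left_le[of r c] by (simp add: norm_mult)
      have rat: "norm (g (of_real r * cis t) - g (of_real (c * r) * cis t)) \<le> e" if "r \<in> \<rat> \<inter> {0..<1}" for r
      proof -
        obtain k where "r = rr k" using \<open>r \<in> _\<close> unfolding rr[symmetric] by auto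
        then have "ennreal ((norm (g (of_real r * cis t) - g (of_real (c * r) * cis t)))\<^sup>2) \<le> D (b n) t"
          unfolding D_def c_def by (auto intro!: SUP_upper)
        also have "\<dots> \<le> ennreal (e\<^sup>2)" using n by simp
        finally show ?thesis using e by (auto intro: power2_le_imp_le)
      qed
      have contr: "continuous_on {0..<1} (\<lambda>r. norm (g (of_real r * cis t) - g (of_real (c * r) * cis t)))"
        by (intro continuous_intros continuous_on_compose2[OF cont])
           (use c_mem in \<open>auto simp: norm_mult\<close>)
      have all: "norm (g (of_real r * cis t) - g (of_real (c * r) * cis t)) \<le> e" if r: "0 < r" "r < 1" for r
      proof -
        have "r \<in> closure (\<rat> \<inter> {0<..<1})"
        proof -
          have "open {0<..<1::real}" by simp
          from open_Int_closure_subset[OF this, of \<rat>] r show ?thesis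
            by (auto simp: Rats_closure_real Int_commute)
        qed
        then obtain x where x: "\<And>k. x k \<in> \<rat> \<inter> {0<..<1}" "x \<longlonglongrightarrow> r"
          unfolding closure_sequential by blast
        have "isCont (\<lambda>r. norm (g (of_real r * cis t) - g (of_real (c * r) * cis t))) r"
          using continuous_on_subset[OF contr, of "{0<..<1}"] r
          by (simp add: continuous_on_eq_continuous_at subset_eq)
        from isCont_tendsto_compose[OF this x(2)] show ?thesis
        proof (rule LIMSEQ_le_const2)
          have "norm (g (of_real (x k) * cis t) - g (of_real (c * x k) * cis t)) \<le> e" for k
            by (rule rat) (use x(1)[of k] in auto)
          then show "\<exists>N. \<forall>n\<ge>N. norm (g (of_real (x n) * cis t) - g (of_real (c * x n) * cis t)) \<le> e"
            by blast
        qed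
      qed
      have "isCont g (of_real (c * 1) * cis t)"
        using cont continuous_on_eq_continuous_at[of "ball 0 1" g] c_mem[of 1] by auto
      then have "((\<lambda>r. g (of_real (c * r) * cis t)) \<longlongrightarrow> g (of_real (c * 1) * cis t)) (at_left 1)"
        by (rule isCont_tendsto_compose) (intro tendsto_intros)
      moreover have "\<forall>\<^sub>F r in at_left 1. norm (g (of_real r * cis t) - g (of_real (c * r) * cis t)) \<le> e"
      proof (rule eventually_mono)
        show "\<forall>\<^sub>F r in at_left (1::real). r \<in> {0<..<1}" by (rule eventually_at_left_real) simp
      qed (rule all; simp)
      ultimately show "\<exists>h l. (h \<longlongrightarrow> l) (at_left 1) \<and>
                (\<forall>\<^sub>F r in at_left 1. norm (g (of_real r * cis t) - h r) \<le> e)" by blast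
    qed
  qed
qed

section \<open>A criterion for outer functions\<close>

text \<open>
  The boundary function of \<^const>\<open>radial_limit\<close> is only Lebesgue measurable. The next lemmas
  translate between the Lebesgue measure on \<open>[0, 2\<pi>]\<close> and \<^const>\<open>circ\<close> and replace Lebesgue measurable
  functions by Borel ones.
\<close>

lemma AE_circ_iff: "(AE t in circ. P t) \<longleftrightarrow> (AE t in circle_measure. P t)"
proof -
  have "(AE t in circ. P t) \<longleftrightarrow> (AE t in lborel. t \<in> {0..2*pi} \<longrightarrow> P t)"
    unfolding circ_eq_density by (subst AE_density) (auto simp: indicator_def)
  also have "\<dots> \<longleftrightarrow> (AE t in lebesgue. t \<in> {0..2*pi} \<longrightarrow> P t)"
    by (simp add: AE_completion_iff)
  also have "\<dots> \<longleftrightarrow> (AE t in circle_measure. P t)"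
    by (subst AE_restrict_space_iff) auto
  finally show ?thesis .
qed

lemma measurable_circle_measure_AE:
  fixes f g :: "real \<Rightarrow> 'b :: euclidean_space"
  assumes f: "f \<in> borel_measurable borel" and eq: "AE t in circle_measure. f t = g t"
  shows "g \<in> borel_measurable circle_measure"
proof -
  have "f \<in> borel_measurable lebesgue" using f by (intro measurable_completion) simp
  then have m: "(\<lambda>t. if t \<in> {0..2*pi} then f t else 0) \<in> borel_measurable lebesgue"
    by (subst borel_measurable_if) (auto intro: measurable_restrict_space1)
  have "AE t in lebesgue. t \<in> {0..2*pi} \<longrightarrow> f t = g t"
    using eq by (subst (asm) AE_restrict_space_iff) auto
  then have ae: "AE t in lebesgue. (if t \<in> {0..2*pi} then f t else 0) = (if t \<in> {0..2*pi} then g t else 0)"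
    by eventually_elim auto
  have "(\<lambda>t. if t \<in> {0..2*pi} then g t else 0) \<in> borel_measurable lebesgue"
    using borel_measurable_AE[OF m ae] .
  then show ?thesis by (subst (asm) borel_measurable_if) auto
qed

lemma borel_version_circle_measure:
  fixes g :: "real \<Rightarrow> real"
  assumes "g \<in> borel_measurable circle_measure"
  obtains f where "f \<in> borel_measurable borel" "AE t in circle_measure. f t = g t"
proof -
  have "(\<lambda>t. if t \<in> {0..2*pi} then g t else 0) \<in> borel_measurable lebesgue"
    using assms by (subst borel_measurable_if) auto
  from completion_ex_borel_measurable_real[OF this]
  obtain f where f: "f \<in> borel_measurable lborel" "AE t in lborel. (if t \<in> {0..2*pi} then g t else 0) = f t"
    by auto
  then have "AE t in lebesgue. t \<in> {0..2*pi} \<longrightarrow> f t = g t"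
    unfolding AE_completion_iff by (auto elim!: eventually_mono split: if_splits)
  then have "AE t in circle_measure. f t = g t"
    by (subst AE_restrict_space_iff) auto
  with f(1) show ?thesis by (intro that[of f]) auto
qed

lemma integrable_circ_iff:
  fixes f :: "real \<Rightarrow> 'b :: euclidean_space"
  assumes [measurable]: "f \<in> borel_measurable borel"
  shows "integrable circ f \<longleftrightarrow> integrable circle_measure f"
proof -
  have [measurable]: "f \<in> borel_measurable lebesgue" using assms by (intro measurable_completion) simp
  have "integrable circ f \<longleftrightarrow> integrable lborel (\<lambda>t. (indicator {0..2*pi} t / (2*pi)) *\<^sub>R f t)"
    unfolding circ_eq_density by (subst integrable_density) auto
  also have "(\<lambda>t. (indicator {0..2*pi} t / (2*pi)) *\<^sub>R f t) = (\<lambda>t. (1 / (2*pi)) *\<^sub>R (indicator {0..2*pi} t *\<^sub>R f t))"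
    by (auto simp: fun_eq_iff)
  also have "integrable lborel \<dots> \<longleftrightarrow> integrable lborel (\<lambda>t. indicator {0..2*pi} t *\<^sub>R f t)"
    (is "integrable lborel (\<lambda>t. (1 / (2*pi)) *\<^sub>R ?h t) \<longleftrightarrow> _")
  proof
    assume "integrable lborel (\<lambda>t. (1 / (2*pi)) *\<^sub>R ?h t)"
    then have "integrable lborel (\<lambda>t. (2*pi) *\<^sub>R ((1 / (2*pi)) *\<^sub>R ?h t))"
      by (rule integrable_scaleR_right)
    moreover have "(2*pi) *\<^sub>R ((1 / (2*pi)) *\<^sub>R x) = x" for x :: 'b by simp
    ultimately show "integrable lborel ?h" by (simp only:)
  next
    assume "integrable lborel ?h"
    then show "integrable lborel (\<lambda>t. (1 / (2*pi)) *\<^sub>R ?h t)"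
      by (rule integrable_scaleR_right)
  qed
  also have "\<dots> \<longleftrightarrow> integrable lebesgue (\<lambda>t. indicator {0..2*pi} t *\<^sub>R f t)"
    by (subst integrable_completion) auto
  also have "\<dots> \<longleftrightarrow> integrable circle_measure f"
    by (subst integrable_restrict_space) (auto simp: set_integrable_def)
  finally show ?thesis .
qed

text \<open>
  A bound in \<open>L\<^sup>p\<close> with \<open>p > 1\<close> gives uniform integrability: cutting off at height \<open>k\<close> changes each
  function by at most \<open>C k\<^sup>1\<^sup>-\<^sup>p\<close> in \<open>L\<^sup>1\<close>, and the truncated functions converge by dominated convergence.
\<close>

lemma (in prob_space) L1_convergence_of_Lp_bounded:
  fixes f :: "nat \<Rightarrow> 'a \<Rightarrow> real"
  assumes p: "p > 1"
    and [measurable]: "\<And>n. f n \<in> borel_measurable M" "g \<in> borel_measurable M"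
    and lim: "AE x in M. (\<lambda>n. f n x) \<longlonglongrightarrow> g x"
    and bound: "\<And>n. (\<integral>\<^sup>+x. ennreal (\<bar>f n x\<bar> powr p) \<partial>M) \<le> ennreal C"
  shows "\<And>n. integrable M (f n)" and "integrable M g" and "integrable M (\<lambda>x. \<bar>g x\<bar> powr p)"
    and "(\<lambda>n. \<integral>x. \<bar>f n x - g x\<bar> \<partial>M) \<longlonglongrightarrow> 0"
proof -
  have "(\<integral>\<^sup>+x. ennreal (\<bar>g x\<bar> powr p) \<partial>M) = (\<integral>\<^sup>+x. liminf (\<lambda>n. ennreal (\<bar>f n x\<bar> powr p)) \<partial>M)"
  proof (rule nn_integral_cong_AE)
    show "AE x in M. ennreal (\<bar>g x\<bar> powr p) = liminf (\<lambda>n. ennreal (\<bar>f n x\<bar> powr p))"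
      using lim
    proof eventually_elim
      case (elim x)
      have "(\<lambda>n. \<bar>f n x\<bar> powr p) \<longlonglongrightarrow> \<bar>g x\<bar> powr p"
        using p by (intro tendsto_powr' tendsto_rabs elim tendsto_const) auto
      then have "(\<lambda>n. ennreal (\<bar>f n x\<bar> powr p)) \<longlonglongrightarrow> ennreal (\<bar>g x\<bar> powr p)"
        by (rule tendsto_ennrealI)
      then show ?case by (rule lim_imp_Liminf[OF trivial_limit_sequentially, symmetric])
    qed
  qed
  also have "\<dots> \<le> liminf (\<lambda>n. \<integral>\<^sup>+x. ennreal (\<bar>f n x\<bar> powr p) \<partial>M)"
    by (rule nn_integral_liminf) measurable
  also have "\<dots> \<le> ennreal C"
    by (rule order_trans[OF Liminf_le_Limsup Limsup_bounded]) (use bound in auto)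
  finally have bound_g: "(\<integral>\<^sup>+x. ennreal (\<bar>g x\<bar> powr p) \<partial>M) \<le> ennreal C" .
  have *: "integrable M (\<lambda>x. \<bar>h x\<bar> powr p)" "integrable M h" "(\<integral>x. \<bar>h x\<bar> powr p \<partial>M) \<le> max C 0"
    if [measurable]: "h \<in> borel_measurable M" and le: "(\<integral>\<^sup>+x. ennreal (\<bar>h x\<bar> powr p) \<partial>M) \<le> ennreal C" for h
  proof -
    show 1: "integrable M (\<lambda>x. \<bar>h x\<bar> powr p)"
      by (rule integrableI_bounded) (use le in \<open>auto intro: le_less_trans\<close>)
    have "\<bar>h x\<bar> \<le> 1 + \<bar>h x\<bar> powr p" for x
    proof (cases "\<bar>h x\<bar> \<le> 1")
      case False
      then have "\<bar>h x\<bar> powr 1 \<le> \<bar>h x\<bar> powr p" using p by (intro powr_mono) auto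
      then show ?thesis using False by simp
    qed (use powr_ge_zero[of "\<bar>h x\<bar>" p] in linarith)
    then show "integrable M h"
      by (intro Bochner_Integration.integrable_bound[OF Bochner_Integration.integrable_add[OF integrable_const[of 1] 1]]) auto
    have "ennreal (\<integral>x. \<bar>h x\<bar> powr p \<partial>M) \<le> ennreal C"
      using le by (subst nn_integral_eq_integral[symmetric, OF 1]) auto
    then show "(\<integral>x. \<bar>h x\<bar> powr p \<partial>M) \<le> max C 0"
      by (cases "C \<ge> 0") (auto simp: ennreal_neg)
  qed
  show f: "integrable M (f n)" for n by (rule *(2)) (use bound in auto)
  show g: "integrable M g" "integrable M (\<lambda>x. \<bar>g x\<bar> powr p)" by (rule *; use bound_g in auto)+
  show "(\<lambda>n. \<integral>x. \<bar>f n x - g x\<bar> \<partial>M) \<longlonglongrightarrow> 0"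
  proof (rule LIMSEQ_I)
    fix e :: real assume e: "e > 0"
    define C' where "C' = max C 0"
    have "((\<lambda>k::real. 2 * C' * k powr (1 - p)) \<longlongrightarrow> 2 * C' * 0) at_top"
      by (intro tendsto_mult tendsto_const tendsto_neg_powr filterlim_ident) (use p in auto)
    then have "\<forall>\<^sub>F k in at_top. 2 * C' * k powr (1 - p) < e / 2"
      by (rule order_tendstoD) (use e in auto)
    then obtain k :: real where k: "k > 0" "2 * C' * k powr (1 - p) < e / 2"
      using eventually_conj[OF eventually_gt_at_top[of 0]] eventually_happens'[OF trivial_limit_at_top_linorder]
      by (metis (mono_tags, lifting))
    define T where "T x = max (- k) (min k x)" for x
    have T_le: "\<bar>x - T x\<bar> \<le> k powr (1 - p) * \<bar>x\<bar> powr p" for x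
    proof (cases "\<bar>x\<bar> \<le> k")
      case True
      then have "T x = x" by (auto simp: T_def)
      then show ?thesis by simp
    next
      case False
      have "\<bar>x - T x\<bar> \<le> \<bar>x\<bar>" using False k(1) by (auto simp: T_def)
      also have "\<dots> = \<bar>x\<bar> powr (1 - p) * \<bar>x\<bar> powr p"
        using False k(1) by (simp flip: powr_add)
      also have "\<dots> \<le> k powr (1 - p) * \<bar>x\<bar> powr p"
        using False k(1) p by (intro mult_right_mono powr_mono2') auto
      finally show ?thesis .
    qed
    have [measurable]: "T \<in> borel_measurable borel" unfolding T_def by measurable
    have "(\<lambda>n. \<integral>x. \<bar>T (f n x) - T (g x)\<bar> \<partial>M) \<longlonglongrightarrow> (\<integral>x. 0 \<partial>M)"
    proof (rule integral_dominated_convergence[where w = "\<lambda>_. 2 * k"])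
      show "AE x in M. (\<lambda>n. \<bar>T (f n x) - T (g x)\<bar>) \<longlonglongrightarrow> 0"
        using lim
      proof eventually_elim
        case (elim x)
        have "(\<lambda>n. \<bar>T (f n x) - T (g x)\<bar>) \<longlonglongrightarrow> \<bar>T (g x) - T (g x)\<bar>"
          unfolding T_def by (intro tendsto_intros elim)
        then show ?case by simp
      qed
      show "AE x in M. norm \<bar>T (f n x) - T (g x)\<bar> \<le> 2 * k" for n
        using k(1) by (intro AE_I2) (auto simp: T_def abs_le_iff)
    qed auto
    then have "\<forall>\<^sub>F n in sequentially. (\<integral>x. \<bar>T (f n x) - T (g x)\<bar> \<partial>M) < e / 2"
      using e by (intro order_tendstoD) auto
    then obtain N where N: "\<And>n. n \<ge> N \<Longrightarrow> (\<integral>x. \<bar>T (f n x) - T (g x)\<bar> \<partial>M) < e / 2"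
      by (auto simp: eventually_sequentially)
    have "(\<integral>x. \<bar>f n x - g x\<bar> \<partial>M) < e" if n: "n \<ge> N" for n
    proof -
      have iT: "integrable M (\<lambda>x. \<bar>T (f n x) - T (g x)\<bar>)"
        using k(1) by (intro integrable_const_bound[of _ "2 * k"] AE_I2) (auto simp: T_def abs_le_iff)
      note ip = *(1)[OF _ bound[of n]] *(1)[OF _ bound_g]
      have "(\<integral>x. \<bar>f n x - g x\<bar> \<partial>M) \<le>
         (\<integral>x. \<bar>T (f n x) - T (g x)\<bar> + (k powr (1 - p) * \<bar>f n x\<bar> powr p + k powr (1 - p) * \<bar>g x\<bar> powr p) \<partial>M)"
      proof (rule integral_mono)
        show "\<bar>f n x - g x\<bar> \<le> \<bar>T (f n x) - T (g x)\<bar> + (k powr (1 - p) * \<bar>f n x\<bar> powr p + k powr (1 - p) * \<bar>g x\<bar> powr p)" for x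
          using T_le[of "f n x"] T_le[of "g x"] by linarith
      qed (use f g ip iT in auto)
      also have "\<dots> = (\<integral>x. \<bar>T (f n x) - T (g x)\<bar> \<partial>M) + (k powr (1 - p) * (\<integral>x. \<bar>f n x\<bar> powr p \<partial>M) + k powr (1 - p) * (\<integral>x. \<bar>g x\<bar> powr p \<partial>M))"
        using ip iT by simp
      also have "\<dots> \<le> (\<integral>x. \<bar>T (f n x) - T (g x)\<bar> \<partial>M) + (k powr (1 - p) * C' + k powr (1 - p) * C')"
        using *(3)[OF _ bound[of n]] *(3)[OF _ bound_g] unfolding C'_def
        by (intro add_left_mono add_mono mult_left_mono) auto
      also have "\<dots> < e / 2 + e / 2"
        using N[OF n] k(2) by (simp add: mult_ac)
      finally show ?thesis by simp
    qed
    then show "\<exists>N. \<forall>n\<ge>N. norm ((\<integral>x. \<bar>f n x - g x\<bar> \<partial>M) - 0) < e"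
      by (intro exI[of _ N]) (auto simp: abs_of_nonneg)
  qed
qed

text \<open>
  Radial limits exist almost everywhere by Fatou's theorem, and Fatou's lemma shows that they are
  nonzero almost everywhere. Since \<open>p > 1\<close>, the functions \<open>log |g(r e\<^sup>i\<^sup>t)|\<close> even converge in \<open>L\<^sup>1\<close> as
  \<open>r \<rightarrow> 1\<close>, so the Schwarz formula for a logarithm of \<open>g(rz)\<close> passes to the limit and is the
  representation that defines outer functions. An \<open>L\<^sup>1\<close> bound would not suffice: singular
  inner functions satisfy it.
\<close>

theorem outer_function_criterion:
  assumes g: "g holomorphic_on ball 0 1" and nz: "\<And>z. z \<in> ball 0 1 \<Longrightarrow> g z \<noteq> 0"
    and le1: "\<And>z. z \<in> ball 0 1 \<Longrightarrow> norm (g z) \<le> 1" and p: "p > 1"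
    and bound: "\<And>r. 0 < r \<Longrightarrow> r < 1 \<Longrightarrow>
        (\<integral>\<^sup>+t. ennreal (\<bar>ln (norm (g (of_real r * cis t)))\<bar> powr p) \<partial>circ) \<le> ennreal C"
  shows "outer_function g" and "log_boundary_in_Lp p g"
proof -
  have cont: "continuous_on (ball 0 1) g" using g by (rule holomorphic_on_imp_continuous_on)
  define rs :: "nat \<Rightarrow> real" where "rs n = 1 - 1 / real (n + 2)" for n
  have rs: "0 < rs n" "rs n < 1" for n by (auto simp: rs_def)
  have rs_lim: "rs \<longlonglongrightarrow> 1" unfolding rs_def by real_asymp
  have rs_at: "filterlim rs (at_left 1) sequentially"
    unfolding filterlim_at using rs(2) less_imp_neq[OF rs(2)] rs_lim by (auto intro!: always_eventually)
  have mem: "of_real (rs n) * cis t \<in> ball 0 1" for n t using rs[of n] by (simp add: norm_mult)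
  define f where "f n t = ln (norm (g (of_real (rs n) * cis t)))" for n t
  define gl where "gl t = lim (\<lambda>n. g (of_real (rs n) * cis t))" for t
  define fl where "fl t = ln (norm (gl t))" for t
  have meas_g[measurable]: "(\<lambda>t. g (of_real (rs n) * cis t)) \<in> borel_measurable borel" for n
    by (rule measurable_circle_comp) (use rs[of n] in \<open>auto intro!: continuous_on_subset[OF cont]\<close>)
  have [measurable]: "f n \<in> borel_measurable borel" for n unfolding f_def by measurable
  have [measurable]: "gl \<in> borel_measurable borel" unfolding gl_def by measurable
  then have fl_meas[measurable]: "fl \<in> borel_measurable borel" unfolding fl_def by measurable
  have f_bound: "(\<integral>\<^sup>+t. ennreal (\<bar>f n t\<bar> powr p) \<partial>circ) \<le> ennreal C" for n
    unfolding f_def by (rule bound[OF rs])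
  have "bounded (g ` ball 0 1)" using le1 by (intro boundedI[of _ 1]) auto
  from Fatou_radial_limits[OF g this]
  have ae_lim: "AE t in circ. ((\<lambda>r. g (of_real r * cis t)) \<longlongrightarrow> radial_limit g (cis t)) (at_left 1)"
    by eventually_elim (auto simp: radial_limit_def tendsto_Lim)
  have seq: "(\<lambda>n. g (of_real (rs n) * cis t)) \<longlonglongrightarrow> radial_limit g (cis t)"
    if "((\<lambda>r. g (of_real r * cis t)) \<longlongrightarrow> radial_limit g (cis t)) (at_left 1)" for t
    using filterlim_compose[OF that rs_at] .
  have ae_gl: "AE t in circ. gl t = radial_limit g (cis t)"
    using ae_lim by eventually_elim (auto simp: gl_def dest!: seq limI)
  \<comment> \<open>where the radial limit vanishes, the logarithms tend to minus infinity; the bound excludes this on a set of positive measure\<close>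
  have "(\<integral>\<^sup>+t. liminf (\<lambda>n. ennreal (\<bar>f n t\<bar> powr p)) \<partial>circ) \<le> liminf (\<lambda>n. \<integral>\<^sup>+t. ennreal (\<bar>f n t\<bar> powr p) \<partial>circ)"
    by (rule nn_integral_liminf) measurable
  also have "\<dots> \<le> ennreal C"
    by (rule order_trans[OF Liminf_le_Limsup Limsup_bounded]) (use f_bound in auto)
  also have "\<dots> < \<infinity>" by simp
  finally have "(\<integral>\<^sup>+t. liminf (\<lambda>n. ennreal (\<bar>f n t\<bar> powr p)) \<partial>circ) \<noteq> \<infinity>" by simp
  then have "AE t in circ. liminf (\<lambda>n. ennreal (\<bar>f n t\<bar> powr p)) \<noteq> \<infinity>"
    by (intro nn_integral_PInf_AE) measurable
  with ae_lim have ae_nz: "AE t in circ. radial_limit g (cis t) \<noteq> 0"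
  proof eventually_elim
    case (elim t)
    show ?case
    proof
      assume "radial_limit g (cis t) = 0"
      then have "(\<lambda>n. norm (g (of_real (rs n) * cis t))) \<longlonglongrightarrow> 0"
        using seq[OF elim(1)] by (simp add: tendsto_norm_zero)
      then have "filterlim (\<lambda>n. norm (g (of_real (rs n) * cis t))) (at_right 0) sequentially"
        using nz[OF mem] by (auto simp: filterlim_at intro!: always_eventually)
      then have "filterlim (\<lambda>n. f n t) at_bot sequentially"
        unfolding f_def by (rule filterlim_compose[OF ln_at_0])
      then have "filterlim (\<lambda>n. \<bar>f n t\<bar>) at_top sequentially"
      proof -
        assume "filterlim (\<lambda>n. f n t) at_bot sequentially"
        then have "filterlim (\<lambda>n. - f n t) at_top sequentially"
          unfolding filterlim_uminus_at_top by simp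
        then show ?thesis
          by (rule filterlim_at_top_mono) (intro always_eventually allI abs_ge_minus_self)
      qed
      then have "filterlim (\<lambda>n. \<bar>f n t\<bar> powr p) at_top sequentially"
        by (rule filterlim_compose[OF real_powr_at_top, rotated]) (use p in simp)
      then have "(\<lambda>n. ennreal (\<bar>f n t\<bar> powr p)) \<longlonglongrightarrow> \<infinity>"
        by (simp add: ennreal_tendsto_top_eq_at_top)
      then have "liminf (\<lambda>n. ennreal (\<bar>f n t\<bar> powr p)) = \<infinity>"
        by (rule lim_imp_Liminf[OF trivial_limit_sequentially])
      with elim(2) show False by simp
    qed
  qed
  have ae_f: "AE t in circ. (\<lambda>n. f n t) \<longlonglongrightarrow> fl t"
    using ae_lim ae_gl ae_nz
  proof eventually_elim
    case (elim t)
    then show ?case unfolding f_def fl_def using seq[of t] by (auto intro!: tendsto_intros)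
  qed
  have f_meas: "f n \<in> borel_measurable circ" "fl \<in> borel_measurable circ" for n by measurable
  note L1 = circ.L1_convergence_of_Lp_bounded[OF p f_meas ae_f f_bound]
  have ae_fl: "AE t in circle_measure. fl t = ln (norm (radial_limit g (cis t)))"
    using ae_gl unfolding AE_circ_iff by eventually_elim (simp add: fl_def)
  have m: "(\<lambda>t. ln (norm (radial_limit g (cis t)))) \<in> borel_measurable circle_measure"
    by (rule measurable_circle_measure_AE[OF fl_meas ae_fl])
  have fl_m[measurable]: "fl \<in> borel_measurable circle_measure"
    by (rule measurable_circle_measure_AE[OF fl_meas]) simp
  have in_Lp: "log_boundary_in_Lp q g" if "integrable circ (\<lambda>t. \<bar>fl t\<bar> powr q)" for q
    unfolding log_boundary_in_Lp_def
  proof (intro conjI m)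
    show "AE t in circle_measure. ((\<lambda>r. g (of_real r * cis t)) \<longlongrightarrow> radial_limit g (cis t)) (at_left 1) \<and> radial_limit g (cis t) \<noteq> 0"
      using ae_lim ae_nz unfolding AE_circ_iff by eventually_elim simp
    have "integrable circle_measure (\<lambda>t. \<bar>fl t\<bar> powr q)"
      using that by (subst (asm) integrable_circ_iff) auto
    then show "integrable circle_measure (\<lambda>t. \<bar>ln (norm (radial_limit g (cis t)))\<bar> powr q)"
      by (rule Bochner_Integration.integrable_cong_AE_imp) (use m ae_fl in \<open>auto elim!: eventually_mono\<close>)
  qed
  show "log_boundary_in_Lp p g" by (rule in_Lp[OF L1(3)])
  have Lp1: "log_boundary_in_Lp 1 g" by (rule in_Lp) (use L1(2) in simp)
  obtain G where G: "G holomorphic_on ball 0 1" "\<And>z. z \<in> ball 0 1 \<Longrightarrow> exp (G z) = g z"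
    using holomorphic_logarithm_exists[of "ball 0 1" g 0] g nz by auto
  have Re_G: "Re (G z) = ln (norm (g z))" if "z \<in> ball 0 1" for z
    unfolding G(2)[OF that, symmetric] by simp
  have formula: "(\<integral>t. (cis t + z) / (cis t - z) * of_real (fl t) \<partial>circ) = G z - \<i> * of_real (Im (G 0))"
    if z: "z \<in> ball 0 1" for z
  proof -
    define K where "K t = (cis t + z) / (cis t - z)" for t
    define W where "W = 2 / (1 - norm z)"
    have z1: "norm z < 1" using z by simp
    have K: "norm (K t) \<le> W" for t
      unfolding K_def W_def by (rule norm_schwarz_kernel_le[OF z1])
    note K_int = integrable_schwarz_kernel[OF z1, folded K_def]
    have 1: "(\<integral>t. K t * of_real (f n t) \<partial>circ) = G (of_real (rs n) * z) - \<i> * of_real (Im (G 0))" for n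
      using schwarz_formula[OF strict_dilation[OF G(1) less_imp_le[OF rs(1)] rs(2)], of z n] z Re_G[OF mem]
      by (simp add: K_def f_def)
    have "(\<lambda>n. \<integral>t. K t * of_real (f n t) \<partial>circ) \<longlonglongrightarrow> (\<integral>t. K t * of_real (fl t) \<partial>circ)"
    proof (rule LIM_zero_cancel, rule Lim_null_comparison)
      show "(\<lambda>n. W * (\<integral>t. \<bar>f n t - fl t\<bar> \<partial>circ)) \<longlonglongrightarrow> 0"
        using tendsto_mult_right_zero[OF L1(4)] by simp
      show "\<forall>\<^sub>F n in sequentially. norm ((\<integral>t. K t * of_real (f n t) \<partial>circ) - (\<integral>t. K t * of_real (fl t) \<partial>circ))
          \<le> W * (\<integral>t. \<bar>f n t - fl t\<bar> \<partial>circ)"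
      proof (rule always_eventually, rule allI)
        fix n
        have "(\<integral>t. K t * of_real (f n t) \<partial>circ) - (\<integral>t. K t * of_real (fl t) \<partial>circ) = (\<integral>t. K t * of_real (f n t - fl t) \<partial>circ)"
          using K_int[OF L1(1)] K_int[OF L1(2)] by (simp add: algebra_simps)
        also have "norm \<dots> \<le> (\<integral>t. norm (K t * of_real (f n t - fl t)) \<partial>circ)"
          by (rule integral_norm_bound)
        also have "\<dots> \<le> (\<integral>t. W * \<bar>f n t - fl t\<bar> \<partial>circ)"
        proof (rule integral_mono)
          show "integrable circ (\<lambda>t. norm (K t * of_real (f n t - fl t)))"
            by (intro integrable_norm K_int Bochner_Integration.integrable_diff L1)
          show "integrable circ (\<lambda>t. W * \<bar>f n t - fl t\<bar>)"
            by (intro integrable_mult_right integrable_abs Bochner_Integration.integrable_diff L1)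
          show "norm (K t * of_real (f n t - fl t)) \<le> W * \<bar>f n t - fl t\<bar>" for t
            unfolding norm_mult norm_of_real by (intro mult_right_mono K) simp
        qed
        finally show "norm ((\<integral>t. K t * of_real (f n t) \<partial>circ) - (\<integral>t. K t * of_real (fl t) \<partial>circ))
          \<le> W * (\<integral>t. \<bar>f n t - fl t\<bar> \<partial>circ)" by simp
      qed
    qed
    moreover have "(\<lambda>n. \<integral>t. K t * of_real (f n t) \<partial>circ) \<longlonglongrightarrow> G z - \<i> * of_real (Im (G 0))"
    proof -
      have "isCont G z"
        using holomorphic_on_imp_continuous_on[OF G(1)] z continuous_on_eq_continuous_at[of "ball 0 1" G] by auto
      then have "(\<lambda>n. G (of_real (rs n) * z)) \<longlonglongrightarrow> G z"
      proof (rule isCont_tendsto_compose)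
        have "(\<lambda>n. of_real (rs n) * z) \<longlonglongrightarrow> of_real 1 * z" by (intro tendsto_intros rs_lim)
        then show "(\<lambda>n. of_real (rs n) * z) \<longlonglongrightarrow> z" by simp
      qed
      then show ?thesis unfolding 1 by (intro tendsto_intros)
    qed
    ultimately show ?thesis unfolding K_def by (rule LIMSEQ_unique)
  qed
  show "outer_function g"
    unfolding outer_function_def
  proof (intro conjI g Lp1 exI[of _ "exp (\<i> * of_real (Im (G 0)))"] ballI)
    show "norm (exp (\<i> * of_real (Im (G 0)))) = 1" by simp
    fix z :: complex assume z: "z \<in> ball 0 1"
    have K_meas[measurable]: "(\<lambda>t. (cis t + z) / (cis t - z)) \<in> borel_measurable circle_measure"
    proof (rule measurable_circle_measure_AE)
      show "(\<lambda>t. (cis t + z) / (cis t - z)) \<in> borel_measurable borel" by measurable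
    qed simp
    have "(\<integral>t. (cis t + z) / (cis t - z) * of_real (ln (norm (radial_limit g (cis t)))) \<partial>circle_measure)
        = (\<integral>t. (cis t + z) / (cis t - z) * of_real (fl t) \<partial>circle_measure)"
    proof (rule Bochner_Integration.integral_cong_AE)
      have of_real_meas: "(\<lambda>t. complex_of_real (h t)) \<in> borel_measurable circle_measure"
        if "h \<in> borel_measurable circle_measure" for h
        using that by measurable
      show "(\<lambda>t. (cis t + z) / (cis t - z) * of_real (ln (norm (radial_limit g (cis t))))) \<in> borel_measurable circle_measure"
        "(\<lambda>t. (cis t + z) / (cis t - z) * of_real (fl t)) \<in> borel_measurable circle_measure"
        by (rule borel_measurable_times[OF K_meas of_real_meas], rule m fl_m)+
    qed (use ae_fl in \<open>auto elim!: eventually_mono\<close>)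
    also have "\<dots> = (2 * of_real pi) * (\<integral>t. (cis t + z) / (cis t - z) * of_real (fl t) \<partial>circ)"
      by (subst integral_circ) (auto simp: scaleR_conv_of_real)
    finally have "1 / (2 * of_real pi) * (\<integral>t. (cis t + z) / (cis t - z) * of_real (ln (norm (radial_limit g (cis t)))) \<partial>circle_measure)
       = G z - \<i> * of_real (Im (G 0))"
      using formula[OF z] by simp
    then show "g z = exp (\<i> * of_real (Im (G 0))) * exp (1 / (2 * of_real pi) *
        (\<integral>t. (cis t + z) / (cis t - z) * of_real (ln (norm (radial_limit g (cis t)))) \<partial>circle_measure))"
      using G(2)[OF z] by (simp add: exp_add[symmetric])
  qed
qed

section \<open>Approximation by real parts of entire functions\<close>

text \<open>
  Functions that agree on the unit circle with a real trigonometric polynomial \<open>Re \<Sum> c\<^sub>k z\<^sup>k\<close>; off the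
  circle they are arbitrary, since the product of two such real parts is again of this form only on the
  circle.
\<close>

inductive trig_poly :: "(complex \<Rightarrow> real) \<Rightarrow> bool" where
  zero: "(\<And>z. norm z = 1 \<Longrightarrow> \<phi> z = 0) \<Longrightarrow> trig_poly \<phi>"
| add_term: "trig_poly \<phi> \<Longrightarrow> (\<And>z. norm z = 1 \<Longrightarrow> \<psi> z = \<phi> z + Re (c * z ^ k)) \<Longrightarrow> trig_poly \<psi>"

lemma trig_poly_cong: "trig_poly \<phi> \<Longrightarrow> (\<And>z. norm z = 1 \<Longrightarrow> \<psi> z = \<phi> z) \<Longrightarrow> trig_poly \<psi>"
  using trig_poly.add_term[of \<phi> \<psi> 0 0] by simp

lemma trig_poly_monom: "trig_poly (\<lambda>z. Re (c * z ^ k))"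
  by (rule trig_poly.add_term[OF trig_poly.zero[of "\<lambda>_. 0"]]) auto

lemma trig_poly_add:
  assumes "trig_poly \<phi>" "trig_poly \<psi>"
  shows "trig_poly (\<lambda>z. \<phi> z + \<psi> z)"
  using assms(1)
proof induction
  case (zero \<phi>)
  then show ?case by (intro trig_poly_cong[OF assms(2)]) simp
next
  case (add_term \<phi> \<phi>' c k)
  show ?case by (rule trig_poly.add_term[OF add_term.IH, of _ c k]) (simp add: add_term)
qed

lemma Re_monom_mult_Re_monom:
  assumes "norm z = 1" "j \<le> k"
  shows "Re (c * z ^ k) * Re (d * z ^ j) = Re (c * d / 2 * z ^ (k + j)) + Re (c * cnj d / 2 * z ^ (k - j))"
proof -
  have "z * cnj z = 1" using assms(1) by (simp add: complex_norm_square[symmetric])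
  then have "z ^ j * cnj z ^ j = 1" by (simp flip: power_mult_distrib)
  moreover have "z ^ k = z ^ (k - j) * z ^ j" using assms(2) by (simp flip: power_add)
  ultimately have "(c * z ^ k) * cnj (d * z ^ j) = c * cnj d * z ^ (k - j)"
    by (simp add: algebra_simps)
  moreover have "Re x * Re y = Re (x * y) / 2 + Re (x * cnj y) / 2" for x y
    by (simp add: field_simps)
  ultimately have "Re (c * z ^ k) * Re (d * z ^ j) = Re ((c * z ^ k) * (d * z ^ j)) / 2 + Re (c * cnj d * z ^ (k - j)) / 2"
    by metis
  then show ?thesis by (simp add: power_add mult_ac del: times_complex.sel)
qed

lemma trig_poly_mult_monom:
  assumes "trig_poly \<phi>"
  shows "trig_poly (\<lambda>z. \<phi> z * Re (c * z ^ k))"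
  using assms
proof induction
  case (zero \<phi>)
  then show ?case by (intro trig_poly.zero) simp
next
  case (add_term \<phi> \<psi> d j)
  have "trig_poly (\<lambda>z. Re (d * z ^ j) * Re (c * z ^ k))"
  proof (cases "j \<le> k")
    case True
    show ?thesis
      by (rule trig_poly_cong[OF trig_poly_add[OF trig_poly_monom[of "c * d / 2" "k + j"] trig_poly_monom[of "c * cnj d / 2" "k - j"]]])
         (use Re_monom_mult_Re_monom[OF _ True, of _ c d] in \<open>simp only: mult.commute\<close>)
  next
    case False
    show ?thesis
      by (rule trig_poly_cong[OF trig_poly_add[OF trig_poly_monom[of "d * c / 2" "j + k"] trig_poly_monom[of "d * cnj c / 2" "j - k"]]])
         (use Re_monom_mult_Re_monom[of _ k j d c] False in simp)
  qed
  from trig_poly_add[OF add_term.IH this] show ?case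
    by (rule trig_poly_cong) (simp add: add_term distrib_right del: times_complex.sel)
qed

lemma trig_poly_mult:
  assumes "trig_poly \<phi>" "trig_poly \<psi>"
  shows "trig_poly (\<lambda>z. \<phi> z * \<psi> z)"
  using assms(2)
proof induction
  case (zero \<phi>)
  then show ?case by (intro trig_poly.zero) simp
next
  case (add_term \<psi> \<psi>' c k)
  from trig_poly_add[OF add_term.IH trig_poly_mult_monom[OF assms(1), of c k]] show ?case
    by (rule trig_poly_cong) (simp add: add_term distrib_left del: times_complex.sel)
qed

lemma trig_poly_eq_Re_entire:
  assumes "trig_poly \<phi>"
  shows "\<exists>q. q holomorphic_on UNIV \<and> (\<forall>z. norm z = 1 \<longrightarrow> \<phi> z = Re (q z))"
  using assms
proof induction
  case (zero \<phi>)
  then show ?case by (intro exI[of _ "\<lambda>_. 0"]) auto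
next
  case (add_term \<phi> \<psi> c k)
  then obtain q where "q holomorphic_on UNIV" "\<And>z. norm z = 1 \<Longrightarrow> \<phi> z = Re (q z)" by blast
  then show ?case
    by (intro exI[of _ "\<lambda>z. q z + c * z ^ k"]) (auto intro!: holomorphic_intros simp: add_term simp del: times_complex.sel)
qed

text \<open>
  Stone-Weierstrass on the circle. The approximation is one-sided so that the maximum principle can be
  applied to \<^term>\<open>\<lambda>z. exp (- q z)\<close>.
\<close>

lemma entire_Re_approximation:
  assumes "continuous_on (sphere 0 1) u" "e > 0"
  obtains q where "q holomorphic_on UNIV" "\<And>z. norm z = 1 \<Longrightarrow> u z < Re (q z) \<and> Re (q z) < u z + e"
proof -
  interpret function_ring_on "Collect trig_poly" "sphere (0::complex) 1"
  proof
    show "continuous_on (sphere 0 1) f" if "f \<in> Collect trig_poly" for f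
    proof -
      obtain q where q: "q holomorphic_on UNIV" "\<And>z. norm z = 1 \<Longrightarrow> f z = Re (q z)"
        using trig_poly_eq_Re_entire \<open>f \<in> _\<close> by blast
      have "continuous_on (sphere 0 1) (\<lambda>z. Re (q z))"
        using holomorphic_on_imp_continuous_on[OF q(1)]
        by (intro continuous_intros) (auto intro: continuous_on_subset)
      then show ?thesis by (rule continuous_on_cong[THEN iffD1, rotated -1]) (auto simp: q(2))
    qed
    show "(\<lambda>_. c) \<in> Collect trig_poly" for c
      using trig_poly_monom[of "of_real c" 0] by simp
    show "\<exists>f\<in>Collect trig_poly. f x \<noteq> f y" if "x \<noteq> y" for x y :: complex
    proof (cases "Re x = Re y")
      case True
      then have "Im x \<noteq> Im y" using that by (simp add: complex_eq_iff)
      then show ?thesis using trig_poly_monom[of "- \<i>" 1] by (intro bexI[of _ "\<lambda>z. Re (- \<i> * z ^ 1)"]) auto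
    next
      case False
      then show ?thesis using trig_poly_monom[of 1 1] by (intro bexI[of _ "\<lambda>z. Re (1 * z ^ 1)"]) auto
    qed
  qed (auto intro: trig_poly_add trig_poly_mult)
  have "continuous_on (sphere 0 1) (\<lambda>z. u z + e / 2)" by (intro continuous_intros assms)
  from Stone_Weierstrass_basic[OF this, of "e / 2"] assms(2)
  obtain \<phi> where \<phi>: "trig_poly \<phi>" "\<And>z. norm z = 1 \<Longrightarrow> \<bar>u z + e / 2 - \<phi> z\<bar> < e / 2" by auto
  obtain q where q: "q holomorphic_on UNIV" "\<And>z. norm z = 1 \<Longrightarrow> \<phi> z = Re (q z)"
    using trig_poly_eq_Re_entire[OF \<phi>(1)] by blast
  show ?thesis
  proof (rule that[OF q(1)])
    fix z :: complex assume "norm z = 1"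
    then show "u z < Re (q z) \<and> Re (q z) < u z + e" using \<phi>(2)[of z] q(2)[of z] by linarith
  qed
qed

section \<open>Outer denominators\<close>

lemma norm_le_1_of_sphere:
  assumes "continuous_on (cball 0 1) F" "F holomorphic_on ball 0 1" "\<And>z. norm z = 1 \<Longrightarrow> norm (F z) \<le> 1" "norm z < 1"
  shows "norm (F z) \<le> 1"
  by (rule maximum_modulus_frontier[of F "ball 0 1"]) (use assms in auto)

lemma log_plus_nonneg: "log_plus x \<ge> 0"
  by (simp add: log_plus_def)

lemma log_plus_eq: "x \<ge> 0 \<Longrightarrow> log_plus x = ln (max 1 x)"
  unfolding log_plus_def by (cases "x \<ge> 1"; cases "x = 0") (auto simp: max_def ln_ge_zero_iff)

lemma le_exp_log_plus: "x \<ge> 0 \<Longrightarrow> x \<le> exp (log_plus x)"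
  by (simp add: log_plus_eq)

lemma continuous_log_plus_norm:
  "continuous_on A f \<Longrightarrow> continuous_on A (\<lambda>z. log_plus (norm (f z)))"
  unfolding log_plus_eq[OF norm_ge_zero] by (intro continuous_intros) auto

lemma log_plus_add_le:
  assumes "a \<ge> 0" "b \<ge> 0"
  shows "log_plus (a + b) \<le> (log_plus a + log_plus b) + ln 2"
proof -
  have "max 1 a * 1 \<le> max 1 a * max 1 b" "1 * max 1 b \<le> max 1 a * max 1 b"
    by (intro mult_mono; simp)+
  then have "max 1 (a + b) \<le> (max 1 a * max 1 b) * 2" by simp
  then have "ln (max 1 (a + b)) \<le> ln ((max 1 a * max 1 b) * 2)" by (subst ln_le_cancel_iff) (auto simp: less_max_iff_disj)
  also have "\<dots> = (ln (max 1 a) + ln (max 1 b)) + ln 2"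
    by (auto simp: max_def ln_mult)
  finally show ?thesis using assms by (simp add: log_plus_eq)
qed

lemma log_plus_mult_le:
  assumes "a \<ge> 0" "b \<ge> 0"
  shows "log_plus (a * b) \<le> log_plus a + log_plus b"
proof -
  have "1 * 1 \<le> max 1 a * max 1 b" by (rule mult_mono) auto
  moreover have "a * b \<le> max 1 a * max 1 b" using assms by (intro mult_mono) auto
  ultimately have "max 1 (a * b) \<le> max 1 a * max 1 b" by simp
  then have "ln (max 1 (a * b)) \<le> ln (max 1 a * max 1 b)" by (subst ln_le_cancel_iff) (auto simp: less_max_iff_disj)
  also have "\<dots> = ln (max 1 a) + ln (max 1 b)"
    by (auto simp: max_def ln_mult)
  finally show ?thesis using assms by (simp add: log_plus_eq)
qed

lemma log_plus_mono: "0 \<le> a \<Longrightarrow> a \<le> b \<Longrightarrow> log_plus a \<le> log_plus b"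
  by (simp add: log_plus_eq less_max_iff_disj)

lemma powr_add_le:
  fixes a b p :: real
  assumes "a \<ge> 0" "b \<ge> 0" "p \<ge> 0"
  shows "(a + b) powr p \<le> 2 powr p * (a powr p + b powr p)"
proof -
  have "(a + b) powr p \<le> (2 * max a b) powr p" using assms by (intro powr_mono2) auto
  also have "\<dots> = 2 powr p * (max a b) powr p" using assms by (simp add: powr_mult)
  also have "\<dots> \<le> 2 powr p * (a powr p + b powr p)"
    by (intro mult_left_mono) (auto simp: max_def)
  finally show ?thesis .
qed

text \<open>
  On the circle approximate \<open>log\<^sup>+ |f(r\<^sub>n \<zeta>)|\<close> from above by the real part of an entire function \<open>q\<^sub>n\<close>,
  and set \<open>g\<^sub>n = exp (- q\<^sub>n)\<close>. By the maximum principle \<open>|g\<^sub>n| \<le> 1\<close> and \<open>|f(r\<^sub>n z) g\<^sub>n(z)| \<le> 1\<close> in the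
  disc, and the \<open>L\<^sup>p\<close> contraction bounds the means of \<open>- log |g\<^sub>n| = Re q\<^sub>n\<close> on all circles. A limit \<open>g\<close>
  along a subsequence, given by Montel's theorem, inherits these bounds; it is free of zeros because the
  values \<open>g\<^sub>n(0)\<close> stay away from 0, so \<open>outer_function_criterion\<close> applies.
\<close>

theorem outer_denominator:
  assumes f: "f holomorphic_on ball 0 1" and p: "p > 1"
    and bound: "\<And>r. 0 < r \<Longrightarrow> r < 1 \<Longrightarrow> (\<integral>\<^sup>+t. ennreal (log_plus (norm (f (of_real r * cis t))) powr p) \<partial>circ) \<le> ennreal C"
  obtains g where "g \<in> extensional (ball 0 1)" "g holomorphic_on ball 0 1"
    "\<And>z. z \<in> ball 0 1 \<Longrightarrow> norm (g z) \<le> 1" "\<And>z. z \<in> ball 0 1 \<Longrightarrow> norm (f z * g z) \<le> 1"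
    "outer_function g" "log_boundary_in_Lp p g"
proof -
  define C0 where "C0 = max C 0"
  have C0: "C0 \<ge> 0" "ennreal C \<le> ennreal C0" unfolding C0_def by (auto intro: ennreal_leI)
  define K where "K = 2 powr p * (C0 + 1)"
  have cont: "continuous_on (ball 0 1) f" using f by (rule holomorphic_on_imp_continuous_on)
  define rs :: "nat \<Rightarrow> real" where "rs n = 1 - 1 / real (n + 2)" for n
  have rs: "0 < rs n" "rs n < 1" for n by (auto simp: rs_def)
  have rs_lim: "rs \<longlonglongrightarrow> 1" unfolding rs_def by real_asymp
  define fn where "fn n z = f (of_real (rs n) * z)" for n z
  note fn = strict_dilation[OF f less_imp_le[OF rs(1)] rs(2), folded fn_def]
  define u where "u n z = log_plus (norm (fn n z))" for n z
  have u_cont: "continuous_on (sphere 0 1) (u n)" for n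
    unfolding u_def by (intro continuous_log_plus_norm continuous_on_sphere_of_cball[OF fn(1)]) simp
  have "\<exists>q. q holomorphic_on UNIV \<and> (\<forall>z. norm z = 1 \<longrightarrow> u n z < Re (q z) \<and> Re (q z) < u n z + 1)" for n
    using entire_Re_approximation[OF u_cont[of n], of 1] by (metis zero_less_one)
  then obtain q where q: "\<And>n. q n holomorphic_on UNIV"
      "\<And>n z. norm z = 1 \<Longrightarrow> u n z < Re (q n z)" "\<And>n z. norm z = 1 \<Longrightarrow> Re (q n z) < u n z + 1"
    by metis
  have q_cont: "continuous_on A (q n)" for A n
    using holomorphic_on_imp_continuous_on[OF q(1)] continuous_on_subset by blast
  have q_holo: "q n holomorphic_on A" for A n
    using q(1) holomorphic_on_subset by blast
  define gn where "gn n z = exp (- q n z)" for n z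
  have gn_cont: "continuous_on A (gn n)" for A n unfolding gn_def by (intro continuous_intros q_cont)
  have gn_holo: "gn n holomorphic_on A" for A n unfolding gn_def by (intro holomorphic_intros q_holo)
  have gn_le: "norm (gn n z) \<le> 1" if "norm z < 1" for n z
  proof (rule norm_le_1_of_sphere[OF gn_cont gn_holo _ that])
    fix z :: complex assume "norm z = 1"
    from q(2)[OF this, of n] have "Re (q n z) \<ge> 0"
      using log_plus_nonneg[of "norm (fn n z)"] unfolding u_def by linarith
    then show "norm (gn n z) \<le> 1" by (simp add: gn_def)
  qed
  have fgn_le: "norm (fn n z * gn n z) \<le> 1" if "norm z < 1" for n z
  proof (rule norm_le_1_of_sphere[of "\<lambda>z. fn n z * gn n z", OF _ _ _ that])
    fix z :: complex assume z: "norm z = 1"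
    have "norm (fn n z) \<le> exp (u n z)" unfolding u_def by (rule le_exp_log_plus) simp
    also have "\<dots> \<le> exp (Re (q n z))" using less_imp_le[OF q(2)[OF z]] by simp
    finally show "norm (fn n z * gn n z) \<le> 1"
      by (simp add: gn_def exp_minus norm_mult norm_divide norm_inverse divide_simps)
  qed (intro continuous_intros holomorphic_intros fn gn_cont gn_holo)+
  have Re_q_nonneg: "Re (q n z) \<ge> 0" if "norm z \<le> 1" for n z
  proof (cases "norm z = 1")
    case True
    from q(2)[OF this, of n] show ?thesis
      using log_plus_nonneg[of "norm (fn n z)"] unfolding u_def by linarith
  next
    case False
    with gn_le[of z n] that show ?thesis by (simp add: gn_def)
  qed
  have int_q: "integrable circ (\<lambda>t. Re (q n (cis t)))" for n
    by (intro integrable_Re circ_cis_comp1 q_cont)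
  have u_meas[measurable]: "(\<lambda>t. u n (cis t)) \<in> borel_measurable borel" for n
    by (rule circ_cis_comp1(1)[OF u_cont])
  have sphere_bound: "(\<integral>\<^sup>+t. ennreal (Re (q n (cis t)) powr p) \<partial>circ) \<le> ennreal K" for n
  proof -
    have "(\<integral>\<^sup>+t. ennreal (Re (q n (cis t)) powr p) \<partial>circ) \<le> (\<integral>\<^sup>+t. ennreal (2 powr p * (u n (cis t) powr p + 1)) \<partial>circ)"
    proof (intro nn_integral_mono ennreal_leI)
      fix t
      have "Re (q n (cis t)) powr p \<le> (u n (cis t) + 1) powr p"
        using q(3)[of "cis t" n] Re_q_nonneg[of "cis t" n] p by (intro powr_mono2) auto
      also have "\<dots> \<le> 2 powr p * (u n (cis t) powr p + 1 powr p)"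
        using p by (intro powr_add_le) (auto simp: u_def log_plus_nonneg)
      finally show "Re (q n (cis t)) powr p \<le> 2 powr p * (u n (cis t) powr p + 1)" by simp
    qed
    also have "\<dots> = ennreal (2 powr p) * ((\<integral>\<^sup>+t. ennreal (u n (cis t) powr p) \<partial>circ) + 1)"
      by (simp add: ennreal_mult ennreal_plus nn_integral_cmult nn_integral_add circ.emeasure_space_1[simplified] del: ennreal_plus[symmetric])
    also have "\<dots> \<le> ennreal (2 powr p) * (ennreal C0 + 1)"
      unfolding u_def fn_def by (intro mult_left_mono add_right_mono order_trans[OF bound C0(2)] rs) simp
    also have "\<dots> = ennreal K"
      unfolding K_def using C0(1) by (simp add: ennreal_mult ennreal_plus)
    finally show ?thesis .
  qed
  have gn_bound: "(\<integral>\<^sup>+t. ennreal (\<bar>ln (norm (gn n (of_real r * cis t)))\<bar> powr p) \<partial>circ) \<le> ennreal K"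
    if r: "0 < r" "r < 1" for n r
  proof -
    have z: "norm (of_real r * cis t) < 1" for t using r by (simp add: norm_mult)
    have "\<bar>ln (norm (gn n (of_real r * cis t)))\<bar> = (\<integral>s. poisson (of_real r * cis t) s * Re (q n (cis s)) \<partial>circ)" for t
    proof -
      have "integrable circ (\<lambda>s. poisson (of_real r * cis t) s *\<^sub>R q n (cis s))"
        by (intro integrable_poisson_mult z circ_cis_comp1 q_cont)
      from integral_Re[OF this] poisson_formula[OF q_cont[of _ n] q_holo[of n] z[of t]]
      have "(\<integral>s. poisson (of_real r * cis t) s * Re (q n (cis s)) \<partial>circ) = Re (q n (of_real r * cis t))"
        by simp
      then show ?thesis using Re_q_nonneg[OF less_imp_le[OF z[of t]], of n] by (simp add: gn_def)
    qed
    then have "(\<integral>\<^sup>+t. ennreal (\<bar>ln (norm (gn n (of_real r * cis t)))\<bar> powr p) \<partial>circ) =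
        (\<integral>\<^sup>+t. ennreal ((\<integral>s. poisson (of_real r * cis t) s * Re (q n (cis s)) \<partial>circ) powr p) \<partial>circ)" by simp
    also have "\<dots> \<le> (\<integral>\<^sup>+t. ennreal (Re (q n (cis t)) powr p) \<partial>circ)"
      by (rule poisson_Lp_contraction) (use r p int_q Re_q_nonneg in auto)
    also have "\<dots> \<le> ennreal K" by (rule sphere_bound)
    finally show ?thesis .
  qed
  \<comment> \<open>by the mean value property, as \<open>x \<le> 1 + x\<^sup>p\<close>; this keeps the limit from vanishing identically\<close>
  have gn_0: "exp (- (1 + K)) \<le> norm (gn n 0)" for n
  proof -
    have "(\<integral>t. Re (q n (cis t)) \<partial>circ) = Re (q n 0)"
      using integral_Re[OF circ_cis_comp1(2)[OF q_cont]] mean_value_circ[OF q_cont q_holo] by simp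
    then have "ennreal (Re (q n 0)) = (\<integral>\<^sup>+t. ennreal (Re (q n (cis t))) \<partial>circ)"
      using Re_q_nonneg int_q by (subst nn_integral_eq_integral) auto
    also have "\<dots> \<le> (\<integral>\<^sup>+t. 1 + ennreal (Re (q n (cis t)) powr p) \<partial>circ)"
    proof (rule nn_integral_mono)
      fix t
      have "Re (q n (cis t)) \<le> 1 + Re (q n (cis t)) powr p"
      proof (cases "Re (q n (cis t)) \<le> 1")
        case False
        then have "Re (q n (cis t)) powr 1 \<le> Re (q n (cis t)) powr p" using p by (intro powr_mono) auto
        then show ?thesis using False by simp
      qed (use powr_ge_zero[of "Re (q n (cis t))" p] in linarith)
      then have "ennreal (Re (q n (cis t))) \<le> ennreal (1 + Re (q n (cis t)) powr p)" by (rule ennreal_leI)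
      then show "ennreal (Re (q n (cis t))) \<le> 1 + ennreal (Re (q n (cis t)) powr p)" by (simp add: ennreal_plus)
    qed
    also have "\<dots> = 1 + (\<integral>\<^sup>+t. ennreal (Re (q n (cis t)) powr p) \<partial>circ)"
      using borel_measurable_integrable[OF int_q[of n]] by (subst nn_integral_add) (auto simp: circ.emeasure_space_1[simplified])
    also have "\<dots> \<le> 1 + ennreal K" by (intro add_left_mono sphere_bound)
    also have "\<dots> = ennreal (1 + K)" using C0(1) by (simp add: K_def ennreal_plus)
    finally have "Re (q n 0) \<le> 1 + K" using C0(1) by (subst (asm) ennreal_le_iff) (auto simp: K_def)
    then show ?thesis by (simp add: gn_def)
  qed
  obtain g k where g: "g holomorphic_on ball 0 1" and k: "strict_mono (k :: nat \<Rightarrow> nat)"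
    and lim: "\<And>z. z \<in> ball 0 1 \<Longrightarrow> (\<lambda>n. gn (k n) z) \<longlonglongrightarrow> g z"
    and unif: "\<And>L. compact L \<Longrightarrow> L \<subseteq> ball 0 1 \<Longrightarrow> uniform_limit L (gn \<circ> k) g sequentially"
  proof (rule Montel[of "ball 0 1" "range gn" gn])
    show "h holomorphic_on ball 0 1" if "h \<in> range gn" for h using that gn_holo by auto
    show "\<exists>B. \<forall>h\<in>range gn. \<forall>z\<in>L. norm (h z) \<le> B" if "compact L" "L \<subseteq> ball 0 1" for L
    proof (intro exI[of _ 1] ballI)
      fix h z assume "h \<in> range gn" "z \<in> L"
      then show "norm (h z) \<le> 1" using gn_le that(2) by (auto simp: subset_eq)
    qed
  qed auto
  have g_le: "norm (g z) \<le> 1" if "z \<in> ball 0 1" for z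
    by (rule LIMSEQ_le_const2[OF tendsto_norm[OF lim[OF that]]]) (use gn_le that in auto)
  have fg_le: "norm (f z * g z) \<le> 1" if z: "z \<in> ball 0 1" for z
  proof -
    have "isCont f z" using cont z continuous_on_eq_continuous_at[of "ball 0 1" f] by auto
    moreover have "(\<lambda>n. of_real (rs (k n)) * z) \<longlonglongrightarrow> of_real 1 * z"
      using LIMSEQ_subseq_LIMSEQ[OF rs_lim k] by (intro tendsto_intros) (simp add: o_def)
    ultimately have "(\<lambda>n. fn (k n) z) \<longlonglongrightarrow> f z"
      unfolding fn_def by (intro isCont_tendsto_compose[of z f]) auto
    then have "(\<lambda>n. fn (k n) z * gn (k n) z) \<longlonglongrightarrow> f z * g z" by (intro tendsto_mult lim z)
    from LIMSEQ_le_const2[OF tendsto_norm[OF this]] show ?thesis using fgn_le z by auto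
  qed
  have g_nz: "g z \<noteq> 0" if z: "z \<in> ball 0 1" for z
  \<comment> \<open>Hurwitz's theorem does not cover constant limits\<close>
  proof (cases "g constant_on ball 0 1")
    case True
    have "exp (- (1 + K)) \<le> norm (g 0)"
      by (rule LIMSEQ_le_const[OF tendsto_norm[OF lim]]) (use gn_0 in auto)
    then have "g 0 \<noteq> 0" using exp_gt_zero[of "- (1 + K)"] by auto
    then show ?thesis using True z unfolding constant_on_def by (metis centre_in_ball zero_less_one)
  next
    case False
    show ?thesis
    proof (rule Hurwitz_no_zeros[of "ball 0 1" "gn \<circ> k" g, OF _ _ _ g unif False _ z])
      show "(gn \<circ> k) n holomorphic_on ball 0 1" for n by (simp add: gn_holo)
      show "(gn \<circ> k) n z \<noteq> 0" for n z by (simp add: gn_def)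
    qed auto
  qed
  define h where "h = restrict g (ball 0 1)"
  have h_eq: "h z = g z" if "z \<in> ball 0 1" for z using that by (simp add: h_def)
  have h: "h holomorphic_on ball 0 1" by (rule holomorphic_transform[OF g]) (simp add: h_def)
  have h_bound: "(\<integral>\<^sup>+t. ennreal (\<bar>ln (norm (h (of_real r * cis t)))\<bar> powr p) \<partial>circ) \<le> ennreal K"
    if r: "0 < r" "r < 1" for r
  proof -
    have z: "of_real r * cis t \<in> ball 0 1" for t using r by (simp add: norm_mult)
    have [measurable]: "(\<lambda>t. gn n (of_real r * cis t)) \<in> borel_measurable borel" for n
      by (rule measurable_circle_comp[OF gn_cont]) (use r in simp)
    have "(\<integral>\<^sup>+t. ennreal (\<bar>ln (norm (h (of_real r * cis t)))\<bar> powr p) \<partial>circ) =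
          (\<integral>\<^sup>+t. liminf (\<lambda>n. ennreal (\<bar>ln (norm (gn (k n) (of_real r * cis t)))\<bar> powr p)) \<partial>circ)"
    proof (rule nn_integral_cong)
      fix t
      have "(\<lambda>n. \<bar>ln (norm (gn (k n) (of_real r * cis t)))\<bar> powr p) \<longlonglongrightarrow> \<bar>ln (norm (g (of_real r * cis t)))\<bar> powr p"
        using p g_nz[OF z] by (intro tendsto_powr' tendsto_rabs tendsto_ln tendsto_norm lim z tendsto_const) auto
      then have "(\<lambda>n. ennreal (\<bar>ln (norm (gn (k n) (of_real r * cis t)))\<bar> powr p)) \<longlonglongrightarrow> ennreal (\<bar>ln (norm (h (of_real r * cis t)))\<bar> powr p)"
        unfolding h_eq[OF z] by (rule tendsto_ennrealI)
      then show "ennreal (\<bar>ln (norm (h (of_real r * cis t)))\<bar> powr p) = liminf (\<lambda>n. ennreal (\<bar>ln (norm (gn (k n) (of_real r * cis t)))\<bar> powr p))"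
        by (rule lim_imp_Liminf[OF trivial_limit_sequentially, symmetric])
    qed
    also have "\<dots> \<le> liminf (\<lambda>n. \<integral>\<^sup>+t. ennreal (\<bar>ln (norm (gn (k n) (of_real r * cis t)))\<bar> powr p) \<partial>circ)"
      by (rule nn_integral_liminf) measurable
    also have "\<dots> \<le> ennreal K"
      by (rule order_trans[OF Liminf_le_Limsup Limsup_bounded]) (use gn_bound[OF r] in auto)
    finally show ?thesis .
  qed
  have "outer_function h" "log_boundary_in_Lp p h"
    using outer_function_criterion[OF h _ _ p h_bound] g_nz g_le h_eq by auto
  then show ?thesis
    by (intro that[of h] h) (use g_le fg_le h_eq in \<open>auto simp: h_def\<close>)
qed

section \<open>Prime ideals in rings of fractions\<close>

text \<open>
  The hypotheses make \<open>N\<close> a ring of fractions of \<open>H\<close> with denominators in \<open>S\<close>. Any prime \<open>Q\<close> over \<open>P\<close>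
  contains no denominator and must therefore consist of the \<open>f\<close> with \<open>f h \<in> P\<close> for some \<open>h \<in> H - P\<close>.
  Conversely, if \<open>P\<close> misses \<open>S\<close>, this set is a prime ideal over \<open>P\<close>: the set \<open>H - P\<close> of multipliers
  contains \<open>S\<close> and is multiplicatively closed because \<open>P\<close> is prime, which gives the closure properties.
\<close>

theorem prime_contraction_localization:
  fixes H N :: "('a, 'b) ring_scheme"
  assumes "cring H" and "cring N" and sub: "carrier H \<subseteq> carrier N"
    and ops: "(\<otimes>\<^bsub>H\<^esub>) = (\<otimes>\<^bsub>N\<^esub>)" "(\<oplus>\<^bsub>H\<^esub>) = (\<oplus>\<^bsub>N\<^esub>)" "\<one>\<^bsub>H\<^esub> = \<one>\<^bsub>N\<^esub>" "\<zero>\<^bsub>H\<^esub> = \<zero>\<^bsub>N\<^esub>"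
    and S: "S \<subseteq> carrier H" "\<And>F. F \<in> S \<Longrightarrow> \<exists>G\<in>carrier N. F \<otimes>\<^bsub>N\<^esub> G = \<one>\<^bsub>N\<^esub>"
    and denom: "\<And>f. f \<in> carrier N \<Longrightarrow> \<exists>F\<in>S. f \<otimes>\<^bsub>N\<^esub> F \<in> carrier H"
    and P: "primeideal P H"
  shows "((\<exists>Q. primeideal Q N \<and> P = Q \<inter> carrier H) \<longleftrightarrow> P \<inter> S = {}) \<and>
         (\<forall>Q. primeideal Q N \<and> P = Q \<inter> carrier H \<longrightarrow>
            (\<forall>Q'. primeideal Q' N \<and> P = Q' \<inter> carrier H \<longrightarrow> Q' = Q) \<and> Q = genideal N P)"
proof -
  interpret H: cring H by fact
  interpret N: cring N by fact
  interpret P: primeideal P H by fact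
  note P_sub = P.a_subset
  have P_add: "a \<oplus>\<^bsub>N\<^esub> b \<in> P" if "a \<in> P" "b \<in> P" for a b
    using P.a_closed[OF that] by (simp add: ops)
  have P_mult: "a \<otimes>\<^bsub>N\<^esub> x \<in> P" if "a \<in> P" "x \<in> carrier H" for a x
    using P.I_r_closed[OF that] by (simp add: ops)
  have P_prime: "a \<in> P \<or> b \<in> P" if "a \<in> carrier H" "b \<in> carrier H" "a \<otimes>\<^bsub>N\<^esub> b \<in> P" for a b
    using P.I_prime[of a b] that by (simp add: ops)
  have H_mult: "a \<otimes>\<^bsub>N\<^esub> b \<in> carrier H" if "a \<in> carrier H" "b \<in> carrier H" for a b
    using H.m_closed[OF that] by (simp add: ops)
  have one_H: "\<one>\<^bsub>N\<^esub> \<in> carrier H" using H.one_closed by (simp add: ops)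
  have one_P: "\<one>\<^bsub>N\<^esub> \<notin> P" using P.one_imp_carrier P.I_notcarr by (auto simp: ops)
  have zero_P: "\<zero>\<^bsub>N\<^esub> \<in> P" using P.zero_closed by (simp add: ops)
  note HN = subsetD[OF sub]
  note PH = subsetD[OF P_sub]
  define Q0 where "Q0 = {f \<in> carrier N. \<exists>h\<in>carrier H. h \<notin> P \<and> f \<otimes>\<^bsub>N\<^esub> h \<in> P}"
  have disjoint: "P \<inter> S = {}" if Q: "primeideal Q N" "P = Q \<inter> carrier H" for Q
  proof (rule ccontr)
    interpret Q: primeideal Q N by fact
    assume "P \<inter> S \<noteq> {}"
    then obtain F G where F: "F \<in> P" "G \<in> carrier N" "F \<otimes>\<^bsub>N\<^esub> G = \<one>\<^bsub>N\<^esub>" using S(2) by blast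
    then have "\<one>\<^bsub>N\<^esub> \<in> Q" using Q.I_r_closed[of F G] Q(2) by auto
    then show False using Q.one_imp_carrier Q.I_notcarr by auto
  qed
  have saturated: "Q = Q0" if Q: "primeideal Q N" "P = Q \<inter> carrier H" for Q
  proof -
    interpret Q: primeideal Q N by fact
    show ?thesis
    proof (intro equalityI subsetI)
      fix f assume f: "f \<in> Q"
      then have fN: "f \<in> carrier N" using Q.a_subset by blast
      obtain F where F: "F \<in> S" "f \<otimes>\<^bsub>N\<^esub> F \<in> carrier H" using denom[OF fN] by blast
      then have "F \<in> carrier H" using S(1) by blast
      then have "f \<otimes>\<^bsub>N\<^esub> F \<in> P" using Q.I_r_closed[OF f HN] F(2) Q(2) by blast
      moreover have "F \<notin> P" using disjoint[OF Q] F(1) by blast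
      ultimately show "f \<in> Q0" using fN \<open>F \<in> carrier H\<close> unfolding Q0_def by blast
    next
      fix f assume "f \<in> Q0"
      then obtain h where h: "f \<in> carrier N" "h \<in> carrier H" "h \<notin> P" "f \<otimes>\<^bsub>N\<^esub> h \<in> P"
        unfolding Q0_def by blast
      then have "f \<in> Q \<or> h \<in> Q" using Q.I_prime[of f h] HN Q(2) by blast
      then show "f \<in> Q" using h Q(2) by blast
    qed
  qed
  have main: "primeideal Q0 N \<and> P = Q0 \<inter> carrier H \<and> Q0 = genideal N P" if disj: "P \<inter> S = {}"
  proof -
    have mult_closed: "f \<otimes>\<^bsub>N\<^esub> a \<in> Q0" if f: "f \<in> Q0" and a: "a \<in> carrier N" for f a
    proof -
      obtain h where h: "f \<in> carrier N" "h \<in> carrier H" "h \<notin> P" "f \<otimes>\<^bsub>N\<^esub> h \<in> P"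
        using f unfolding Q0_def by blast
      obtain F where F: "F \<in> S" "a \<otimes>\<^bsub>N\<^esub> F \<in> carrier H" using denom[OF a] by blast
      have FH: "F \<in> carrier H" "F \<notin> P" using F S(1) disj by auto
      have "(f \<otimes>\<^bsub>N\<^esub> a) \<otimes>\<^bsub>N\<^esub> (h \<otimes>\<^bsub>N\<^esub> F) = (f \<otimes>\<^bsub>N\<^esub> h) \<otimes>\<^bsub>N\<^esub> (a \<otimes>\<^bsub>N\<^esub> F)"
        using h a FH HN by (simp add: N.m_ac)
      then have "(f \<otimes>\<^bsub>N\<^esub> a) \<otimes>\<^bsub>N\<^esub> (h \<otimes>\<^bsub>N\<^esub> F) \<in> P" using P_mult[OF h(4) F(2)] by simp
      moreover have "h \<otimes>\<^bsub>N\<^esub> F \<notin> P" using P_prime[OF h(2) FH(1)] h(3) FH(2) by blast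
      ultimately show ?thesis using h(1) a H_mult[OF h(2) FH(1)] unfolding Q0_def by blast
    qed
    have add_closed: "f \<oplus>\<^bsub>N\<^esub> g \<in> Q0" if f: "f \<in> Q0" and g: "g \<in> Q0" for f g
    proof -
      obtain h where h: "f \<in> carrier N" "h \<in> carrier H" "h \<notin> P" "f \<otimes>\<^bsub>N\<^esub> h \<in> P"
        using f unfolding Q0_def by blast
      obtain k where k: "g \<in> carrier N" "k \<in> carrier H" "k \<notin> P" "g \<otimes>\<^bsub>N\<^esub> k \<in> P"
        using g unfolding Q0_def by blast
      have "(f \<oplus>\<^bsub>N\<^esub> g) \<otimes>\<^bsub>N\<^esub> (h \<otimes>\<^bsub>N\<^esub> k) = (f \<otimes>\<^bsub>N\<^esub> h) \<otimes>\<^bsub>N\<^esub> k \<oplus>\<^bsub>N\<^esub> (g \<otimes>\<^bsub>N\<^esub> k) \<otimes>\<^bsub>N\<^esub> h"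
      proof -
        have hk: "h \<in> carrier N" "k \<in> carrier N" using h k HN by auto
        have "(f \<oplus>\<^bsub>N\<^esub> g) \<otimes>\<^bsub>N\<^esub> (h \<otimes>\<^bsub>N\<^esub> k) = f \<otimes>\<^bsub>N\<^esub> (h \<otimes>\<^bsub>N\<^esub> k) \<oplus>\<^bsub>N\<^esub> g \<otimes>\<^bsub>N\<^esub> (h \<otimes>\<^bsub>N\<^esub> k)"
          using h(1) k(1) hk by (intro N.l_distr) auto
        also have "f \<otimes>\<^bsub>N\<^esub> (h \<otimes>\<^bsub>N\<^esub> k) = (f \<otimes>\<^bsub>N\<^esub> h) \<otimes>\<^bsub>N\<^esub> k"
          using h(1) hk by (simp add: N.m_assoc)
        also have "g \<otimes>\<^bsub>N\<^esub> (h \<otimes>\<^bsub>N\<^esub> k) = (g \<otimes>\<^bsub>N\<^esub> k) \<otimes>\<^bsub>N\<^esub> h"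
          using k(1) hk by (simp add: N.m_ac)
        finally show ?thesis .
      qed
      then have "(f \<oplus>\<^bsub>N\<^esub> g) \<otimes>\<^bsub>N\<^esub> (h \<otimes>\<^bsub>N\<^esub> k) \<in> P"
        using P_add[OF P_mult[OF h(4) k(2)] P_mult[OF k(4) h(2)]] by simp
      moreover have "h \<otimes>\<^bsub>N\<^esub> k \<notin> P" using P_prime[OF h(2) k(2)] h(3) k(3) by blast
      ultimately show ?thesis using h(1) k(1) H_mult[OF h(2) k(2)] unfolding Q0_def by blast
    qed
    have P_Q0: "P \<subseteq> Q0"
    proof
      fix f assume f: "f \<in> P"
      then have "f \<in> carrier N" "f \<otimes>\<^bsub>N\<^esub> \<one>\<^bsub>N\<^esub> \<in> P" using PH HN by auto
      then show "f \<in> Q0" using one_H one_P unfolding Q0_def by blast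
    qed
    have Q0_sub: "Q0 \<subseteq> carrier N" unfolding Q0_def by blast
    have "ideal Q0 N"
    proof (rule idealI)
      show "ring N" by (rule N.ring_axioms)
      show "subgroup Q0 (add_monoid N)"
      proof (rule N.add.subgroupI)
        show "Q0 \<noteq> {}" using zero_P P_Q0 by blast
        fix f assume f: "f \<in> Q0"
        then have "f \<in> carrier N" using Q0_sub by blast
        then have "\<ominus>\<^bsub>N\<^esub> f = f \<otimes>\<^bsub>N\<^esub> (\<ominus>\<^bsub>N\<^esub> \<one>\<^bsub>N\<^esub>)" by (simp add: N.r_minus)
        then show "\<ominus>\<^bsub>N\<^esub> f \<in> Q0" using mult_closed[OF f] by simp
      qed (use Q0_sub add_closed in auto)
      show "f \<otimes>\<^bsub>N\<^esub> a \<in> Q0" "a \<otimes>\<^bsub>N\<^esub> f \<in> Q0" if "f \<in> Q0" "a \<in> carrier N" for f a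
        using mult_closed[OF that] N.m_comm[of f a] Q0_sub that by auto
    qed
    then interpret Q0: ideal Q0 N .
    have trace: "P = Q0 \<inter> carrier H"
      using P_Q0 P_sub P_prime unfolding Q0_def by blast
    have gen: "Q0 = genideal N P"
    proof
      show "genideal N P \<subseteq> Q0"
        unfolding genideal_def using Q0.ideal_axioms P_Q0 by blast
      show "Q0 \<subseteq> genideal N P"
        unfolding genideal_def
      proof (intro subsetI InterI, clarify)
        fix f I assume f: "f \<in> Q0" and I: "ideal I N" "P \<subseteq> I"
        interpret I: ideal I N by fact
        obtain h where h: "f \<in> carrier N" "h \<in> carrier H" "h \<notin> P" "f \<otimes>\<^bsub>N\<^esub> h \<in> P"
          using f unfolding Q0_def by blast
        obtain F where F: "F \<in> S" "f \<otimes>\<^bsub>N\<^esub> F \<in> carrier H" using denom[OF h(1)] by blast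
        obtain G where G: "G \<in> carrier N" "F \<otimes>\<^bsub>N\<^esub> G = \<one>\<^bsub>N\<^esub>" using S(2)[OF F(1)] by blast
        have FH: "F \<in> carrier H" using F S(1) by auto
        have "(f \<otimes>\<^bsub>N\<^esub> F) \<otimes>\<^bsub>N\<^esub> h = (f \<otimes>\<^bsub>N\<^esub> h) \<otimes>\<^bsub>N\<^esub> F"
          using h FH HN by (simp add: N.m_ac)
        then have "(f \<otimes>\<^bsub>N\<^esub> F) \<otimes>\<^bsub>N\<^esub> h \<in> P" using P_mult[OF h(4) FH] by simp
        then have "f \<otimes>\<^bsub>N\<^esub> F \<in> I" using P_prime[OF F(2) h(2)] h(3) I(2) by blast
        then have "(f \<otimes>\<^bsub>N\<^esub> F) \<otimes>\<^bsub>N\<^esub> G \<in> I" using G(1) by (rule I.I_r_closed)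
        moreover have "(f \<otimes>\<^bsub>N\<^esub> F) \<otimes>\<^bsub>N\<^esub> G = f"
          using h(1) FH HN G by (simp add: N.m_assoc)
        ultimately show "f \<in> I" by simp
      qed
    qed
    have "primeideal Q0 N"
    proof (rule primeidealI)
      show "ideal Q0 N" "cring N" by (fact Q0.ideal_axioms, fact N.cring_axioms)
      show "carrier N \<noteq> Q0"
        using trace one_H one_P N.one_closed by auto
      fix f g assume f: "f \<in> carrier N" and g: "g \<in> carrier N" and fg: "f \<otimes>\<^bsub>N\<^esub> g \<in> Q0"
      obtain F where F: "F \<in> S" "f \<otimes>\<^bsub>N\<^esub> F \<in> carrier H" using denom[OF f] by blast
      obtain G where G: "G \<in> S" "g \<otimes>\<^bsub>N\<^esub> G \<in> carrier H" using denom[OF g] by blast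
      have FG: "F \<in> carrier H" "G \<in> carrier H" "F \<notin> P" "G \<notin> P" using F G S(1) disj by auto
      have "(f \<otimes>\<^bsub>N\<^esub> F) \<otimes>\<^bsub>N\<^esub> (g \<otimes>\<^bsub>N\<^esub> G) = (f \<otimes>\<^bsub>N\<^esub> g) \<otimes>\<^bsub>N\<^esub> (F \<otimes>\<^bsub>N\<^esub> G)"
        using f g FG HN by (simp add: N.m_ac)
      also have "\<dots> \<in> Q0" using mult_closed[OF fg] FG HN by simp
      finally have "(f \<otimes>\<^bsub>N\<^esub> F) \<otimes>\<^bsub>N\<^esub> (g \<otimes>\<^bsub>N\<^esub> G) \<in> P" using trace H_mult[OF F(2) G(2)] by blast
      from P_prime[OF F(2) G(2) this] show "f \<in> Q0 \<or> g \<in> Q0"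
        unfolding Q0_def using f g FG by blast
    qed
    with trace gen show ?thesis by blast
  qed
  show ?thesis using disjoint saturated main by metis
qed

section \<open>The ring Np and its units\<close>

lemma disc_ring_simps:
  "carrier (disc_ring A) = {f \<in> extensional unit_disc. f \<in> A}"
  "f \<otimes>\<^bsub>disc_ring A\<^esub> g = (\<lambda>z\<in>unit_disc. f z * g z)"
  "f \<oplus>\<^bsub>disc_ring A\<^esub> g = (\<lambda>z\<in>unit_disc. f z + g z)"
  "\<one>\<^bsub>disc_ring A\<^esub> = (\<lambda>z\<in>unit_disc. 1)"
  "\<zero>\<^bsub>disc_ring A\<^esub> = (\<lambda>z\<in>unit_disc. 0)"
  by (simp_all add: disc_ring_def)

lemma cring_disc_ring:
  assumes c: "\<And>c. (\<lambda>z\<in>unit_disc. c) \<in> A"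
    and add: "\<And>f g. f \<in> A \<Longrightarrow> g \<in> A \<Longrightarrow> (\<lambda>z\<in>unit_disc. f z + g z) \<in> A"
    and mult: "\<And>f g. f \<in> A \<Longrightarrow> g \<in> A \<Longrightarrow> (\<lambda>z\<in>unit_disc. f z * g z) \<in> A"
  shows "cring (disc_ring A)"
proof (rule cringI)
  have ext: "f = g" if "f \<in> extensional unit_disc" "g \<in> extensional unit_disc" "\<And>z. norm z < 1 \<Longrightarrow> f z = g z" for f g :: "complex \<Rightarrow> complex"
    by (rule extensionalityI[OF that(1,2)]) (use that(3) in auto)
  show "abelian_group (disc_ring A)"
  proof (rule abelian_groupI; unfold disc_ring_simps)
    fix f assume f: "f \<in> {f \<in> extensional unit_disc. f \<in> A}"
    have "(\<lambda>z\<in>unit_disc. (\<lambda>z\<in>unit_disc. -1) z * f z) \<in> A" using f by (intro mult c) auto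
    then show "\<exists>g\<in>{f \<in> extensional unit_disc. f \<in> A}. (\<lambda>z\<in>unit_disc. g z + f z) = (\<lambda>z\<in>unit_disc. 0)"
      by (intro bexI[of _ "\<lambda>z\<in>unit_disc. (\<lambda>z\<in>unit_disc. -1) z * f z"]) (auto intro!: ext)
  qed (auto intro!: add c ext simp: algebra_simps)
  show "comm_monoid (disc_ring A)"
    by (rule comm_monoidI; unfold disc_ring_simps) (auto intro!: mult c ext simp: algebra_simps)
qed (auto simp: disc_ring_simps intro!: extensionalityI[where A = unit_disc] simp: algebra_simps)

text \<open>
  A bound by a real constant instead of a finite supremum, so that estimates can be chained circle by circle.
\<close>

definition Lp_circle_bounded :: "real \<Rightarrow> (complex \<Rightarrow> real) \<Rightarrow> bool" where
  "Lp_circle_bounded p h \<longleftrightarrow>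
     (\<exists>C. \<forall>r. 0 < r \<and> r < 1 \<longrightarrow> (\<integral>\<^sup>+t. ennreal (h (of_real r * cis t) powr p) \<partial>circ) \<le> ennreal C)"

lemma Lp_circle_bounded_const: "Lp_circle_bounded p (\<lambda>_. c)"
  unfolding Lp_circle_bounded_def by (auto simp: circ.emeasure_space_1[simplified])

lemma Lp_circle_bounded_mono:
  assumes "Lp_circle_bounded p h" "p > 0" "\<And>z. norm z < 1 \<Longrightarrow> 0 \<le> k z \<and> k z \<le> h z"
  shows "Lp_circle_bounded p k"
proof -
  obtain C where C: "\<And>r. 0 < r \<Longrightarrow> r < 1 \<Longrightarrow> (\<integral>\<^sup>+t. ennreal (h (of_real r * cis t) powr p) \<partial>circ) \<le> ennreal C"
    using assms(1) unfolding Lp_circle_bounded_def by blast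
  have "(\<integral>\<^sup>+t. ennreal (k (of_real r * cis t) powr p) \<partial>circ) \<le> ennreal C" if r: "0 < r" "r < 1" for r
  proof (rule order_trans[OF nn_integral_mono C[OF r]], rule ennreal_leI)
    show "k (of_real r * cis t) powr p \<le> h (of_real r * cis t) powr p" for t
      using assms(2) assms(3)[of "of_real r * cis t"] r by (intro powr_mono2) (auto simp: norm_mult)
  qed
  then show ?thesis unfolding Lp_circle_bounded_def by blast
qed

lemma Lp_circle_bounded_add:
  assumes "Lp_circle_bounded p h" "Lp_circle_bounded p k" "p > 0"
    "continuous_on (ball 0 1) h" "continuous_on (ball 0 1) k"
    "\<And>z. norm z < 1 \<Longrightarrow> 0 \<le> h z \<and> 0 \<le> k z"
  shows "Lp_circle_bounded p (\<lambda>z. h z + k z)"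
proof -
  obtain C where C: "\<And>r. 0 < r \<Longrightarrow> r < 1 \<Longrightarrow> (\<integral>\<^sup>+t. ennreal (h (of_real r * cis t) powr p) \<partial>circ) \<le> ennreal C"
    using assms(1) unfolding Lp_circle_bounded_def by blast
  obtain D where D: "\<And>r. 0 < r \<Longrightarrow> r < 1 \<Longrightarrow> (\<integral>\<^sup>+t. ennreal (k (of_real r * cis t) powr p) \<partial>circ) \<le> ennreal D"
    using assms(2) unfolding Lp_circle_bounded_def by blast
  have "(\<integral>\<^sup>+t. ennreal ((h (of_real r * cis t) + k (of_real r * cis t)) powr p) \<partial>circ) \<le> ennreal (2 powr p * (max C 0 + max D 0))"
    if r: "0 < r" "r < 1" for r
  proof -
    have [measurable]: "(\<lambda>t. h (of_real r * cis t)) \<in> borel_measurable borel" "(\<lambda>t. k (of_real r * cis t)) \<in> borel_measurable borel"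
      by (rule measurable_circle_comp; use r in \<open>auto intro!: continuous_on_subset[OF assms(4)] continuous_on_subset[OF assms(5)]\<close>)+
    have "(\<integral>\<^sup>+t. ennreal ((h (of_real r * cis t) + k (of_real r * cis t)) powr p) \<partial>circ) \<le>
       (\<integral>\<^sup>+t. ennreal (2 powr p) * (ennreal (h (of_real r * cis t) powr p) + ennreal (k (of_real r * cis t) powr p)) \<partial>circ)"
    proof (rule nn_integral_mono)
      fix t
      have "ennreal ((h (of_real r * cis t) + k (of_real r * cis t)) powr p) \<le>
         ennreal (2 powr p * (h (of_real r * cis t) powr p + k (of_real r * cis t) powr p))"
        using assms(3) assms(6)[of "of_real r * cis t"] r by (intro ennreal_leI powr_add_le) (auto simp: norm_mult)
      then show "ennreal ((h (of_real r * cis t) + k (of_real r * cis t)) powr p) \<le>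
         ennreal (2 powr p) * (ennreal (h (of_real r * cis t) powr p) + ennreal (k (of_real r * cis t) powr p))"
        by (simp add: ennreal_mult flip: ennreal_plus)
    qed
    also have "\<dots> = ennreal (2 powr p) * ((\<integral>\<^sup>+t. ennreal (h (of_real r * cis t) powr p) \<partial>circ) + (\<integral>\<^sup>+t. ennreal (k (of_real r * cis t) powr p) \<partial>circ))"
      by (simp add: nn_integral_cmult nn_integral_add)
    also have "\<dots> \<le> ennreal (2 powr p) * (ennreal (max C 0) + ennreal (max D 0))"
      by (intro mult_left_mono add_mono order_trans[OF C[OF r]] order_trans[OF D[OF r]] ennreal_leI) auto
    also have "ennreal (max C 0) + ennreal (max D 0) = ennreal (max C 0 + max D 0)"
      by (rule ennreal_plus[symmetric]) auto
    also have "ennreal (2 powr p) * \<dots> = ennreal (2 powr p * (max C 0 + max D 0))"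
      by (rule ennreal_mult[symmetric]) auto
    finally show ?thesis .
  qed
  then show ?thesis unfolding Lp_circle_bounded_def by blast
qed

lemma carrier_Np:
  "f \<in> carrier (Np p) \<longleftrightarrow> f \<in> extensional unit_disc \<and> f holomorphic_on unit_disc \<and>
     Lp_circle_bounded p (\<lambda>z. log_plus (norm (f z)))"
proof (cases "f \<in> extensional unit_disc \<and> f holomorphic_on unit_disc")
  case True
  define I where "I r = (\<integral>\<^sup>+t. ennreal (log_plus (norm (f (of_real r * cis t))) powr p) \<partial>circ)" for r :: real
  have "(\<integral>\<^sup>+t\<in>{0..2*pi}. ennreal (log_plus (norm (f (of_real r * cis t))) powr p / (2 * pi)) \<partial>lborel) = I r"
    if r: "r \<in> {0<..<1}" for r
  proof -
    have "continuous_on unit_disc (\<lambda>z. log_plus (norm (f z)))"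
      using True holomorphic_on_imp_continuous_on by (intro continuous_log_plus_norm) blast
    then have [measurable]: "(\<lambda>t. log_plus (norm (f (of_real r * cis t)))) \<in> borel_measurable borel"
      by (intro measurable_circle_comp[where f = "\<lambda>z. log_plus (norm (f z))"]) (use r in \<open>auto intro: continuous_on_subset\<close>)
    have "I r = (\<integral>\<^sup>+t\<in>{0..2*pi}. ennreal (log_plus (norm (f (of_real r * cis t))) powr p) \<partial>lborel) / ennreal (2*pi)"
      unfolding I_def by (rule nn_integral_circ) measurable
    also have "\<dots> = (\<integral>\<^sup>+t. (ennreal (log_plus (norm (f (of_real r * cis t))) powr p) * indicator {0..2*pi} t) / ennreal (2*pi) \<partial>lborel)"
      by (rule nn_integral_divide[symmetric]) measurable
    also have "\<dots> = (\<integral>\<^sup>+t\<in>{0..2*pi}. ennreal (log_plus (norm (f (of_real r * cis t))) powr p / (2 * pi)) \<partial>lborel)"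
      by (intro nn_integral_cong) (auto simp: divide_ennreal indicator_def)
    finally show ?thesis ..
  qed
  then have "f \<in> carrier (Np p) \<longleftrightarrow> (SUP r\<in>{0<..<1}. I r) < \<infinity>"
    unfolding Np_def disc_ring_simps using True by simp
  also have "\<dots> \<longleftrightarrow> (\<exists>C. \<forall>r. 0 < r \<and> r < 1 \<longrightarrow> I r \<le> ennreal C)"
  proof
    assume fin: "(SUP r\<in>{0<..<1}. I r) < \<infinity>"
    then obtain C where "(SUP r\<in>{0<..<1}. I r) = ennreal C" by (cases "(SUP r\<in>{0<..<1}. I r)") auto
    then have "I r \<le> ennreal C" if "0 < r" "r < 1" for r
      using SUP_upper[of r "{0<..<1}" I] that by auto
    then show "\<exists>C. \<forall>r. 0 < r \<and> r < 1 \<longrightarrow> I r \<le> ennreal C" by blast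
  next
    assume "\<exists>C. \<forall>r. 0 < r \<and> r < 1 \<longrightarrow> I r \<le> ennreal C"
    then obtain C where "\<And>r. r \<in> {0<..<1} \<Longrightarrow> I r \<le> ennreal C" by auto
    then have "(SUP r\<in>{0<..<1}. I r) \<le> ennreal C" by (rule SUP_least)
    also have "\<dots> < \<infinity>" by simp
    finally show "(SUP r\<in>{0<..<1}. I r) < \<infinity>" .
  qed
  finally show ?thesis using True unfolding I_def Lp_circle_bounded_def by simp
next
  case False
  then show ?thesis unfolding Np_def disc_ring_simps by auto
qed

lemma cring_Np:
  assumes p: "p > 1"
  shows "cring (Np p)"
proof -
  define A where "A = {f. f holomorphic_on unit_disc \<and> Lp_circle_bounded p (\<lambda>z. log_plus (norm (f z)))}"
  have carrier_eq: "carrier (Np p) = carrier (disc_ring A)"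
    unfolding disc_ring_simps A_def using carrier_Np[of _ p] by blast
  have "Np p = disc_ring A"
    using carrier_eq unfolding Np_def disc_ring_def by simp
  moreover have "cring (disc_ring A)"
  proof (rule cring_disc_ring)
    have cont: "continuous_on unit_disc (\<lambda>z. log_plus (norm (f z)))" if "f \<in> A" for f
      using that holomorphic_on_imp_continuous_on unfolding A_def by (intro continuous_log_plus_norm) blast
    have restrict: "(\<lambda>z\<in>unit_disc. f z) \<in> A"
      if "f holomorphic_on unit_disc" "Lp_circle_bounded p h" "\<And>z. norm z < 1 \<Longrightarrow> log_plus (norm (f z)) \<le> h z" for f h
    proof -
      have "(\<lambda>z\<in>unit_disc. f z) holomorphic_on unit_disc"
        by (rule holomorphic_transform[OF that(1)]) simp
      moreover have "Lp_circle_bounded p (\<lambda>z. log_plus (norm ((\<lambda>z\<in>unit_disc. f z) z)))"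
        by (rule Lp_circle_bounded_mono[OF that(2)]) (use p that(3) log_plus_nonneg in auto)
      ultimately show ?thesis unfolding A_def by blast
    qed
    show "(\<lambda>z\<in>unit_disc. c) \<in> A" for c
      by (rule restrict[OF _ Lp_circle_bounded_const[of p "log_plus (norm c)"]]) auto
    fix f g assume f: "f \<in> A" and g: "g \<in> A"
    have fg: "Lp_circle_bounded p (\<lambda>z. log_plus (norm (f z)) + log_plus (norm (g z)))"
      by (rule Lp_circle_bounded_add) (use f g p log_plus_nonneg in \<open>auto simp: A_def intro!: cont\<close>)
    show "(\<lambda>z\<in>unit_disc. f z * g z) \<in> A"
      by (rule restrict[OF _ fg]) (use f g in \<open>auto simp: A_def norm_mult intro!: holomorphic_intros log_plus_mult_le\<close>)
    have "Lp_circle_bounded p (\<lambda>z. (log_plus (norm (f z)) + log_plus (norm (g z))) + ln 2)"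
      by (rule Lp_circle_bounded_add[OF fg Lp_circle_bounded_const])
         (use p log_plus_nonneg in \<open>auto intro!: continuous_intros cont[OF f] cont[OF g] add_nonneg_nonneg\<close>)
    then show "(\<lambda>z\<in>unit_disc. f z + g z) \<in> A"
    proof (rule restrict[rotated])
      show "log_plus (norm (f z + g z)) \<le> (log_plus (norm (f z)) + log_plus (norm (g z))) + ln 2" for z
        by (rule order_trans[OF log_plus_mono[OF norm_ge_zero norm_triangle_ineq] log_plus_add_le]) auto
    qed (use f g in \<open>auto simp: A_def intro!: holomorphic_intros\<close>)
  qed
  ultimately show ?thesis by simp
qed

lemma Hinf_subset_Np:
  assumes p: "p > 1"
  shows "carrier Hinf \<subseteq> carrier (Np p)"
proof
  fix f assume "f \<in> carrier Hinf"
  then have f: "f \<in> extensional unit_disc" "f holomorphic_on unit_disc" "bounded (f ` unit_disc)"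
    by (auto simp: Hinf_def disc_ring_simps)
  obtain B where B: "\<forall>x\<in>f ` unit_disc. norm x \<le> B" using f(3) by (auto simp: bounded_iff)
  have "Lp_circle_bounded p (\<lambda>z. log_plus (norm (f z)))"
    by (rule Lp_circle_bounded_mono[OF Lp_circle_bounded_const[of p "log_plus B"]])
       (use p B in \<open>auto intro!: log_plus_mono log_plus_nonneg\<close>)
  then show "f \<in> carrier (Np p)" unfolding carrier_Np using f by blast
qed

text \<open>
  By the defining formula \<open>log |F|\<close> is the Poisson integral of \<open>log |F*|\<close>, so \<open>log\<^sup>+ |1/F|\<close> is at most
  the Poisson integral of \<open>|log |F*||\<close>, whose \<open>L\<^sup>p\<close> means are bounded by \<open>poisson_Lp_contraction\<close>.
\<close>

theorem outer_function_inverse_in_Np: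
  assumes F: "F \<in> carrier Hinf" and out: "outer_function F" and Lp: "log_boundary_in_Lp p F" and p: "p > 1"
  shows "\<exists>G\<in>carrier (Np p). F \<otimes>\<^bsub>Np p\<^esub> G = \<one>\<^bsub>Np p\<^esub>"
proof -
  define b where "b t = ln (norm (radial_limit F (cis t)))" for t
  have holo: "F holomorphic_on unit_disc" and Lp1: "log_boundary_in_Lp 1 F"
    using out by (auto simp: outer_function_def)
  obtain c where c: "norm c = 1" and F_eq: "\<And>z. z \<in> unit_disc \<Longrightarrow> F z = c * exp (1 / (2 * of_real pi) *
           (\<integral>t. (cis t + z) / (cis t - z) * of_real (b t) \<partial>circle_measure))"
    using out unfolding outer_function_def b_def by blast
  have b: "b \<in> borel_measurable circle_measure" "integrable circle_measure (\<lambda>t. \<bar>b t\<bar> powr p)" "integrable circle_measure (\<lambda>t. \<bar>b t\<bar> powr 1)"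
    using Lp Lp1 by (auto simp: log_boundary_in_Lp_def b_def[abs_def])
  obtain L where L[measurable]: "L \<in> borel_measurable borel" and ae: "AE t in circle_measure. L t = b t"
    using borel_version_circle_measure[OF b(1)] .
  have L_m: "L \<in> borel_measurable circle_measure"
    by (rule measurable_circle_measure_AE[OF L]) simp
  have int_pow: "integrable circ (\<lambda>t. \<bar>L t\<bar> powr q)" if "integrable circle_measure (\<lambda>t. \<bar>b t\<bar> powr q)" for q
  proof -
    have "integrable circle_measure (\<lambda>t. \<bar>L t\<bar> powr q)"
      using that by (rule Bochner_Integration.integrable_cong_AE_imp) (use L_m ae in \<open>auto elim!: eventually_mono\<close>)
    then show ?thesis by (subst integrable_circ_iff) auto
  qed
  have L_int: "integrable circ L"
    using int_pow[OF b(3)] by (subst integrable_abs_iff[symmetric]) auto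
  have norm_F: "norm (F z) = exp (\<integral>t. poisson z t * L t \<partial>circ)" if z: "z \<in> unit_disc" for z
  proof -
    have z1: "norm z < 1" using z by simp
    have K_m: "(\<lambda>t. (cis t + z) / (cis t - z)) \<in> borel_measurable circle_measure"
    proof (rule measurable_circle_measure_AE)
      show "(\<lambda>t. (cis t + z) / (cis t - z)) \<in> borel_measurable borel" by measurable
    qed simp
    have of_real_meas: "(\<lambda>t. complex_of_real (h t)) \<in> borel_measurable circle_measure"
      if "h \<in> borel_measurable circle_measure" for h
      using that by measurable
    have "(\<integral>t. (cis t + z) / (cis t - z) * of_real (b t) \<partial>circle_measure) = (\<integral>t. (cis t + z) / (cis t - z) * of_real (L t) \<partial>circle_measure)"
    proof (rule Bochner_Integration.integral_cong_AE)
      show "(\<lambda>t. (cis t + z) / (cis t - z) * of_real (b t)) \<in> borel_measurable circle_measure"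
        "(\<lambda>t. (cis t + z) / (cis t - z) * of_real (L t)) \<in> borel_measurable circle_measure"
        by (rule borel_measurable_times[OF K_m of_real_meas], rule b L_m)+
    qed (use ae in \<open>auto elim!: eventually_mono\<close>)
    also have "\<dots> = (2 * of_real pi) * (\<integral>t. (cis t + z) / (cis t - z) * of_real (L t) \<partial>circ)"
      by (subst integral_circ) (auto simp: scaleR_conv_of_real)
    finally have "norm (F z) = exp (Re (\<integral>t. (cis t + z) / (cis t - z) * of_real (L t) \<partial>circ))"
      unfolding F_eq[OF z] by (simp add: norm_mult c)
    also have "Re (\<integral>t. (cis t + z) / (cis t - z) * of_real (L t) \<partial>circ) = (\<integral>t. Re ((cis t + z) / (cis t - z) * of_real (L t)) \<partial>circ)"
      by (rule integral_Re[symmetric, OF integrable_schwarz_kernel[OF z1 L_int]])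
    also have "\<dots> = (\<integral>t. poisson z t * L t \<partial>circ)"
    proof -
      have "Re (x * of_real y) = Re x * y" for x y by simp
      then show ?thesis by (simp only: poisson_eq_Re[OF z1])
    qed
    finally show ?thesis .
  qed
  have F_nz: "F z \<noteq> 0" if "z \<in> unit_disc" for z
    using norm_F[OF that] exp_gt_zero by (metis less_irrefl norm_zero)
  define G where "G = (\<lambda>z\<in>unit_disc. inverse (F z))"
  have G_holo: "G holomorphic_on unit_disc"
    by (rule holomorphic_transform[of "\<lambda>z. inverse (F z)"]) (use F_nz holo in \<open>auto intro!: holomorphic_intros simp: G_def\<close>)
  have "(\<integral>\<^sup>+t. ennreal (log_plus (norm (G (of_real r * cis t))) powr p) \<partial>circ) \<le> ennreal (\<integral>t. \<bar>L t\<bar> powr p \<partial>circ)"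
    if r: "0 < r" "r < 1" for r
  proof -
    have "(\<integral>\<^sup>+t. ennreal (log_plus (norm (G (of_real r * cis t))) powr p) \<partial>circ) \<le>
       (\<integral>\<^sup>+t. ennreal ((\<integral>s. poisson (of_real r * cis t) s * \<bar>L s\<bar> \<partial>circ) powr p) \<partial>circ)"
    proof (intro nn_integral_mono ennreal_leI powr_mono2 log_plus_nonneg)
      fix t
      have z: "norm (of_real r * cis t) < 1" using r by (simp add: norm_mult)
      have abs_le: "\<bar>\<integral>s. poisson (of_real r * cis t) s * L s \<partial>circ\<bar> \<le> (\<integral>s. poisson (of_real r * cis t) s * \<bar>L s\<bar> \<partial>circ)"
        using integral_abs_bound[of circ "\<lambda>s. poisson (of_real r * cis t) s * L s"] poisson_nonneg[OF z]
        by (simp add: abs_mult)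
      have "norm (G (of_real r * cis t)) = inverse (norm (F (of_real r * cis t)))"
        using z by (simp add: G_def norm_inverse)
      also have "\<dots> = exp (- (\<integral>s. poisson (of_real r * cis t) s * L s \<partial>circ))"
        using z by (simp add: norm_F exp_minus)
      finally have "log_plus (norm (G (of_real r * cis t))) = max (- (\<integral>s. poisson (of_real r * cis t) s * L s \<partial>circ)) 0"
        by (simp add: log_plus_def)
      then show "log_plus (norm (G (of_real r * cis t))) \<le> (\<integral>s. poisson (of_real r * cis t) s * \<bar>L s\<bar> \<partial>circ)"
        using abs_le by linarith
    qed (use p in auto)
    also have "\<dots> \<le> (\<integral>\<^sup>+t. ennreal (\<bar>L t\<bar> powr p) \<partial>circ)"
      by (rule poisson_Lp_contraction) (use r p L_int in auto)
    also have "\<dots> = ennreal (\<integral>t. \<bar>L t\<bar> powr p \<partial>circ)"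
      by (rule nn_integral_eq_integral[OF int_pow[OF b(2)]]) simp
    finally show ?thesis .
  qed
  then have "Lp_circle_bounded p (\<lambda>z. log_plus (norm (G z)))" unfolding Lp_circle_bounded_def by blast
  then have "G \<in> carrier (Np p)"
    unfolding carrier_Np using G_holo by (simp add: G_def)
  moreover have "F \<otimes>\<^bsub>Np p\<^esub> G = \<one>\<^bsub>Np p\<^esub>"
    unfolding Np_def disc_ring_simps by (rule restrict_ext) (use F_nz in \<open>auto simp: G_def\<close>)
  ultimately show ?thesis by blast
qed

text \<open>
  The denominators are the bounded outer functions with logarithm in \<open>L\<^sup>p\<close>: they are units of \<open>N\<^sup>p\<close> by
  \<open>outer_function_inverse_in_Np\<close>, and \<open>outer_denominator\<close> supplies one for every element of \<open>N\<^sup>p\<close>.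
\<close>

theorem theorem3:
  fixes p :: real and P :: "(complex \<Rightarrow> complex) set"
  assumes "1 < p" and "primeideal P Hinf"
  shows "((\<exists>Q. primeideal Q (Np p) \<and> P = Q \<inter> carrier Hinf) \<longleftrightarrow>
            \<not> (\<exists>F\<in>P. outer_function F \<and> log_boundary_in_Lp p F)) \<and>
         (\<forall>Q. primeideal Q (Np p) \<and> P = Q \<inter> carrier Hinf \<longrightarrow>
            (\<forall>Q'. primeideal Q' (Np p) \<and> P = Q' \<inter> carrier Hinf \<longrightarrow> Q' = Q) \<and>
            Q = genideal (Np p) P)"
proof -
  interpret P: primeideal P Hinf by fact
  define S where "S = {F \<in> carrier Hinf. outer_function F \<and> log_boundary_in_Lp p F}"
  have "((\<exists>Q. primeideal Q (Np p) \<and> P = Q \<inter> carrier Hinf) \<longleftrightarrow> P \<inter> S = {}) \<and>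
         (\<forall>Q. primeideal Q (Np p) \<and> P = Q \<inter> carrier Hinf \<longrightarrow>
            (\<forall>Q'. primeideal Q' (Np p) \<and> P = Q' \<inter> carrier Hinf \<longrightarrow> Q' = Q) \<and> Q = genideal (Np p) P)"
  proof (rule prime_contraction_localization)
    show "primeideal P Hinf" by fact
    show "cring Hinf" by (rule P.cring_axioms)
    show "cring (Np p)" by (rule cring_Np[OF assms(1)])
    show "carrier Hinf \<subseteq> carrier (Np p)" by (rule Hinf_subset_Np[OF assms(1)])
    show "S \<subseteq> carrier Hinf" by (auto simp: S_def)
    show "\<exists>G\<in>carrier (Np p). F \<otimes>\<^bsub>Np p\<^esub> G = \<one>\<^bsub>Np p\<^esub>" if "F \<in> S" for F
      using that outer_function_inverse_in_Np assms(1) unfolding S_def by blast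
    fix f assume "f \<in> carrier (Np p)"
    then have f: "f holomorphic_on unit_disc" "Lp_circle_bounded p (\<lambda>z. log_plus (norm (f z)))"
      unfolding carrier_Np by auto
    obtain C where C: "\<And>r. 0 < r \<Longrightarrow> r < 1 \<Longrightarrow> (\<integral>\<^sup>+t. ennreal (log_plus (norm (f (of_real r * cis t))) powr p) \<partial>circ) \<le> ennreal C"
      using f(2) unfolding Lp_circle_bounded_def by blast
    obtain F where F: "F \<in> extensional unit_disc" "F holomorphic_on unit_disc"
        "\<And>z. z \<in> unit_disc \<Longrightarrow> norm (F z) \<le> 1" "\<And>z. z \<in> unit_disc \<Longrightarrow> norm (f z * F z) \<le> 1"
        "outer_function F" "log_boundary_in_Lp p F"
    proof (rule outer_denominator[OF f(1) assms(1)])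
      show "(\<integral>\<^sup>+t. ennreal (log_plus (norm (f (of_real r * cis t))) powr p) \<partial>circ) \<le> ennreal C"
        if "0 < r" "r < 1" for r by (rule C[OF that])
    qed (rule that)
    have "F \<in> carrier Hinf"
      unfolding Hinf_def disc_ring_simps using F(1,2,3) by (auto intro!: boundedI[of _ 1])
    moreover have "f \<otimes>\<^bsub>Np p\<^esub> F \<in> carrier Hinf"
    proof -
      have "(\<lambda>z\<in>unit_disc. f z * F z) holomorphic_on unit_disc"
        by (rule holomorphic_transform[of "\<lambda>z. f z * F z"]) (auto intro!: holomorphic_intros f F)
      then show ?thesis
        unfolding Hinf_def Np_def disc_ring_simps using F(4) by (auto intro!: boundedI[of _ 1])
    qed
    ultimately show "\<exists>F\<in>S. f \<otimes>\<^bsub>Np p\<^esub> F \<in> carrier Hinf" unfolding S_def using F by blast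
  qed (auto simp: Hinf_def Np_def disc_ring_def)
  moreover have "P \<inter> S = {} \<longleftrightarrow> \<not> (\<exists>F\<in>P. outer_function F \<and> log_boundary_in_Lp p F)"
    using P.a_subset unfolding S_def by blast
  ultimately show ?thesis by simp
qed

end
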